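(* Let $\beta\in(0,1/2)$. Let $A$ be a real $n\times n$ matrix with all its eigenvalues in $\{z\in\mathbb{C}:\mathrm{Re}(z)<0\}$, let $b\in\mathbb{R}^n$, $e_1=(1,0,\dots,0)^T\in\mathbb{R}^n$, and let $f(u)=b^Te^{Au}e_1$ for $u\ge0$. Then the function $D^\beta f:\mathbb{R}\to\mathbb{R}$ defined by $D^\beta f(t)=0$ for $t\le0$ and $$D^\beta f(t)=\frac{1}{\Gamma(1-\beta)}b^T\left(Ae^{At}\int_0^te^{-Au}u^{-\beta}\,du+t^{-\beta}I_n\right)e_1$$ for $t>0$ belongs to $L^1\cap L^2$. Suppose in addition that $\kappa\in\mathbb{R}$ satisfies $\kappa+b^TA^{-1}e_1\ne0$ and that $$Q(z)\big[z+\kappa z^\beta\big]+R(z)z^\beta\ne0\quad\text{for all } z\in\mathbb{C}\setminus\{0\}\text{ with }\mathrm{Re}(z)\ge0,$$ where $Q$ and $R$ are the real polynomials without common roots, $Q$ monic and of larger degree than $R$, such that $\mathcal{F}[f](y)=-b^T(A+iyI_n)^{-1}e_1=-R(-iy)/Q(-iy)$ for $y\in\mathbb{R}$. Let $(L_t)_{t\in\mathbb{R}}$ be a two-sided Lévy process with $\mathbb{E}[L_1]=0$ and $\mathbb{E}[L_1^2]=1$, and let $(X_t)_{t\in\mathbb{R}}$ be the process $X_t=\int_{-\infty}^tg(t-u)\,dL_u$, where $g:\mathbb{R}\to\mathbb{R}$ is the function in $L^2$, vanishing on $(-\infty,0)$, with $$\mathcal{F}[g](y)=\frac{Q(-iy)}{Q(-iy)\big[-iy+\kappa(-iy)^\beta\big]+R(-iy)(-iy)^\beta},\quad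 y\in\mathbb{R}.$$ Then $$\int_0^\infty D^\beta X_{t-u}\,f(u)\,du=\int_0^\infty X_{t-u}\,D^\beta f(u)\,du$$ almost surely for any $t\in\mathbb{R}$.
   Context: Complex powers: $z^\gamma=r^\gamma e^{i\gamma\theta}$ for $z=re^{i\theta}$, $r>0$, $\theta\in(-\pi,\pi]$ (principal branch). $f$ is taken to be $0$ on $(-\infty,0)$. The Fourier transform is $\mathcal{F}[\phi](y)=\int_{\mathbb{R}}e^{iyu}\phi(u)\,du$ for $\phi\in L^1$ and is extended to $L^2$ by Plancherel's theorem. The pair $(Q,R)$ exists and is unique, and the roots of $Q$ are eigenvalues of $A$. Under the stated conditions $g$ exists and is unique in $L^2$, and $(X_t)$ is the unique purely non-deterministic stationary solution of $X_t-X_s=\int_{-\infty}^t\frac{1}{\Gamma(1-\beta)}\big[(t-u)_+^{-\beta}-(s-u)_+^{-\beta}\big]\int_{[0,\infty)}X_{u-v}\,\eta(dv)\,du+L_t-L_s$ ($s<t$) with $\eta(du)=-\kappa\,\delta_0(du)+f(u)\,du$ on $[0,\infty)$, where $\delta_0$ is the Dirac measure at $0$ and $x_+=\max\{x,0\}$. The process $(D^\beta X_t)_{t\in\mathbb{R}}$ is defined by the limit in $L^2(\mathbb{P})$ $$D^\beta X_t=\frac{\beta}{\Gamma(1-\beta)}\lim_{\delta\downarrow0}\int_\delta^\infty\frac{X_t-X_{t-u}}{u^{1+\beta}}\,du,$$ which exists for every $t\in\mathbb{R}$. A two-sided Lévy process is $L_t=L^1_t$ for $t\ge0$ and $L_t=-L^2_{(-t)-}$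 for $t<0$, where $(L^1_t)_{t\ge0}$ is a one-sided Lévy process and $L^2$ is an independent copy of it. For $\phi\in L^2$, $\int_{\mathbb{R}}\phi\,dL$ is the $L^2(\mathbb{P})$-limit of integrals of step functions, with $\mathbb{E}[(\int \phi\,dL)^2]=\mathbb{E}[L_1^2]\int \phi(u)^2\,du$. *)

theory Defs
  imports "HOL-Probability.Probability" "HOL-Computational_Algebra.Polynomial"
begin

text \<open>Vectors are indexed by a finite linearly ordered type, whose least element plays the role of
  the index 1, so that \<open>e1\<close> is \<open>(1, 0, \<dots>, 0)\<close>.\<close>

definition e1 :: "'a::zero_neq_one ^ 'n::{finite,linorder}" where
  "e1 = axis (Min UNIV) 1"

definition cvec :: "real ^ 'n \<Rightarrow> complex ^ 'n" where
  "cvec v = (\<chi> i. complex_of_real (v $ i))"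

definition cmat :: "real ^ 'n ^ 'n \<Rightarrow> complex ^ 'n ^ 'n" where
  "cmat A = map_matrix complex_of_real A"

definition eigenvalue :: "complex ^ 'n ^ 'n \<Rightarrow> complex \<Rightarrow> bool" where
  "eigenvalue A z \<longleftrightarrow> (\<exists>v. v \<noteq> 0 \<and> A *v v = z *s v)"

fun mat_power :: "'a::semiring_1 ^ 'n ^ 'n \<Rightarrow> nat \<Rightarrow> 'a ^ 'n ^ 'n" where
  "mat_power A 0 = mat 1"
| "mat_power A (Suc k) = A ** mat_power A k"

definition mat_exp :: "real ^ 'n ^ 'n \<Rightarrow> real ^ 'n ^ 'n" where
  "mat_exp A = (\<Sum>k. (1 / fact k) *\<^sub>R mat_power A k)"

definition exp_kernel ::
    "real ^ 'n::{finite,linorder} ^ 'n::{finite,linorder} \<Rightarrow> real ^ 'n::{finite,linorder} \<Rightarrow> real \<Rightarrow> real" where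
  "exp_kernel A b u = (if u \<ge> 0 then b \<bullet> (mat_exp (u *\<^sub>R A) *v e1) else 0)"

definition exp_kernel_frac_deriv ::
    "real \<Rightarrow> real ^ 'n::{finite,linorder} ^ 'n::{finite,linorder} \<Rightarrow> real ^ 'n::{finite,linorder} \<Rightarrow> real \<Rightarrow> real" where
  "exp_kernel_frac_deriv \<beta> A b t =
     (if t > 0 then
        1 / Gamma (1 - \<beta>) *
        (b \<bullet> ((A ** mat_exp (t *\<^sub>R A)
                 ** (LBINT u:{0..t}. (u powr (- \<beta>)) *\<^sub>R mat_exp (- (u *\<^sub>R A)))
               + (t powr (- \<beta>)) *\<^sub>R mat 1) *v e1))
      else 0)"

definition in_L2 :: "'a measure \<Rightarrow> ('a \<Rightarrow> 'b::{real_normed_vector,second_countable_topology}) \<Rightarrow> bool" where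
  "in_L2 M f \<longleftrightarrow> f \<in> borel_measurable M \<and> integrable M (\<lambda>x. (norm (f x))\<^sup>2)"

definition L2_tendsto ::
    "'a measure \<Rightarrow> ('i \<Rightarrow> 'a \<Rightarrow> 'b::real_normed_vector) \<Rightarrow> ('a \<Rightarrow> 'b) \<Rightarrow> 'i filter \<Rightarrow> bool" where
  "L2_tendsto M F f \<FF> \<longleftrightarrow>
     ((\<lambda>k. \<integral>\<^sup>+ x. ennreal ((norm (F k x - f x))\<^sup>2) \<partial>M) \<longlongrightarrow> 0) \<FF>"

definition fourier :: "(real \<Rightarrow> real) \<Rightarrow> real \<Rightarrow> complex" where
  "fourier \<phi> y = (LBINT u. exp (\<i> * of_real (y * u)) * of_real (\<phi> u))"

text \<open>The continuous extension of \<open>fourier\<close> from the dense subspace \<open>L\<^sup>1 \<inter> L\<^sup>2\<close> to \<open>L\<^sup>2\<close>.  It is a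
  relation because the transform is only determined almost everywhere; by Plancherel's theorem it
  does not matter which approximating sequence is chosen.\<close>

definition has_fourier_L2 :: "(real \<Rightarrow> real) \<Rightarrow> (real \<Rightarrow> complex) \<Rightarrow> bool" where
  "has_fourier_L2 g h \<longleftrightarrow> in_L2 lborel g \<and> in_L2 lborel h \<and>
     (\<exists>\<phi> :: nat \<Rightarrow> real \<Rightarrow> real.
        (\<forall>k. integrable lborel (\<phi> k) \<and> in_L2 lborel (\<phi> k)) \<and>
        L2_tendsto lborel \<phi> g sequentially \<and>
        L2_tendsto lborel (\<lambda>k. fourier (\<phi> k)) h sequentially)"

definition cadlag :: "(real \<Rightarrow> real) \<Rightarrow> bool" where
  "cadlag p \<longleftrightarrow> (\<forall>t\<ge>0. continuous (at_right t) p \<and> (t > 0 \<longrightarrow> (\<exists>l. (p \<longlongrightarrow> l) (at_left t))))"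

text \<open>Only the values at times \<open>t \<ge> 0\<close> matter.\<close>

definition levy_process :: "'w measure \<Rightarrow> (real \<Rightarrow> 'w \<Rightarrow> real) \<Rightarrow> bool" where
  "levy_process M L \<longleftrightarrow> prob_space M \<and>
     (\<forall>t\<ge>0. L t \<in> borel_measurable M) \<and>
     (AE \<omega> in M. L 0 \<omega> = 0) \<and>
     (\<forall>(n::nat) (t::nat \<Rightarrow> real). 0 \<le> t 0 \<longrightarrow> mono t \<longrightarrow>
        prob_space.indep_vars M (\<lambda>_. borel) (\<lambda>i \<omega>. L (t (Suc i)) \<omega> - L (t i) \<omega>) {..<n}) \<and>
     (\<forall>s\<ge>0. \<forall>h\<ge>0. distr M borel (\<lambda>\<omega>. L (s + h) \<omega> - L s \<omega>) = distr M borel (L h)) \<and>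
     (AE \<omega> in M. cadlag (\<lambda>t. L t \<omega>))"

definition path_space :: "(real \<Rightarrow> real) measure" where
  "path_space = Pi\<^sub>M {0..} (\<lambda>_. borel)"

definition process_path :: "(real \<Rightarrow> 'w \<Rightarrow> real) \<Rightarrow> 'w \<Rightarrow> (real \<Rightarrow> real)" where
  "process_path L \<omega> = (\<lambda>t\<in>{0..}. L t \<omega>)"

definition two_sided_levy_process :: "'w measure \<Rightarrow> (real \<Rightarrow> 'w \<Rightarrow> real) \<Rightarrow> bool" where
  "two_sided_levy_process M L \<longleftrightarrow>
     (\<forall>t. L t \<in> borel_measurable M) \<and>
     (\<exists>L1 L2. levy_process M L1 \<and> levy_process M L2 \<and>
        distr M path_space (process_path L2) = distr M path_space (process_path L1) \<and>
        prob_space.indep_var M path_space (process_path L1) path_space (process_path L2) \<and>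
        (AE \<omega> in M. \<forall>t. L t \<omega> =
           (if t \<ge> 0 then L1 t \<omega> else - Lim (at_left (- t)) (\<lambda>s. L2 s \<omega>))))"

text \<open>A list of triples \<open>(c, r, s)\<close> with \<open>r \<le> s\<close> represents the step function
  \<open>\<Sum> c * 1\<^bsub>(r, s]\<^esub>\<close>.\<close>

type_synonym step = "(real \<times> real \<times> real) list"

definition step_valid :: "step \<Rightarrow> bool" where
  "step_valid S \<longleftrightarrow> (\<forall>(c, r, s) \<in> set S. r \<le> s)"

definition step_fun :: "step \<Rightarrow> real \<Rightarrow> real" where
  "step_fun S u = (\<Sum>(c, r, s) \<leftarrow> S. c * indicator {r<..s} u)"

definition step_integral :: "(real \<Rightarrow> 'w \<Rightarrow> real) \<Rightarrow> step \<Rightarrow> 'w \<Rightarrow> real" where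
  "step_integral L S \<omega> = (\<Sum>(c, r, s) \<leftarrow> S. c * (L s \<omega> - L r \<omega>))"

text \<open>\<open>Y\<close> is a version of \<open>\<integral> \<phi> dL\<close>.\<close>

definition has_levy_integral ::
    "'w measure \<Rightarrow> (real \<Rightarrow> 'w \<Rightarrow> real) \<Rightarrow> (real \<Rightarrow> real) \<Rightarrow> ('w \<Rightarrow> real) \<Rightarrow> bool" where
  "has_levy_integral M L \<phi> Y \<longleftrightarrow> in_L2 lborel \<phi> \<and> in_L2 M Y \<and>
     (\<exists>S :: nat \<Rightarrow> step. (\<forall>k. step_valid (S k)) \<and>
        L2_tendsto lborel (\<lambda>k. step_fun (S k)) \<phi> sequentially \<and>
        L2_tendsto M (\<lambda>k. step_integral L (S k)) Y sequentially)"

text \<open>\<open>Y\<close> is a version of \<open>D\<^sup>\<beta> X\<^sub>t\<close>.\<close>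

definition has_frac_deriv ::
    "'w measure \<Rightarrow> real \<Rightarrow> (real \<Rightarrow> 'w \<Rightarrow> real) \<Rightarrow> real \<Rightarrow> ('w \<Rightarrow> real) \<Rightarrow> bool" where
  "has_frac_deriv M \<beta> X t Y \<longleftrightarrow> in_L2 M Y \<and>
     L2_tendsto M
       (\<lambda>\<delta> \<omega>. \<beta> / Gamma (1 - \<beta>) * (LBINT u:{\<delta>..}. (X t \<omega> - X (t - u) \<omega>) / u powr (1 + \<beta>)))
       Y (at_right 0)"

text \<open>Random variables such as \<open>X\<^sub>t\<close> and \<open>D\<^sup>\<beta> X\<^sub>t\<close> are only defined up to null sets for each \<open>t\<close>.
  Integrals over \<open>t\<close> are taken pathwise, which requires jointly measurable versions.\<close>

definition measurable_process :: "'w measure \<Rightarrow> (real \<Rightarrow> 'w \<Rightarrow> real) \<Rightarrow> bool" where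
  "measurable_process M X \<longleftrightarrow> (\<lambda>(t, \<omega>). X t \<omega>) \<in> borel_measurable (borel \<Otimes>\<^sub>M M)"

end

theory Submission
  imports Defs "HOL-Computational_Algebra.Fundamental_Theorem_Algebra"
begin

text \<open>
  Write \<open>f\<close> for the kernel \<open>exp_kernel A b\<close>, \<open>w\<^sub>\<delta>(u) = \<beta> / \<Gamma>(1 - \<beta>) u\<^sup>-\<^sup>1\<^sup>-\<^sup>\<beta>\<close> for
  \<open>u \<ge> \<delta>\<close>, and \<open>T\<^sub>\<delta> x(t) = \<integral> (x(t) - x(t - u)) w\<^sub>\<delta>(u) du\<close>.  The operator \<open>T\<^sub>\<delta>\<close> has an
  integrable weight, so Fubini's theorem and a translation give, path by path,
  \<open>\<integral> T\<^sub>\<delta> X(t - v) f(v) dv = \<integral> X(t - v) T\<^sub>\<delta> f(v) dv\<close> (\<open>weighted_transpose\<close>).  The theorem is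
  the limit \<open>\<delta> \<rightarrow> 0\<close> of this identity in \<open>L\<^sup>1(M)\<close>, and each side needs one idea.

  On the right, \<open>X\<close> has bounded first moments, so it is enough that \<open>T\<^sub>\<delta> f\<close> tends to
  \<open>exp_kernel_frac_deriv\<close> in \<open>L\<^sup>1\<close>.  By the spectral assumption \<open>f\<close> and its derivative decay
  exponentially, whence \<open>\<integral> \<bar>f(t) - f(t - u)\<bar> dt\<close> is at most a constant times \<open>min u 1\<close>
  (\<open>L1_modulus\<close>).  This is integrable against \<open>w\<^sub>0\<close>, so \<open>T\<^sub>0 f\<close> exists in \<open>L\<^sup>1\<close> and is the limit
  of \<open>T\<^sub>\<delta> f\<close>; integration by parts identifies it with the closed formula
  (\<open>increment_integral_eq\<close>).  The singularity of the formula at \<open>0\<close> is of order \<open>t\<^sup>-\<^sup>\<beta>\<close>, which is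
  square integrable because \<open>\<beta> < 1/2\<close>.

  The decay of \<open>e\<^sup>t\<^sup>A v\<close> is proved without a normal form: \<open>v, A v, A\<^sup>2 v, \<dots>\<close> are linearly
  dependent, so a product of factors \<open>A - l\<close> annihilates \<open>v\<close>, and the factors are removed one at
  a time by a scalar differential equation or by inverting \<open>A - l\<close>.

  On the left, \<open>T\<^sub>\<delta> X\<^sub>s\<close> tends to \<open>D\<^sup>\<beta> X\<^sub>s\<close> in \<open>L\<^sup>2(M)\<close> for each \<open>s\<close>, but integration over \<open>s\<close>
  requires a bound that is uniform in \<open>s\<close>.  Stationarity provides it: the second moment of
  \<open>T\<^sub>\<delta> X\<^sub>s - T\<^sub>\<delta>\<^sub>' X\<^sub>s\<close> is a double integral of covariances of \<open>X\<close>, which depend only on time lags,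
  so the Cauchy property at \<open>s = 0\<close> is a Cauchy property uniformly in \<open>s\<close>
  (\<open>weighted_limit_uniform\<close>).

  The covariances are computed from the isometry \<open>E (\<integral> \<phi> dL \<integral> \<psi> dL) = \<integral> \<phi> \<psi>\<close>, which rests on
  \<open>E (L\<^sub>s - L\<^sub>t)\<^sup>2 = \<bar>s - t\<bar>\<close> for all real \<open>s, t\<close>.  For this, \<open>L\<^sub>t\<close> is square integrable as an
  independent summand of \<open>L\<^sub>n\<close>, its variance and mean are additive in \<open>t\<close>, and both are small near
  \<open>0\<close>: the variance by monotonicity, the mean by right continuity of the paths.
\<close>

section \<open>The matrix exponential\<close>

lemma mat_power_commute: "mat_power A k ** A = A ** mat_power A k"
  by (induction k) (simp_all add: matrix_mul_assoc[symmetric])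

lemma mat_power_scaleR:
  fixes A :: "real ^ 'n ^ 'n"
  shows "mat_power (c *\<^sub>R A) k = c ^ k *\<^sub>R mat_power A k"
  by (induction k) (simp_all add: vec_eq_iff matrix_matrix_mult_def sum_distrib_left mult_ac)

lemma abs_mat_power_entry_le:
  fixes A :: "real ^ 'n ^ 'n"
  shows "\<bar>mat_power A k $ i $ j\<bar> \<le> (\<Sum>i\<in>UNIV. \<Sum>j\<in>UNIV. \<bar>A $ i $ j\<bar>) ^ k"
proof (induction k arbitrary: i j)
  case 0
  then show ?case by (simp add: mat_def)
next
  case (Suc k)
  let ?C = "\<Sum>i\<in>UNIV. \<Sum>j\<in>UNIV. \<bar>A $ i $ j\<bar>"
  have C: "?C \<ge> 0" by (intro sum_nonneg) auto
  have "\<bar>mat_power A (Suc k) $ i $ j\<bar> = \<bar>\<Sum>l\<in>UNIV. A $ i $ l * mat_power A k $ l $ j\<bar>"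
    by (simp add: matrix_matrix_mult_def)
  also have "\<dots> \<le> (\<Sum>l\<in>UNIV. \<bar>A $ i $ l\<bar> * ?C ^ k)"
    by (rule order_trans[OF sum_abs]) (auto simp: abs_mult intro!: sum_mono mult_left_mono Suc)
  also have "\<dots> = (\<Sum>l\<in>UNIV. \<bar>A $ i $ l\<bar>) * ?C ^ k"
    by (simp add: sum_distrib_right)
  also have "\<dots> \<le> ?C * ?C ^ k"
    using C by (intro mult_right_mono member_le_sum sum_nonneg) auto
  finally show ?case by simp
qed

lemma sums_vecI:
  fixes f :: "nat \<Rightarrow> 'a::real_normed_vector ^ 'n"
  assumes "\<And>i. (\<lambda>k. f k $ i) sums (x $ i)"
  shows "f sums x"
  using assms unfolding sums_def by (intro vec_tendstoI) simp

lemma summable_mat_power_entry: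
  fixes A :: "real ^ 'n ^ 'n"
  shows "summable (\<lambda>k. mat_power A k $ i $ j / fact k * t ^ k)"
proof (rule summable_comparison_test')
  let ?C = "\<Sum>i\<in>UNIV. \<Sum>j\<in>UNIV. \<bar>A $ i $ j\<bar>"
  show "summable (\<lambda>k. inverse (fact k) * (?C * \<bar>t\<bar>) ^ k)"
    by (rule summable_exp)
  show "norm (mat_power A k $ i $ j / fact k * t ^ k) \<le> inverse (fact k) * (?C * \<bar>t\<bar>) ^ k" for k
    using mult_right_mono[OF abs_mat_power_entry_le[of A k i j], of "\<bar>t\<bar> ^ k / fact k"]
    by (simp add: abs_mult power_abs power_mult_distrib field_simps)
qed

lemma mat_exp_entry:
  fixes A :: "real ^ 'n ^ 'n"
  shows "mat_exp (t *\<^sub>R A) $ i $ j = (\<Sum>k. mat_power A k $ i $ j / fact k * t ^ k)"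
proof -
  define E where "E = (\<chi> i j. \<Sum>k. mat_power A k $ i $ j / fact k * t ^ k)"
  have "(\<lambda>k. (1 / fact k) *\<^sub>R mat_power (t *\<^sub>R A) k) sums E"
  proof (intro sums_vecI)
    fix i j
    show "(\<lambda>k. ((1 / fact k) *\<^sub>R mat_power (t *\<^sub>R A) k) $ i $ j) sums (E $ i $ j)"
      using summable_sums[OF summable_mat_power_entry[of A i j t]]
      by (simp add: E_def mat_power_scaleR mult_ac)
  qed
  then have "mat_exp (t *\<^sub>R A) = E" unfolding mat_exp_def by (rule sums_unique[symmetric])
  then show ?thesis by (simp add: E_def)
qed

lemma mat_exp_zero: "mat_exp 0 = (mat 1 :: real ^ 'n ^ 'n)"
proof -
  have "mat_exp (0 *\<^sub>R mat 1) = (mat 1 :: real ^ 'n ^ 'n)"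
    unfolding vec_eq_iff mat_exp_entry by (subst powser_zero) simp
  then show ?thesis by simp
qed

lemma mat_exp_entry_deriv:
  fixes A :: "real ^ 'n ^ 'n"
  shows "((\<lambda>t. mat_exp (t *\<^sub>R A) $ i $ j) has_real_derivative (A ** mat_exp (t *\<^sub>R A)) $ i $ j) (at
      t)"
proof -
  let ?c = "\<lambda>i k. mat_power A k $ i $ j / fact k"
  have d: "diffs (?c i) k * t ^ k = (\<Sum>l\<in>UNIV. A $ i $ l * (?c l k * t ^ k))" for k
    by (simp add: diffs_def matrix_matrix_mult_def sum_divide_distrib sum_distrib_right
        sum_distrib_left field_simps fact_Suc del: of_nat_Suc)
  have "((\<lambda>t. \<Sum>k. ?c i k * t ^ k) has_real_derivative (\<Sum>k. diffs (?c i) k * t ^ k)) (at t)"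
    by (intro termdiffs_strong_converges_everywhere summable_mat_power_entry)
  also have "(\<Sum>k. diffs (?c i) k * t ^ k) = (\<Sum>k. \<Sum>l\<in>UNIV. A $ i $ l * (?c l k * t ^ k))"
    by (simp only: d)
  also have "\<dots> = (\<Sum>l\<in>UNIV. \<Sum>k. A $ i $ l * (?c l k * t ^ k))"
    by (intro suminf_sum summable_mult summable_mat_power_entry)
  also have "\<dots> = (A ** mat_exp (t *\<^sub>R A)) $ i $ j"
    by (simp only: matrix_matrix_mult_def mat_exp_entry vec_lambda_beta
        suminf_mult[OF summable_mat_power_entry])
  finally show ?thesis by (simp add: mat_exp_entry)
qed

lemma mat_exp_commute:
  fixes A :: "real ^ 'n ^ 'n"
  shows "mat_exp (t *\<^sub>R A) ** A = A ** mat_exp (t *\<^sub>R A)"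
proof -
  have "(\<Sum>l\<in>UNIV. mat_exp (t *\<^sub>R A) $ i $ l * A $ l $ j)
      = (\<Sum>l\<in>UNIV. A $ i $ l * mat_exp (t *\<^sub>R A) $ l $ j)" for i j
  proof -
    have *: "(\<Sum>l\<in>UNIV. mat_power A k $ i $ l / fact k * t ^ k * A $ l $ j)
        = (\<Sum>l\<in>UNIV. A $ i $ l * (mat_power A k $ l $ j / fact k * t ^ k))" for k
    proof -
      have "(\<Sum>l\<in>UNIV. mat_power A k $ i $ l * A $ l $ j)
        = (\<Sum>l\<in>UNIV. A $ i $ l * mat_power A k $ l $ j)"
        using arg_cong[OF mat_power_commute[of A k], of "\<lambda>M. M $ i $ j"]
        by (simp add: matrix_matrix_mult_def)
      then have "(\<Sum>l\<in>UNIV. mat_power A k $ i $ l * A $ l $ j) * (t ^ k / fact k)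
        = (\<Sum>l\<in>UNIV. A $ i $ l * mat_power A k $ l $ j) * (t ^ k / fact k)" by simp
      then show ?thesis
        unfolding sum_distrib_right
            by (simp only: mult_ac times_divide_eq_right times_divide_eq_left mult_1)
    qed
    have "(\<Sum>l\<in>UNIV. mat_exp (t *\<^sub>R A) $ i $ l * A $ l $ j)
      = (\<Sum>k. \<Sum>l\<in>UNIV. mat_power A k $ i $ l / fact k * t ^ k * A $ l $ j)"
      by (subst suminf_sum)
        (simp_all only: mat_exp_entry suminf_mult2[OF summable_mat_power_entry]
          summable_mult2 summable_mat_power_entry)
    also have "\<dots> = (\<Sum>k. \<Sum>l\<in>UNIV. A $ i $ l * (mat_power A k $ l $ j / fact k * t ^ k))"
      by (simp only: *)
    also have "\<dots> = (\<Sum>l\<in>UNIV. A $ i $ l * mat_exp (t *\<^sub>R A) $ l $ j)"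
      by (subst suminf_sum)
        (simp_all only: mat_exp_entry suminf_mult[OF summable_mat_power_entry]
          summable_mult summable_mat_power_entry)
    finally show ?thesis .
  qed
  then show ?thesis by (simp add: vec_eq_iff matrix_matrix_mult_def)
qed

text \<open>For fixed \<open>s + t\<close> the product \<open>e\<^sup>s\<^sup>A e\<^sup>t\<^sup>A\<close> has derivative zero in \<open>s\<close>.\<close>

lemma mat_exp_add:
  fixes A :: "real ^ 'n ^ 'n"
  shows "mat_exp (s *\<^sub>R A) ** mat_exp (t *\<^sub>R A) = mat_exp ((s + t) *\<^sub>R A)"
proof -
  define P where "P i j u = (mat_exp (u *\<^sub>R A) ** mat_exp ((s + t - u) *\<^sub>R A)) $ i $ j" for i j u
  have "(P i j has_real_derivative 0) (at u)" for i j u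
  proof -
    let ?E = "\<lambda>u. mat_exp (u *\<^sub>R A)"
    have inner: "((\<lambda>u. ?E (s + t - u) $ l $ j) has_real_derivative - (A ** ?E (s
        + t - u)) $ l $ j) (at u)"
      for l
    proof -
      have "((\<lambda>u. s + t - u) has_real_derivative -1) (at u)"
        by (auto intro!: derivative_eq_intros)
      from DERIV_chain2[where f = "\<lambda>t. mat_exp (t *\<^sub>R A) $ l $ j" and g = "\<lambda>u. s + t - u",
          OF mat_exp_entry_deriv this]
      show ?thesis by simp
    qed
    have "((\<lambda>u. \<Sum>l\<in>UNIV. ?E u $ i $ l * ?E (s + t - u) $ l $ j) has_real_derivative
        (\<Sum>l\<in>UNIV. (A ** ?E u) $ i $ l * ?E (s + t - u) $ l $ j
           + - (A ** ?E (s + t - u)) $ l $ j * ?E u $ i $ l)) (at u)"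
      by (intro DERIV_sum DERIV_mult mat_exp_entry_deriv inner)
    also have "(\<Sum>l\<in>UNIV. (A ** ?E u) $ i $ l * ?E (s + t - u) $ l $ j
           + - (A ** ?E (s + t - u)) $ l $ j * ?E u $ i $ l)
       = ((A ** ?E u) ** ?E (s + t - u)) $ i $ j - (?E u ** (A ** ?E (s + t - u))) $ i $ j"
      by (simp add: matrix_matrix_mult_def[of "A ** ?E u"] matrix_matrix_mult_def[of "?E u"]
          sum_subtractf mult.commute)
    also have "\<dots> = 0"
      by (simp only: mat_exp_commute[symmetric, of A u] matrix_mul_assoc diff_self)
    finally show ?thesis by (simp add: P_def[abs_def] matrix_matrix_mult_def[of "?E _"])
  qed
  then have "P i j s = P i j 0" for i j by (intro DERIV_isconst_all) auto
  then show ?thesis by (simp add: vec_eq_iff P_def mat_exp_zero)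
qed

section \<open>Exponential decay for matrices with spectrum in the left half-plane\<close>

definition exp_decay :: "(real \<Rightarrow> 'a::real_normed_vector) \<Rightarrow> bool" where
  "exp_decay f \<longleftrightarrow> (\<exists>K \<epsilon>. 0 < \<epsilon> \<and> (\<forall>t\<ge>0. norm (f t) \<le> K * exp (- \<epsilon> * t)))"

lemma exp_decay_zero: "exp_decay (\<lambda>t. 0)"
  unfolding exp_decay_def by (intro exI[of _ 0] exI[of _ 1]) auto

lemma exp_decay_add:
  assumes "exp_decay f" "exp_decay g"
  shows "exp_decay (\<lambda>t. f t + g t)"
proof -
  obtain K \<epsilon> where f: "0 < \<epsilon>" "\<And>t. t \<ge> 0 \<Longrightarrow> norm (f t) \<le> K * exp (- \<epsilon> * t)"
    using assms(1) unfolding exp_decay_def by auto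
  obtain J \<delta> where g: "0 < \<delta>" "\<And>t. t \<ge> 0 \<Longrightarrow> norm (g t) \<le> J * exp (- \<delta> * t)"
    using assms(2) unfolding exp_decay_def by auto
  have KJ: "K \<ge> 0" "J \<ge> 0"
    using order_trans[OF norm_ge_zero f(2)[of 0]] order_trans[OF norm_ge_zero g(2)[of 0]] by auto
  have "norm (f t + g t) \<le> (K + J) * exp (- min \<epsilon> \<delta> * t)" if "t \<ge> 0" for t
  proof -
    have "norm (f t + g t) \<le> K * exp (- \<epsilon> * t) + J * exp (- \<delta> * t)"
      using f(2)[OF that] g(2)[OF that] by (intro order_trans[OF norm_triangle_ineq] add_mono)
    also have "\<dots> \<le> K * exp (- min \<epsilon> \<delta> * t) + J * exp (- min \<epsilon> \<delta> * t)"
      using KJ that by (intro add_mono mult_left_mono) (auto intro!: mult_right_mono)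
    finally show ?thesis by (simp add: algebra_simps)
  qed
  then show ?thesis
    using f(1) g(1) unfolding exp_decay_def by (intro exI[of _ "K + J"] exI[of _ "min \<epsilon> \<delta>"]) auto
qed

lemma exp_decay_cmult:
  fixes f :: "real \<Rightarrow> 'a::real_normed_field"
  assumes "exp_decay f"
  shows "exp_decay (\<lambda>t. c * f t)"
proof -
  obtain K \<epsilon> where f: "0 < \<epsilon>" "\<And>t. t \<ge> 0 \<Longrightarrow> norm (f t) \<le> K * exp (- \<epsilon> * t)"
    using assms unfolding exp_decay_def by auto
  have "norm (c * f t) \<le> (norm c * K) * exp (- \<epsilon> * t)" if "t \<ge> 0" for t
    using mult_left_mono[OF f(2)[OF that], of "norm c"] by (simp add: norm_mult mult.assoc)
  then show ?thesis using f(1) unfolding exp_decay_def by blast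
qed

lemma exp_decay_sum:
  "(\<And>i. i \<in> I \<Longrightarrow> exp_decay (f i)) \<Longrightarrow> exp_decay (\<lambda>t. \<Sum>i\<in>I. f i t)"
  by (induction I rule: infinite_finite_induct) (auto intro: exp_decay_zero exp_decay_add)

text \<open>Variation of constants: \<open>e\<^sup>-\<^sup>l\<^sup>t g(t)\<close> has derivative \<open>e\<^sup>-\<^sup>l\<^sup>t h(t)\<close>, which grows more slowly
  than \<open>e\<^sup>-\<^sup>l\<^sup>t\<close> itself.\<close>

lemma exp_decay_ode:
  fixes g h :: "real \<Rightarrow> complex"
  assumes deriv: "\<And>t. (g has_vector_derivative l * g t + h t) (at t)"
    and l: "Re l < 0" and h: "exp_decay h"
  shows "exp_decay g"
proof -
  obtain K \<epsilon> where K: "0 < \<epsilon>" "\<And>t. t \<ge> 0 \<Longrightarrow> norm (h t) \<le> K * exp (- \<epsilon> * t)"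
    using h unfolding exp_decay_def by auto
  have K0: "K \<ge> 0" using order_trans[OF norm_ge_zero K(2)[of 0]] by auto
  \<comment> \<open>The rate \<open>\<delta>\<close> may not exceed \<open>\<epsilon>\<close>; it stays strictly below \<open>- Re l\<close>, which makes \<open>a\<close> positive
      and excludes the resonant case.\<close>
  define \<delta> where "\<delta> = min \<epsilon> (- Re l) / 2"
  define a where "a = - Re l - \<delta>"
  have \<delta>: "0 < \<delta>" "\<delta> \<le> \<epsilon>" and a: "0 < a" using K(1) l by (auto simp: \<delta>_def a_def min_def)
  define \<phi> where "\<phi> t = exp (of_real t * (- l)) * g t" for t
  have exp_deriv: "((\<lambda>t. exp (of_real t * (- l))) has_vector_derivative (- l) * exp (of_real t * (-
      l))) (at t)" for t
  proof -
    have "((\<lambda>z. exp (z * (- l))) has_field_derivative exp (of_real t * (- l)) * (- l)) (at (of_real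
        t))"
      by (auto intro!: derivative_eq_intros)
    from has_vector_derivative_real_field[OF this] show ?thesis by (simp add: mult.commute)
  qed
  have \<phi>_deriv: "(\<phi> has_vector_derivative exp (of_real t * (- l)) * h t) (at t)" for t
    unfolding \<phi>_def
    by (rule has_vector_derivative_eq_rhs[OF has_vector_derivative_mult[OF exp_deriv deriv]])
      (simp add: algebra_simps)
  have psi_deriv: "((\<lambda>t. K / a * exp (a * t)) has_vector_derivative K * exp (a * t)) (at t)" for t
    unfolding has_real_derivative_iff_has_vector_derivative[symmetric]
    using a by (auto intro!: derivative_eq_intros)
  have \<phi>_bound: "norm (\<phi> t - \<phi> 0) \<le> K / a * exp (a * t) - K / a * exp (a * 0)" if "t > 0" for t
  proof (rule differentiable_bound_general[OF that])
    show "continuous_on {0..t} \<phi>"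
      by (intro continuous_at_imp_continuous_on ballI)
        (use \<phi>_deriv has_vector_derivative_continuous in blast)
    show "continuous_on {0..t} (\<lambda>t. K / a * exp (a * t))" by (intro continuous_intros)
    fix s assume "0 < s" "s < t"
    show "(\<phi> has_vector_derivative exp (of_real s * (- l)) * h s) (at s)" by (rule \<phi>_deriv)
    show "((\<lambda>t. K / a * exp (a * t)) has_vector_derivative K * exp (a * s)) (at s)"
        by (rule psi_deriv)
    have "norm (exp (of_real s * (- l)) * h s) \<le> exp (s * (- Re l)) * (K * exp (- \<epsilon> * s))"
      using K(2)[of s] \<open>0 < s\<close> by (simp add: norm_mult)
    also have "\<dots> = K * exp (s * (- Re l) + (- \<epsilon> * s))" by (simp add: exp_add[symmetric])
    also have "\<dots> \<le> K * exp (a * s)"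
      using mult_right_mono[OF \<delta>(2), of s] \<open>0 < s\<close> K0
      by (intro mult_left_mono) (auto simp: a_def algebra_simps)
    finally show "norm (exp (of_real s * (- l)) * h s) \<le> K * exp (a * s)" .
  qed
  have "norm (g t) \<le> (norm (g 0) + K / a) * exp (- \<delta> * t)" if "t \<ge> 0" for t
  proof -
    have "norm (\<phi> t - \<phi> 0) \<le> K / a * exp (a * t)"
    proof (cases "t = 0")
      case False
      then show ?thesis using \<phi>_bound[of t] that a K0
          by (smt (verit) divide_nonneg_pos mult_nonneg_nonneg exp_ge_zero)
    qed (use a K0 in auto)
    moreover have "norm (\<phi> t) \<le> norm (\<phi> t - \<phi> 0) + norm (\<phi> 0)"
      by (metis diff_add_cancel norm_triangle_ineq)
    ultimately have "norm (\<phi> t) \<le> norm (g 0) + K / a * exp (a * t)" by (simp add: \<phi>_def)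
    moreover have "norm (g t) = exp (Re l * t) * norm (\<phi> t)"
      by (simp add: \<phi>_def norm_mult norm_divide exp_minus field_simps)
    ultimately have "norm (g t) \<le> exp (Re l * t) * (norm (g 0) + K / a * exp (a * t))"
      by simp
    also have "\<dots> = exp (Re l * t) * norm (g 0) + K / a * exp (- \<delta> * t)"
      by (simp add: a_def exp_add[symmetric] algebra_simps)
    also have "\<dots> \<le> exp (- \<delta> * t) * norm (g 0) + K / a * exp (- \<delta> * t)"
      using that a mult_right_mono[of "Re l" "- \<delta>" t]
          by (intro add_mono mult_right_mono) (auto simp: a_def)
    finally show ?thesis by (simp add: algebra_simps)
  qed
  then show ?thesis using \<delta>(1) unfolding exp_decay_def by blast
qed

text \<open>The vector \<open>(B - l\<^sub>k) \<dots> (B - l\<^sub>1) v\<close>; the factor that acts first is at the head of the list.\<close>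

fun shift_prod :: "complex ^ 'n ^ 'n \<Rightarrow> complex list \<Rightarrow> complex ^ 'n \<Rightarrow> complex ^ 'n" where
  "shift_prod B [] v = v"
| "shift_prod B (l # ls) v = shift_prod B ls (B *v v - l *s v)"

lemma funpow_matrix_linear:
  fixes B :: "complex ^ 'n ^ 'n"
  shows "((*v) B ^^ k) (x - l *s y) = ((*v) B ^^ k) x - l *s ((*v) B ^^ k) y"
  by (induction k) (simp_all add: matrix_vector_mult_diff_distrib vector_scalar_commute)

text \<open>A root \<open>l\<close> of \<open>p\<close> is split off; the quotient then annihilates \<open>(B - l) v\<close>.  The sum runs to
  a bound \<open>N\<close> on the degree so that the induction needs no case distinction on leading
  coefficients.\<close>

lemma shift_prod_annihilates_poly:
  fixes B :: "complex ^ 'n ^ 'n" and p :: "complex poly"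
  assumes "degree p \<le> N" "p \<noteq> 0" "(\<Sum>k\<le>N. coeff p k *s (((*v) B ^^ k) v)) = 0"
  shows "\<exists>ls. shift_prod B ls v = 0"
  using assms
proof (induction N arbitrary: p v)
  case 0
  then have "coeff p 0 \<noteq> 0" by (metis le_zero_eq leading_coeff_0_iff)
  with 0 have "shift_prod B [] v = 0" by simp
  then show ?case by blast
next
  case (Suc N)
  show ?case
  proof (cases "degree p = 0")
    case True
    then have c: "coeff p 0 \<noteq> 0" "\<And>k. k > 0 \<Longrightarrow> coeff p k = 0"
      using Suc.prems(2) by (auto simp: coeff_eq_0) (metis leading_coeff_0_iff)
    have "(\<Sum>k\<le>Suc N. coeff p k *s (((*v) B ^^ k) v)) = coeff p 0 *s v"
      by (subst sum.atMost_Suc_shift) (simp add: c)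
    then have "shift_prod B [] v = 0" using Suc.prems(3) c by simp
    then show ?thesis by blast
  next
    case False
    then obtain l where "poly p l = 0"
      using fundamental_theorem_of_algebra[of p] by (auto simp: constant_degree)
    then obtain q where q: "p = [:- l, 1:] * q" by (auto simp: poly_eq_0_iff_dvd elim: dvdE)
    then have q0: "q \<noteq> 0" using Suc.prems(2) by auto
    then have dq: "degree q \<le> N" using Suc.prems(1) unfolding q by (subst (asm) degree_mult_eq) auto
    let ?w = "\<lambda>k. ((*v) B ^^ k) v"
    have "0 = (\<Sum>k\<le>Suc N. coeff p k *s ?w k)" using Suc.prems(3) by simp
    also have "\<dots> = (\<Sum>k\<le>Suc N. coeff (pCons 0 q) k *s ?w k) - (\<Sum>k\<le>Suc N. (l * coeff q k) *s ?w k)"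
      unfolding q by (simp add: sum_subtractf[symmetric] vector_sub_rdistrib del: coeff_pCons_Suc)
    also have "(\<Sum>k\<le>Suc N. coeff (pCons 0 q) k *s ?w k) = (\<Sum>k\<le>N. coeff q k *s ?w (Suc k))"
      by (subst sum.atMost_Suc_shift) simp
    also have "(\<Sum>k\<le>Suc N. (l * coeff q k) *s ?w k) = (\<Sum>k\<le>N. (l * coeff q k) *s ?w k)"
      using dq by (simp add: coeff_eq_0)
    also have "(\<Sum>k\<le>N. coeff q k *s ?w (Suc k)) - (\<Sum>k\<le>N. (l * coeff q k) *s ?w k)
       = (\<Sum>k\<le>N. coeff q k *s (((*v) B ^^ k) (B *v v - l *s v)))"
      unfolding funpow_matrix_linear
      by (simp add: sum_subtractf[symmetric] vector_ssub_ldistrib vector_smult_assoc mult.commute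
          funpow_swap1)
    finally have "\<exists>ls. shift_prod B ls (B *v v - l *s v) = 0"
      using Suc.IH[OF dq q0] by simp
    then show ?thesis by (metis shift_prod.simps(2))
  qed
qed

text \<open>The vectors \<open>v, Bv, B\<^sup>2v, \<dots>\<close> are linearly dependent, and a polynomial relation between them
  splits into linear factors.\<close>

lemma ex_shift_prod_eq_0:
  fixes B :: "complex ^ 'n ^ 'n"
  shows "\<exists>ls. shift_prod B ls v = 0"
proof -
  let ?w = "\<lambda>k. ((*v) B ^^ k) v"
  let ?N = "CARD('n)"
  obtain c i where c: "i \<le> ?N" "c i \<noteq> 0" "(\<Sum>k\<le>?N. c k *s ?w k) = 0"
  proof (cases "inj_on ?w {..?N}")
    case True
    have "vec.dependent (?w ` {..?N})"
    proof (rule ccontr)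
      assume "\<not> vec.dependent (?w ` {..?N})"
      then have "card (?w ` {..?N}) \<le> vec.dim (UNIV :: (complex ^ 'n) set)"
        by (intro vec.independent_card_le_dim) auto
      then show False by (simp add: card_image[OF True] card_cart_basis)
    qed
    then obtain u y where "y \<in> ?w ` {..?N}" "u y \<noteq> 0" "(\<Sum>v\<in>?w ` {..?N}. u v *s v) = 0"
      by (subst (asm) vec.dependent_finite) auto
    moreover from this obtain k where "k \<le> ?N" "y = ?w k" by auto
    ultimately show thesis by (intro that[of k "\<lambda>k. u (?w k)"]) (auto simp: sum.reindex[OF True])
  next
    case False
    then obtain i j where ij: "i \<le> ?N" "j \<le> ?N" "i \<noteq> j" "?w i = ?w j" by (auto simp: inj_on_def)
    let ?c = "\<lambda>k. (if k = i then 1 else 0) - (if k = j then 1 else 0 :: complex)"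
    have "(\<Sum>k\<le>?N. ?c k *s ?w k) = (\<Sum>k\<le>?N. (if k = i then ?w k else 0)) - (\<Sum>k\<le>?N. (if k
        = j then ?w k else 0))"
      unfolding sum_subtractf[symmetric] by (intro sum.cong) auto
    also have "\<dots> = 0" using ij by simp
    finally show thesis using ij by (intro that[of i ?c]) auto
  qed
  define p where "p = (\<Sum>k\<le>?N. monom (c k) k)"
  have coeff: "coeff p k = (if k \<le> ?N then c k else 0)" for k
    by (simp add: p_def coeff_sum)
  show ?thesis
  proof (rule shift_prod_annihilates_poly)
    show "degree p \<le> ?N" by (rule degree_le) (simp add: coeff)
    show "p \<noteq> 0" using c coeff[of i] by auto
    show "(\<Sum>k\<le>?N. coeff p k *s ?w k) = 0" using c(3) by (simp add: coeff)
  qed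
qed

lemma mat_vector_mult: "mat c *v x = c *s (x :: 'a::comm_semiring_1 ^ 'n)"
  by (simp add: vec_eq_iff matrix_vector_mult_def mat_def if_distrib[of "\<lambda>a. a * _"] cong: if_cong)

lemma cmat_entry [simp]: "cmat A $ i $ j = complex_of_real (A $ i $ j)"
  by (simp add: cmat_def map_matrix_def)

lemma cmat_mult: "cmat (A ** B) = cmat A ** cmat B"
  by (simp add: vec_eq_iff matrix_matrix_mult_def)

lemma cmat_mat_exp_commute:
  fixes A :: "real ^ 'n ^ 'n"
  shows "cmat A *v (cmat (mat_exp (t *\<^sub>R A)) *v v) = cmat (mat_exp (t *\<^sub>R A)) *v (cmat A *v v)"
  by (simp add: matrix_vector_mul_assoc cmat_mult[symmetric] mat_exp_commute)

lemma cmat_mat_exp_deriv: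
  fixes A :: "real ^ 'n ^ 'n"
  shows "((\<lambda>t. (cmat (mat_exp (t *\<^sub>R A)) *v v) $ i)
     has_vector_derivative (cmat (mat_exp (t *\<^sub>R A)) *v (cmat A *v v)) $ i) (at t)"
proof -
  have "((\<lambda>t. \<Sum>j\<in>UNIV. complex_of_real (mat_exp (t *\<^sub>R A) $ i $ j) * v $ j)
     has_vector_derivative (\<Sum>j\<in>UNIV. complex_of_real ((A ** mat_exp (t *\<^sub>R A)) $ i $ j) * v $ j))
         (at t)"
    by (intro has_vector_derivative_sum has_vector_derivative_mult_left
        has_vector_derivative_of_real)
      (rule mat_exp_entry_deriv)
  then show ?thesis
    unfolding cmat_mat_exp_commute[symmetric]
    by (simp add: matrix_vector_mul_assoc cmat_mult[symmetric])
       (simp add: matrix_vector_mult_def)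
qed

text \<open>Remove the factors of the annihilating product one at a time: an eigenvalue \<open>l\<close> leads to the
  differential equation \<open>G' = l G + H\<close>, and for any other \<open>l\<close> the matrix \<open>A - l\<close> can be cancelled.\<close>

lemma mat_exp_decay_shift_prod:
  fixes A :: "real ^ 'n ^ 'n"
  assumes ev: "\<And>z. eigenvalue (cmat A) z \<Longrightarrow> Re z < 0"
    and "shift_prod (cmat A) ls v = 0"
  shows "exp_decay (\<lambda>t. (cmat (mat_exp (t *\<^sub>R A)) *v v) $ i)"
  using assms(2)
proof (induction ls arbitrary: v i)
  case Nil
  then show ?case by (simp add: exp_decay_zero)
next
  case (Cons l ls)
  let ?E = "\<lambda>t. cmat (mat_exp (t *\<^sub>R A))"
  define w where "w = cmat A *v v - l *s v"
  have w: "exp_decay (\<lambda>t. (?E t *v w) $ i)" for i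
    using Cons by (simp add: w_def)
  have Ew: "?E t *v w = ?E t *v (cmat A *v v) - l *s (?E t *v v)" for t
    by (simp add: w_def matrix_vector_mult_diff_distrib vector_scalar_commute)
  show ?case
  proof (cases "eigenvalue (cmat A) l")
    case True
    show ?thesis
    proof (rule exp_decay_ode[OF _ ev[OF True] w[of i]])
      show "((\<lambda>t. (?E t *v v) $ i) has_vector_derivative l * (?E t *v v) $ i
          + (?E t *v w) $ i) (at t)" for t
        using cmat_mat_exp_deriv[of A v i t] by (simp add: Ew)
    qed
  next
    case False
    have "(cmat A - mat l) *v x = 0 \<longrightarrow> x = 0" for x
      using False unfolding eigenvalue_def
      by (auto simp: matrix_vector_mult_diff_rdistrib mat_vector_mult)
    then obtain C where C: "C ** (cmat A - mat l) = mat 1"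
      using matrix_left_invertible_ker by blast
    have "(cmat A - mat l) *v (?E t *v v) = ?E t *v w" for t
      by (simp add: Ew matrix_vector_mult_diff_rdistrib cmat_mat_exp_commute mat_vector_mult)
    then have "?E t *v v = C *v (?E t *v w)" for t
      by (metis C matrix_vector_mul_assoc matrix_vector_mul_lid)
    then have "(?E t *v v) $ i = (\<Sum>j\<in>UNIV. C $ i $ j * (?E t *v w) $ j)" for t
      by (simp add: matrix_vector_mult_def)
    then show ?thesis by (simp add: exp_decay_sum exp_decay_cmult w)
  qed
qed

lemma exp_decay_mat_exp:
  fixes A :: "real ^ 'n ^ 'n"
  assumes "\<And>z. eigenvalue (cmat A) z \<Longrightarrow> Re z < 0"
  shows "exp_decay (\<lambda>t. b \<bullet> (mat_exp (t *\<^sub>R A) *v v))"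
proof -
  have "exp_decay (\<lambda>t. (mat_exp (t *\<^sub>R A) *v v) $ i)" for i
  proof -
    obtain ls where "shift_prod (cmat A) ls (cvec v) = 0" using ex_shift_prod_eq_0 by blast
    from mat_exp_decay_shift_prod[OF assms this]
    have "exp_decay (\<lambda>t. (cmat (mat_exp (t *\<^sub>R A)) *v cvec v) $ i)" .
    moreover have "(cmat (mat_exp (t *\<^sub>R A)) *v cvec v) $ i
        = complex_of_real ((mat_exp (t *\<^sub>R A) *v v) $ i)" for t
      by (simp add: matrix_vector_mult_def cvec_def)
    ultimately show ?thesis by (simp add: exp_decay_def)
  qed
  then show ?thesis by (simp add: inner_vec_def exp_decay_sum exp_decay_cmult)
qed

section \<open>Fractional derivatives of functions on the half-line\<close>

text \<open>For \<open>w = frac_weight \<beta> 0\<close> this is the Marchaud fractional derivative of order \<open>\<beta>\<close>, and for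
  \<open>w = frac_weight \<beta> \<delta>\<close> its truncation at \<open>\<delta>\<close>.\<close>

definition increment_integral :: "(real \<Rightarrow> real) \<Rightarrow> (real \<Rightarrow> real) \<Rightarrow> real \<Rightarrow> real" where
  "increment_integral w x t = (LBINT u. (x t - x (t - u)) * w u)"

text \<open>Since \<open>1 / 0 = 0\<close>, the weight with \<open>\<delta> = 0\<close> lives on \<open>u > 0\<close>.\<close>

definition frac_weight :: "real \<Rightarrow> real \<Rightarrow> real \<Rightarrow> real" where
  "frac_weight \<beta> \<delta> u = \<beta> / Gamma (1 - \<beta>) * (indicator {\<delta>..} u / u powr (1 + \<beta>))"

lemma frac_weight_measurable [measurable]: "frac_weight \<beta> \<delta> \<in> borel_measurable borel"
  unfolding frac_weight_def[abs_def] by measurable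

lemma powr_tail:
  fixes \<beta> a :: real
  assumes "0 < \<beta>" "0 < a"
  shows "has_bochner_integral lborel (\<lambda>u. indicator {a..} u / u powr (1 + \<beta>)) (a powr (- \<beta>) / \<beta>)"
proof (rule has_bochner_integral_nn_integral)
  have "(\<integral>\<^sup>+u\<in>{a..}. ennreal (u powr (- \<beta> - 1)) \<partial>lborel) = ennreal (0 - (- (a powr (- \<beta>)) / \<beta>))"
  proof (rule nn_integral_FTC_atLeast)
    show "((\<lambda>u. - (u powr (- \<beta>)) / \<beta>) has_real_derivative x powr (- \<beta> - 1)) (at x)" if "a \<le> x" for x
      using assms that by (auto intro!: derivative_eq_intros simp: field_simps)
    have "((\<lambda>u. - (u powr (- \<beta>)) / \<beta>) \<longlongrightarrow> - 0 / \<beta>) at_top"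
      using assms by (intro tendsto_intros tendsto_neg_powr filterlim_ident) auto
    then show "((\<lambda>u. - (u powr (- \<beta>)) / \<beta>) \<longlongrightarrow> 0) at_top" by simp
  qed auto
  also have "(\<integral>\<^sup>+u\<in>{a..}. ennreal (u powr (- \<beta> - 1)) \<partial>lborel)
      = (\<integral>\<^sup>+u. ennreal (indicator {a..} u / u powr (1 + \<beta>)) \<partial>lborel)"
  proof (rule nn_integral_cong)
    fix u :: real
    have "u powr (- \<beta> - 1) = 1 / u powr (1 + \<beta>)"
      using powr_minus_divide[of u "1 + \<beta>"] by (simp add: algebra_simps minus_diff_commute)
    then show "ennreal (u powr (- \<beta> - 1)) * indicator {a..} u
        = ennreal (indicator {a..} u / u powr (1 + \<beta>))" by (simp add: indicator_def)
  qed
  finally show "(\<integral>\<^sup>+u. ennreal (indicator {a..} u / u powr (1 + \<beta>)) \<partial>lborel)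
      = ennreal (a powr (- \<beta>) / \<beta>)"
    by simp
qed (use assms in auto)

lemma integrable_powr_near_0:
  fixes a p :: real
  assumes "p < 1" "0 < a"
  shows "integrable lborel (\<lambda>u. indicator {0<..<a} u * u powr (- p))"
proof -
  let ?F = "\<lambda>u::real. u powr (1 - p) / (1 - p)"
  have lim: "(?F \<longlongrightarrow> ?F x) (at x within {0..})" if "0 \<le> x" for x
  proof -
    have "continuous_on {0..} ?F" using assms by (intro continuous_intros continuous_on_powr') auto
    then show ?thesis using that by (auto simp: continuous_on_def)
  qed
  have "set_integrable lborel (einterval (ereal 0) (ereal a)) (\<lambda>u. u powr (- p))"
  proof (rule interval_integral_FTC_nonneg(1))
    show "DERIV ?F x :> x powr (- p)" if "ereal 0 < ereal x" "ereal x < ereal a" for x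
      using that assms by (auto intro!: derivative_eq_intros)
    show "isCont (\<lambda>u. u powr (- p)) x" if "ereal 0 < ereal x" "ereal x < ereal a" for x
      using that by (auto intro!: continuous_intros)
    show "((?F \<circ> real_of_ereal) \<longlongrightarrow> ?F 0) (at_right (ereal 0))"
      unfolding ereal_tendsto_simps1 by (rule tendsto_within_subset[OF lim]) auto
    show "((?F \<circ> real_of_ereal) \<longlongrightarrow> ?F a) (at_left (ereal a))"
      unfolding ereal_tendsto_simps1 using assms by (auto intro!: tendsto_intros)
  qed (use assms in auto)
  then show ?thesis unfolding set_integrable_def by (simp add: einterval_eq)
qed

lemma nn_integral_exp_tail:
  fixes \<epsilon> a c :: real
  assumes "0 < \<epsilon>" "0 \<le> c"
  shows "(\<integral>\<^sup>+t\<in>{a..}. ennreal (c * exp (- \<epsilon> * (t - a))) \<partial>lborel) = ennreal (c / \<epsilon>)"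
proof -
  have "(\<integral>\<^sup>+t\<in>{a..}. ennreal (c * exp (- \<epsilon> * (t - a))) \<partial>lborel)
      = ennreal (0 - (- c / \<epsilon> * exp (- \<epsilon> * (a - a))))"
  proof (rule nn_integral_FTC_atLeast[where F = "\<lambda>t. - c / \<epsilon> * exp (- \<epsilon> * (t - a))"])
    show "((\<lambda>t. - c / \<epsilon> * exp (- \<epsilon> * (t - a))) has_real_derivative c * exp (- \<epsilon> * (t - a))) (at t)"
        for t
      using assms by (auto intro!: derivative_eq_intros)
    have "filterlim (\<lambda>t. - a + t) at_top at_top"
      by (rule filterlim_tendsto_add_at_top[OF tendsto_const filterlim_ident])
    then have "filterlim (\<lambda>t. - \<epsilon> * (t - a)) at_bot at_top"
      using assms filterlim_tendsto_neg_mult_at_bot[OF tendsto_const, of "- \<epsilon>" "\<lambda>t. - a + t"]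
      by simp
    from tendsto_mult[OF tendsto_const[of "- c / \<epsilon>"] filterlim_compose[OF exp_at_bot this]]
    show "((\<lambda>t. - c / \<epsilon> * exp (- \<epsilon> * (t - a))) \<longlongrightarrow> 0) at_top" by simp
  qed (use assms in auto)
  then show ?thesis by simp
qed

lemma integrable_min_frac:
  fixes \<beta> :: real
  assumes "0 < \<beta>" "\<beta> < 1"
  shows "integrable lborel (\<lambda>u. indicator {0<..} u * min u 1 / u powr (1 + \<beta>))"
proof -
  have "integrable lborel (\<lambda>u. indicator {0<..<1} u * u powr (- \<beta>) + indicator {1..} u / u powr (1
      + \<beta>))"
    using integrable_powr_near_0[of \<beta> 1] has_bochner_integral_iff powr_tail[of \<beta> 1] assms
    by (intro Bochner_Integration.integrable_add) auto
  also have "(\<lambda>u. indicator {0<..<1} u * u powr (- \<beta>) + indicator {1..} u / u powr (1 + \<beta>))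
     = (\<lambda>u. indicator {0<..} u * min u 1 / u powr (1 + \<beta>))"
    by (auto simp: fun_eq_iff indicator_def powr_add powr_minus_divide)
  finally show ?thesis .
qed

lemma frac_weight_0:
  "frac_weight \<beta> 0 u = \<beta> / Gamma (1 - \<beta>) * (indicator {0<..} u / u powr (1 + \<beta>))"
  by (auto simp: frac_weight_def indicator_def)

lemma Gamma_const_pos:
  fixes \<beta> :: real
  assumes "0 < \<beta>" "\<beta> < 1" shows "0 < \<beta> / Gamma (1 - \<beta>)"
  using assms by (intro divide_pos_pos Gamma_real_pos) auto

lemma frac_weight_bounds:
  fixes \<beta> \<delta> :: real
  assumes "0 < \<beta>" "\<beta> < 1" "0 \<le> \<delta>"
  shows "0 \<le> frac_weight \<beta> \<delta> u" "frac_weight \<beta> \<delta> u \<le> frac_weight \<beta> 0 u"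
  using assms Gamma_const_pos[of \<beta>]
  by (auto simp: frac_weight_def indicator_def)

lemma frac_weight_integrable:
  fixes \<beta> \<delta> :: real
  assumes "0 < \<beta>" "0 < \<delta>"
  shows "integrable lborel (frac_weight \<beta> \<delta>)"
  unfolding frac_weight_def[abs_def]
  using powr_tail[OF assms] by (intro integrable_mult_right) (auto simp: has_bochner_integral_iff)

text \<open>Only the restriction of \<open>\<phi>\<close> to the half-line is studied; extended by
  \<open>0\<close> it jumps at \<open>0\<close>, while \<open>\<phi>\<close> itself is smooth across \<open>0\<close>, which avoids one-sided derivatives.\<close>

locale decaying_half_line_function =
  fixes \<phi> \<phi>' :: "real \<Rightarrow> real" and K \<epsilon> \<beta> :: real
  assumes deriv: "(\<phi> has_real_derivative \<phi>' t) (at t)"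
    and cont': "continuous_on UNIV \<phi>'"
    and eps: "0 < \<epsilon>"
    and bound: "t \<ge> 0 \<Longrightarrow> \<bar>\<phi> t\<bar> \<le> K * exp (- \<epsilon> * t)"
    and bound': "t \<ge> 0 \<Longrightarrow> \<bar>\<phi>' t\<bar> \<le> K * exp (- \<epsilon> * t)"
    and beta: "0 < \<beta>" "\<beta> < 1"
begin

definition f :: "real \<Rightarrow> real" where "f u = (if u \<ge> 0 then \<phi> u else 0)"

lemma K_nonneg: "0 \<le> K"
  using bound[of 0] by simp

lemma cont: "continuous_on S \<phi>"
  by (intro continuous_at_imp_continuous_on ballI DERIV_isCont[OF deriv])

lemma phi_measurable [measurable]: "\<phi> \<in> borel_measurable borel"
  by (intro borel_measurable_continuous_onI cont)

lemma f_measurable [measurable]: "f \<in> borel_measurable borel"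
  unfolding f_def[abs_def] by measurable

lemma f_le_K: "\<bar>f t\<bar> \<le> K"
proof -
  have "K * exp (- \<epsilon> * t) \<le> K" if "t \<ge> 0"
    using that eps K_nonneg by (auto intro!: mult_left_le)
  then show ?thesis using bound[of t] K_nonneg by (auto simp: f_def)
qed

lemma phi_diff_bound:
  assumes "0 \<le> u" "u \<le> t"
  shows "\<bar>\<phi> t - \<phi> (t - u)\<bar> \<le> K * u * exp (- \<epsilon> * (t - u))"
proof (cases "u = 0")
  case False
  then obtain z where z: "t - u < z" "z < t" "\<phi> t - \<phi> (t - u) = (t - (t - u)) * \<phi>' z"
    using MVT2[of "t - u" t \<phi> \<phi>'] deriv assms by auto
  have "\<bar>\<phi>' z\<bar> \<le> K * exp (- \<epsilon> * z)" using bound'[of z] z assms by auto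
  also have "\<dots> \<le> K * exp (- \<epsilon> * (t - u))"
    using z(1) eps K_nonneg by (intro mult_left_mono) auto
  finally have "\<bar>\<phi>' z\<bar> \<le> K * exp (- \<epsilon> * (t - u))" .
  then show ?thesis using z(3) assms mult_left_mono[of "\<bar>\<phi>' z\<bar>" "K * exp (- \<epsilon> * (t - u))" u]
    by (simp add: abs_mult mult_ac)
qed simp

lemma f_nn_integral: "(\<integral>\<^sup>+t. ennreal \<bar>f t\<bar> \<partial>lborel) \<le> ennreal (K / \<epsilon>)"
proof -
  have "(\<integral>\<^sup>+t. ennreal \<bar>f t\<bar> \<partial>lborel) \<le> (\<integral>\<^sup>+t\<in>{0..}. ennreal (K * exp (- \<epsilon> * (t - 0))) \<partial>lborel)"
    using bound by (intro nn_integral_mono) (auto simp: indicator_def f_def intro!: ennreal_leI)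
  also have "\<dots> = ennreal (K / \<epsilon>)" by (rule nn_integral_exp_tail[OF eps K_nonneg])
  finally show ?thesis .
qed

lemma f_integrable: "integrable lborel f"
  using f_nn_integral by (intro integrableI_bounded) (auto intro: le_less_trans)

definition C :: real where "C = 2 * (K + K / \<epsilon>)"

lemma C_nonneg: "0 \<le> C"
  using K_nonneg eps by (auto simp: C_def intro!: add_nonneg_nonneg)

text \<open>For \<open>u \<le> 1\<close> the derivative of \<open>\<phi>\<close> contributes at most \<open>K u / \<epsilon>\<close> and the jump of \<open>f\<close> at \<open>0\<close> at
  most \<open>K u\<close>; for \<open>u > 1\<close> the two terms are estimated separately.\<close>

lemma L1_modulus:
  assumes "0 < u"
  shows "(\<integral>\<^sup>+t. ennreal \<bar>f t - f (t - u)\<bar> \<partial>lborel) \<le> ennreal (C * min u 1)"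
proof (cases "u \<le> 1")
  case True
  have "(\<integral>\<^sup>+t. ennreal \<bar>f t - f (t - u)\<bar> \<partial>lborel)
     \<le> (\<integral>\<^sup>+t. ennreal K * indicator {0..u} t
            + ennreal (K * u * exp (- \<epsilon> * (t - u))) * indicator {u..} t \<partial>lborel)"
  proof (intro nn_integral_mono)
    fix t
    consider "t < 0" | "0 \<le> t" "t < u" | "u \<le> t" by linarith
    then show "ennreal \<bar>f t - f (t - u)\<bar>
       \<le> ennreal K * indicator {0..u} t + ennreal (K * u * exp (- \<epsilon> * (t - u))) * indicator {u..} t"
    proof cases
      case 1
      then show ?thesis using assms by (simp add: f_def)
    next
      case 2
      then have "\<bar>f t - f (t - u)\<bar> \<le> K" using f_le_K[of t] by (simp add: f_def)
      then show ?thesis using 2 by (simp add: ennreal_leI)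
    next
      case 3
      then have "\<bar>f t - f (t - u)\<bar> \<le> K * u * exp (- \<epsilon> * (t - u))"
        using phi_diff_bound[of u t] assms by (simp add: f_def)
      then have "ennreal \<bar>f t - f (t - u)\<bar> \<le> ennreal (K * u * exp (- \<epsilon> * (t - u)))"
          by (rule ennreal_leI)
      then show ?thesis using 3 by (simp add: add_increasing)
    qed
  qed
  also have "\<dots> = ennreal K * emeasure lborel {0..u} + ennreal (K * u / \<epsilon>)"
    using assms K_nonneg eps
        by (subst nn_integral_add) (auto simp: nn_integral_cmult_indicator
            nn_integral_exp_tail[simplified])
  also have "\<dots> = ennreal (K * u + K * u / \<epsilon>)"
    using assms K_nonneg eps
        by (simp add: ennreal_mult[symmetric] ennreal_plus[symmetric] del: ennreal_plus)
  also have "\<dots> \<le> ennreal (C * min u 1)"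
  proof (intro ennreal_leI)
    have "K * u + K * u / \<epsilon> = (K + K / \<epsilon>) * u" by (simp add: field_simps)
    also have "\<dots> \<le> (2 * (K + K / \<epsilon>)) * u"
      using assms K_nonneg divide_nonneg_pos[OF K_nonneg eps] by (intro mult_right_mono) argo+
    finally show "K * u + K * u / \<epsilon> \<le> C * min u 1" using True by (simp add: C_def)
  qed
  finally show ?thesis .
next
  case False
  have "(\<integral>\<^sup>+t. ennreal \<bar>f t - f (t - u)\<bar> \<partial>lborel)
     \<le> (\<integral>\<^sup>+t. ennreal \<bar>f t\<bar> + ennreal \<bar>f (t - u)\<bar> \<partial>lborel)"
    by (intro nn_integral_mono) (simp add: ennreal_plus[symmetric] ennreal_leI del: ennreal_plus)
  also have "\<dots> = (\<integral>\<^sup>+t. ennreal \<bar>f t\<bar> \<partial>lborel) + (\<integral>\<^sup>+t. ennreal \<bar>f (t - u)\<bar> \<partial>lborel)"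
    by (intro nn_integral_add) auto
  also have "(\<integral>\<^sup>+t. ennreal \<bar>f (t - u)\<bar> \<partial>lborel) = (\<integral>\<^sup>+t. ennreal \<bar>f t\<bar> \<partial>lborel)"
    using nn_integral_real_affine[of "\<lambda>t. ennreal \<bar>f t\<bar>" 1 "- u"] by (simp add: algebra_simps)
  also have "(\<integral>\<^sup>+t. ennreal \<bar>f t\<bar> \<partial>lborel) + (\<integral>\<^sup>+t. ennreal \<bar>f t\<bar> \<partial>lborel) \<le> ennreal (K / \<epsilon>)
      + ennreal (K / \<epsilon>)"
    by (intro add_mono f_nn_integral)
  also have "\<dots> = ennreal (K / \<epsilon> + K / \<epsilon>)"
    using K_nonneg eps by (simp add: ennreal_plus[symmetric] del: ennreal_plus)
  also have "\<dots> \<le> ennreal (C * min u 1)"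
  proof (intro ennreal_leI)
    have "K / \<epsilon> + K / \<epsilon> \<le> C"
      unfolding C_def using K_nonneg divide_nonneg_pos[OF K_nonneg eps] by argo
    then show "K / \<epsilon> + K / \<epsilon> \<le> C * min u 1" using False by (simp add: min_def)
  qed
  finally show ?thesis .
qed

text \<open>Tonelli's theorem reduces every estimate on increments to the modulus above.\<close>

lemma nn_integral_increments:
  assumes [measurable]: "w \<in> borel_measurable borel" and w: "\<And>u. u \<le> 0 \<Longrightarrow> w u = 0"
  shows "(\<integral>\<^sup>+t. \<integral>\<^sup>+u. ennreal \<bar>(f t - f (t - u)) * w u\<bar> \<partial>lborel \<partial>lborel)
    \<le> (\<integral>\<^sup>+u. ennreal (C * min u 1 * \<bar>w u\<bar>) \<partial>lborel)"
proof -
  have "(\<integral>\<^sup>+t. \<integral>\<^sup>+u. ennreal \<bar>(f t - f (t - u)) * w u\<bar> \<partial>lborel \<partial>lborel)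
     = (\<integral>\<^sup>+u. \<integral>\<^sup>+t. ennreal \<bar>(f t - f (t - u)) * w u\<bar> \<partial>lborel \<partial>lborel)"
    by (rule lborel_pair.Fubini'[symmetric]) measurable
  also have "\<dots> = (\<integral>\<^sup>+u. (\<integral>\<^sup>+t. ennreal \<bar>f t - f (t - u)\<bar> \<partial>lborel) * ennreal \<bar>w u\<bar> \<partial>lborel)"
    by (simp add: abs_mult ennreal_mult nn_integral_multc)
  also have "\<dots> \<le> (\<integral>\<^sup>+u. ennreal (C * min u 1 * \<bar>w u\<bar>) \<partial>lborel)"
  proof (intro nn_integral_mono)
    fix u
    show "(\<integral>\<^sup>+t. ennreal \<bar>f t - f (t - u)\<bar> \<partial>lborel) * ennreal \<bar>w u\<bar> \<le> ennreal (C * min u 1 * \<bar>w u\<bar>)"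
    proof (cases "u \<le> 0")
      case False
      then show ?thesis
        using mult_right_mono[OF L1_modulus[of u], of "ennreal \<bar>w u\<bar>"] C_nonneg
        by (simp add: ennreal_mult)
    qed (simp add: w)
  qed
  finally show ?thesis .
qed


abbreviation "w0 \<equiv> frac_weight \<beta> 0"

lemma w0_nonneg: "0 \<le> w0 u"
  using frac_weight_bounds[of \<beta> 0] beta by simp

lemma modulus_w0_finite: "(\<integral>\<^sup>+u. ennreal (C * min u 1 * \<bar>w0 u\<bar>) \<partial>lborel) < \<infinity>"
proof -
  have "integrable lborel (\<lambda>u. (C * (\<beta> / Gamma (1 - \<beta>))) * (indicator {0<..} u * min u 1 / u powr (1
      + \<beta>)))"
    by (intro integrable_mult_right integrable_min_frac beta)
  moreover have "(\<lambda>u. (C * (\<beta> / Gamma (1 - \<beta>))) * (indicator {0<..} u * min u 1 / u powr (1 + \<beta>)))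
      = (\<lambda>u. C * min u 1 * \<bar>w0 u\<bar>)"
  proof
    fix u
    have "\<bar>w0 u\<bar> = w0 u" using w0_nonneg by simp
    then show "(C * (\<beta> / Gamma (1 - \<beta>))) * (indicator {0<..} u * min u 1 / u powr (1 + \<beta>))
        = C * min u 1 * \<bar>w0 u\<bar>"
      by (simp add: frac_weight_0 mult_ac)
  qed
  ultimately have "integrable lborel (\<lambda>u. C * min u 1 * \<bar>w0 u\<bar>)" by (simp only:)
  then have "(\<integral>\<^sup>+u. ennreal (norm (C * min u 1 * \<bar>w0 u\<bar>)) \<partial>lborel) < \<infinity>"
    unfolding integrable_iff_bounded by blast
  moreover have "(\<integral>\<^sup>+u. ennreal (C * min u 1 * \<bar>w0 u\<bar>) \<partial>lborel)
      \<le> (\<integral>\<^sup>+u. ennreal (norm (C * min u 1 * \<bar>w0 u\<bar>)) \<partial>lborel)"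
    by (intro nn_integral_mono ennreal_leI) simp
  ultimately show ?thesis by (rule le_less_trans[rotated])
qed

lemma integrable_increments:
  "integrable (lborel \<Otimes>\<^sub>M lborel) (\<lambda>(t, u). (f t - f (t - u)) * w0 u)"
proof (rule integrableI_bounded)
  have "(\<integral>\<^sup>+x. ennreal (norm ((\<lambda>(t, u). (f t - f (t - u)) * w0 u) x)) \<partial>(lborel \<Otimes>\<^sub>M lborel))
     = (\<integral>\<^sup>+t. \<integral>\<^sup>+u. ennreal \<bar>(f t - f (t - u)) * w0 u\<bar> \<partial>lborel \<partial>lborel)"
    by (subst lborel.nn_integral_fst[symmetric]) auto
  also have "\<dots> \<le> (\<integral>\<^sup>+u. ennreal (C * min u 1 * \<bar>w0 u\<bar>) \<partial>lborel)"
    by (rule nn_integral_increments) (auto simp: frac_weight_0)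
  also note modulus_w0_finite
  finally show "(\<integral>\<^sup>+x. ennreal (norm ((\<lambda>(t, u). (f t - f (t - u)) * w0 u) x)) \<partial>(lborel \<Otimes>\<^sub>M lborel))
      < \<infinity>" .
qed measurable

lemma AE_integrable_increments: "AE t in lborel. integrable lborel (\<lambda>u. (f t - f (t - u)) * w0 u)"
  by (rule lborel_pair.AE_integrable_fst[OF integrable_increments])

lemma frac_deriv_integrable: "integrable lborel (increment_integral w0 f)"
  unfolding increment_integral_def[abs_def]
  by (rule lborel_pair.integrable_fst[OF integrable_increments])

text \<open>The error consists of the increments with \<open>u < \<delta>\<close>; their total mass tends to \<open>0\<close> by dominated
  convergence.\<close>

lemma truncated_frac_deriv_tendsto_L1:
  assumes \<delta>: "\<And>n. 0 < \<delta> n" "\<delta> \<longlonglongrightarrow> 0"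
  shows "(\<lambda>n. \<integral>\<^sup>+t. ennreal \<bar>increment_integral (frac_weight \<beta> (\<delta> n)) f t - increment_integral w0 f
      t\<bar> \<partial>lborel) \<longlonglongrightarrow> 0"
proof -
  let ?w = "\<lambda>n. frac_weight \<beta> (\<delta> n)"
  have w: "0 \<le> ?w n u" "?w n u \<le> w0 u" for n u
    using frac_weight_bounds[of \<beta> "\<delta> n" u] beta \<delta>(1)[of n] by auto
  have le: "(\<integral>\<^sup>+t. ennreal \<bar>increment_integral (?w n) f t - increment_integral w0 f t\<bar> \<partial>lborel)
     \<le> (\<integral>\<^sup>+u. ennreal (C * min u 1 * \<bar>?w n u - w0 u\<bar>) \<partial>lborel)" for n
  proof -
    have "AE t in lborel. ennreal \<bar>increment_integral (?w n) f t - increment_integral w0 f t\<bar>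
       \<le> (\<integral>\<^sup>+u. ennreal \<bar>(f t - f (t - u)) * (?w n u - w0 u)\<bar> \<partial>lborel)"
      using AE_integrable_increments
    proof eventually_elim
      case (elim t)
      have i: "integrable lborel (\<lambda>u. (f t - f (t - u)) * ?w n u)"
        by (rule Bochner_Integration.integrable_bound[OF elim])
          (use w w0_nonneg in \<open>auto simp: abs_mult intro!: mult_left_mono\<close>)
      have eq: "increment_integral (?w n) f t - increment_integral w0 f t
          = (LBINT u. (f t - f (t - u)) * (?w n u - w0 u))"
        unfolding increment_integral_def
        unfolding right_diff_distrib
            by (rule Bochner_Integration.integral_diff[OF i elim, symmetric])
      show ?case
        unfolding eq
        using integral_norm_bound_ennreal[of lborel "\<lambda>u. (f t - f (t - u)) * (?w n u - w0 u)"]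
          Bochner_Integration.integrable_diff[OF i elim] by (simp add: right_diff_distrib)
    qed
    then have "(\<integral>\<^sup>+t. ennreal \<bar>increment_integral (?w n) f t - increment_integral w0 f t\<bar> \<partial>lborel)
      \<le> (\<integral>\<^sup>+t. \<integral>\<^sup>+u. ennreal \<bar>(f t - f (t - u)) * (?w n u - w0 u)\<bar> \<partial>lborel \<partial>lborel)"
      by (rule nn_integral_mono_AE)
    also have "\<dots> \<le> (\<integral>\<^sup>+u. ennreal (C * min u 1 * \<bar>?w n u - w0 u\<bar>) \<partial>lborel)"
      by (rule nn_integral_increments) (use \<delta>(1)[of n] in \<open>auto simp: frac_weight_def\<close>)
    finally show ?thesis .
  qed
  have "(\<lambda>n. \<integral>\<^sup>+u. ennreal (C * min u 1 * \<bar>?w n u - w0 u\<bar>) \<partial>lborel)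
      \<longlonglongrightarrow> (\<integral>\<^sup>+u. 0 \<partial>(lborel::real measure))"
  proof (rule nn_integral_dominated_convergence[where w = "\<lambda>u. ennreal (C * min u 1 * \<bar>w0 u\<bar>)"])
    show "AE u in lborel. ennreal (C * min u 1 * \<bar>?w n u - w0 u\<bar>) \<le> ennreal (C * min u 1 * \<bar>w0 u\<bar>)"
        for n
    proof (intro AE_I2 ennreal_leI)
      fix u
      show "C * min u 1 * \<bar>?w n u - w0 u\<bar> \<le> C * min u 1 * \<bar>w0 u\<bar>"
      proof (cases "u \<le> 0")
        case True
        then show ?thesis using \<delta>(1)[of n] by (auto simp: frac_weight_def)
      next
        case False
        then show ?thesis using w[of n u] w0_nonneg[of u] C_nonneg by (intro mult_left_mono) auto
      qed
    qed
    show "AE u in lborel. (\<lambda>n. ennreal (C * min u 1 * \<bar>?w n u - w0 u\<bar>)) \<longlonglongrightarrow> 0"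
    proof (rule AE_I2)
      fix u :: real
      show "(\<lambda>n. ennreal (C * min u 1 * \<bar>?w n u - w0 u\<bar>)) \<longlonglongrightarrow> 0"
      proof (cases "u \<le> 0")
        case True
        have "?w n u = w0 u" for n using True \<delta>(1)[of n] by (auto simp: frac_weight_def)
        then show ?thesis by simp
      next
        case False
        then have "eventually (\<lambda>n. \<delta> n < u) sequentially"
          using order_tendstoD(2)[OF \<delta>(2), of u] by simp
        then have "eventually (\<lambda>n. ennreal (C * min u 1 * \<bar>?w n u - w0 u\<bar>) = 0) sequentially"
          by eventually_elim (use False in \<open>simp add: frac_weight_def\<close>)
        then show ?thesis by (rule tendsto_eventually)
      qed
    qed
  qed (use modulus_w0_finite in auto)
  then have lim: "(\<lambda>n. \<integral>\<^sup>+u. ennreal (C * min u 1 * \<bar>?w n u - w0 u\<bar>) \<partial>lborel) \<longlonglongrightarrow> 0"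
    by (simp only: nn_integral_const mult_zero_left)
  show ?thesis
    by (rule tendsto_sandwich[OF _ _ tendsto_const lim]) (auto simp: le)
qed


text \<open>The derivative of \<open>- (\<phi> t - \<phi>(t - u)) u\<^sup>-\<^sup>\<beta>\<close> in \<open>u\<close> is the difference of the two integrands on
  \<open>(0, t)\<close>.  The increments with \<open>u > t\<close> are all equal to \<open>\<phi> t\<close> and contribute
  \<open>\<phi> t t\<^sup>-\<^sup>\<beta>\<close>, which combines with the boundary term at \<open>u = t\<close> to \<open>\<phi> 0 t\<^sup>-\<^sup>\<beta>\<close>.\<close>

lemma increment_integral_eq:
  assumes t: "0 < t"
  shows "increment_integral w0 f t
    = 1 / Gamma (1 - \<beta>) * (\<phi> 0 * t powr (- \<beta>) + (LBINT u:{0..t}. \<phi>' (t - u) * u powr (- \<beta>)))"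
proof -
  define h where "h u = (\<phi> t - \<phi> (t - u)) / u powr (1 + \<beta>)" for u
  define k where "k u = \<phi>' (t - u) * u powr (- \<beta>)" for u
  have [measurable]: "\<phi>' \<in> borel_measurable borel"
    by (rule borel_measurable_continuous_onI[OF cont'])
  have [measurable]: "h \<in> borel_measurable borel" "k \<in> borel_measurable borel"
    unfolding h_def[abs_def] k_def[abs_def] by measurable
  have near0: "integrable lborel (\<lambda>u. K * (indicator {0<..<t} u * u powr (- \<beta>)))"
    using integrable_powr_near_0[of \<beta> t] beta t by simp
  have diff: "\<bar>\<phi> t - \<phi> (t - u)\<bar> \<le> K * u" if "0 < u" "u < t" for u
  proof -
    have "K * u * exp (- \<epsilon> * (t - u)) \<le> K * u * 1"
      using that eps K_nonneg by (intro mult_left_mono) auto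
    then show ?thesis using phi_diff_bound[of u t] that by linarith
  qed
  have h_int: "integrable lborel (\<lambda>u. indicator {0<..<t} u * h u)"
  proof (rule Bochner_Integration.integrable_bound[OF near0])
    show "AE u in lborel. norm (indicator {0<..<t} u * h u)
        \<le> norm (K * (indicator {0<..<t} u * u powr (- \<beta>)))"
    proof (rule AE_I2)
      fix u
      have "\<bar>h u\<bar> \<le> K * u powr (- \<beta>)" if u: "0 < u" "u < t"
      proof -
        have "\<bar>h u\<bar> \<le> K * u / u powr (1 + \<beta>)"
          unfolding h_def abs_divide using diff[OF u] by (simp add: divide_right_mono)
        also have "\<dots> = K * u powr (- \<beta>)" using u by (simp add: powr_add powr_minus_divide)
        finally show ?thesis .
      qed
      then show "norm (indicator {0<..<t} u * h u)
          \<le> norm (K * (indicator {0<..<t} u * u powr (- \<beta>)))"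
        using K_nonneg by (auto simp: indicator_def)
    qed
  qed measurable
  have k_int: "integrable lborel (\<lambda>u. indicator {0<..<t} u * k u)"
  proof (rule Bochner_Integration.integrable_bound[OF near0])
    show "AE u in lborel. norm (indicator {0<..<t} u * k u)
        \<le> norm (K * (indicator {0<..<t} u * u powr (- \<beta>)))"
    proof (rule AE_I2)
      fix u
      have "\<bar>k u\<bar> \<le> K * u powr (- \<beta>)" if u: "0 < u" "u < t"
      proof -
        have "\<bar>\<phi>' (t - u)\<bar> \<le> K * exp (- \<epsilon> * (t - u))" using bound'[of "t - u"] u by simp
        also have "\<dots> \<le> K * 1" using u eps K_nonneg by (intro mult_left_mono) auto
        finally show ?thesis by (simp add: k_def abs_mult mult_right_mono)
      qed
      then show "norm (indicator {0<..<t} u * k u)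
          \<le> norm (K * (indicator {0<..<t} u * u powr (- \<beta>)))"
        using K_nonneg by (auto simp: indicator_def)
    qed
  qed measurable
  define F where "F u = - (\<phi> t - \<phi> (t - u)) * u powr (- \<beta>)" for u
  have "interval_lebesgue_integral lborel (ereal 0) (ereal t) (\<lambda>u. \<beta> * h u - k u) = F t - 0"
  proof (rule interval_integral_FTC_integrable)
    fix u assume "ereal 0 < ereal u" "ereal u < ereal t"
    then have u: "0 < u" "u < t" by auto
    have d: "((\<lambda>u. \<phi> (t - u)) has_real_derivative - \<phi>' (t - u)) (at u)"
    proof -
      have "((\<lambda>u. t - u) has_real_derivative -1) (at u)" by (auto intro!: derivative_eq_intros)
      from DERIV_chain2[OF deriv this] show ?thesis by simp
    qed
    have "(F has_real_derivative (- (0 - - \<phi>' (t - u))) * u powr (- \<beta>)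
        + (- \<beta> * u powr (- \<beta> - 1)) * (- (\<phi> t - \<phi> (t - u)))) (at u)"
      unfolding F_def[abs_def]
      by (intro DERIV_mult DERIV_minus DERIV_diff DERIV_const d has_real_derivative_powr u)
    also have "(- (0 - - \<phi>' (t - u))) * u powr (- \<beta>)
        + (- \<beta> * u powr (- \<beta> - 1)) * (- (\<phi> t - \<phi> (t - u))) = \<beta> * h u - k u"
    proof -
      have "u powr (- \<beta> - 1) = 1 / u powr (1 + \<beta>)"
        using powr_minus_divide[of u "1 + \<beta>"] by (simp add: minus_diff_commute)
      then show ?thesis by (simp add: h_def k_def right_diff_distrib diff_divide_distrib)
    qed
    finally show "(F has_vector_derivative \<beta> * h u - k u) (at u)"
      unfolding has_real_derivative_iff_has_vector_derivative .
    have "isCont \<phi>' x" for x using cont' by (simp add: continuous_on_eq_continuous_at)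
    then show "isCont (\<lambda>u. \<beta> * h u - k u) u"
      unfolding h_def k_def using u DERIV_isCont[OF deriv]
      by (intro continuous_intros isCont_o2[where f = "\<lambda>u. t - u"]) auto
  next
    show "set_integrable lborel (einterval (ereal 0) (ereal t)) (\<lambda>u. \<beta> * h u - k u)"
      unfolding set_integrable_def einterval_eq
      using Bochner_Integration.integrable_diff[OF integrable_mult_right[OF h_int, of \<beta>] k_int]
      by (simp add: right_diff_distrib mult.left_commute)
    have "(F \<longlongrightarrow> 0) (at_right 0)"
    proof (rule Lim_null_comparison)
      show "eventually (\<lambda>u. norm (F u) \<le> K * u powr (1 - \<beta>)) (at_right 0)"
        using eventually_at_right_less[of 0] eventually_at_right_real[OF t]
      proof eventually_elim
        case (elim u)
        have "\<bar>F u\<bar> = \<bar>\<phi> t - \<phi> (t - u)\<bar> * u powr (- \<beta>)"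
            by (simp add: F_def abs_mult abs_minus_commute)
        also have "\<dots> \<le> K * u * u powr (- \<beta>)" using diff[of u] elim by (intro mult_right_mono) auto
        also have "\<dots> = K * u powr (1 - \<beta>)" using elim by (simp add: powr_diff powr_minus_divide)
        finally show ?case by simp
      qed
      have "continuous_on {0..} (\<lambda>u. K * u powr (1 - \<beta>))"
        using beta by (intro continuous_intros continuous_on_powr') auto
      then have "((\<lambda>u. K * u powr (1 - \<beta>)) \<longlongrightarrow> K * 0 powr (1 - \<beta>)) (at 0 within {0..})"
        unfolding continuous_on_def by (rule bspec) simp
      then have "((\<lambda>u. K * u powr (1 - \<beta>)) \<longlongrightarrow> K * 0 powr (1 - \<beta>)) (at_right 0)"
        by (rule tendsto_within_subset) auto
      then show "((\<lambda>u. K * u powr (1 - \<beta>)) \<longlongrightarrow> 0) (at_right 0)"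
        by (simp only: powr_0 mult_zero_right)
    qed
    then show "((F \<circ> real_of_ereal) \<longlongrightarrow> 0) (at_right (ereal 0))"
      unfolding ereal_tendsto_simps1 .
    have "isCont F t"
      unfolding F_def using t DERIV_isCont[OF deriv]
      by (intro continuous_intros isCont_o2[where f = "\<lambda>u. t - u"]) auto
    then show "((F \<circ> real_of_ereal) \<longlongrightarrow> F t) (at_left (ereal t))"
      unfolding ereal_tendsto_simps1 isCont_def by (rule tendsto_within_subset) auto
  qed (use t in auto)
  moreover have "interval_lebesgue_integral lborel (ereal 0) (ereal t) (\<lambda>u. \<beta> * h u - k u)
      = (LBINT u. \<beta> * (indicator {0<..<t} u * h u) - indicator {0<..<t} u * k u)"
    using t by (simp add: interval_lebesgue_integral_def einterval_eq set_lebesgue_integral_def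
        right_diff_distrib mult.left_commute)
  moreover have "\<dots> = \<beta> * (LBINT u. indicator {0<..<t} u * h u) - (LBINT u. indicator {0<..<t} u * k
      u)"
    by (subst Bochner_Integration.integral_diff) (use h_int k_int in auto)
  ultimately have parts: "\<beta> * (LBINT u. indicator {0<..<t} u * h u)
      = (LBINT u. indicator {0<..<t} u * k u) - (\<phi> t - \<phi> 0) * t powr (- \<beta>)"
    by (simp add: F_def algebra_simps)
  have ne: "AE u in lborel. u \<noteq> 0 \<and> u \<noteq> t"
    using AE_lborel_singleton[of 0] AE_lborel_singleton[of t] by eventually_elim simp
  have tail0: "integrable lborel (\<lambda>u. indicator {t..} u / u powr (1 + \<beta>))"
    "(LBINT u. indicator {t..} u / u powr (1 + \<beta>)) = t powr (- \<beta>) / \<beta>"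
    using powr_tail[OF beta(1) t] by (auto simp: has_bochner_integral_iff)
  have tail: "integrable lborel (\<lambda>u. \<phi> t * (indicator {t..} u / u powr (1 + \<beta>)))"
    "(LBINT u. \<phi> t * (indicator {t..} u / u powr (1 + \<beta>))) = \<phi> t * (t powr (- \<beta>) / \<beta>)"
    using tail0(1)
        by (intro integrable_mult_right) (simp_all only: integral_mult_right_zero tail0(2))
  have "increment_integral w0 f t
      = (LBINT u. \<beta> / Gamma (1 - \<beta>) * (indicator {0<..<t} u * h u
          + \<phi> t * (indicator {t..} u / u powr (1 + \<beta>))))"
    unfolding increment_integral_def
  proof (rule integral_cong_AE)
    show "AE u in lborel. (f t - f (t - u)) * w0 u
       = \<beta> / Gamma (1 - \<beta>) * (indicator {0<..<t} u * h u + \<phi> t * (indicator {t..} u / u powr (1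
           + \<beta>)))"
      using ne
    proof eventually_elim
      case (elim u)
      consider "u < 0" | "0 < u" "u < t" | "t < u" using elim by linarith
      then show ?case using t by cases (auto simp: f_def frac_weight_0 h_def)
    qed
  qed measurable
  also have "\<dots> = \<beta> / Gamma (1 - \<beta>) * ((LBINT u. indicator {0<..<t} u * h u)
      + \<phi> t * (t powr (- \<beta>) / \<beta>))"
    using h_int tail by (simp only: integral_mult_right_zero Bochner_Integration.integral_add)
  also have "\<dots> = 1 / Gamma (1 - \<beta>) * (\<beta> * (LBINT u. indicator {0<..<t} u * h u)
      + \<phi> t * t powr (- \<beta>))"
    using beta(1) by (simp add: distrib_left add_divide_distrib)
  also have "\<dots> = 1 / Gamma (1 - \<beta>) * (\<phi> 0 * t powr (- \<beta>) + (LBINT u. indicator {0<..<t} u * k u))"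
    unfolding parts by (simp add: algebra_simps)
  also have "(LBINT u. indicator {0<..<t} u * k u) = (LBINT u:{0..t}. \<phi>' (t - u) * u powr (- \<beta>))"
    unfolding set_lebesgue_integral_def
  proof (rule integral_cong_AE)
    show "AE u in lborel. indicator {0<..<t} u * k u
        = indicator {0..t} u *\<^sub>R (\<phi>' (t - u) * u powr (- \<beta>))"
      using ne by eventually_elim (auto simp: k_def indicator_def)
  qed measurable
  finally show ?thesis .
qed

text \<open>The increments are at most \<open>2 K min u 1\<close>, except for \<open>u \<ge> t\<close>, where the jump at \<open>0\<close> costs
  another \<open>K\<close>; the weight of \<open>u \<ge> t\<close> is of order \<open>t\<^sup>-\<^sup>\<beta>\<close>.\<close>

lemma frac_deriv_bound:
  obtains D where "0 \<le> D" "\<And>t. 0 < t \<Longrightarrow> \<bar>increment_integral w0 f t\<bar> \<le> D * (1 + t powr (- \<beta>))"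
proof -
  define c where "c = \<beta> / Gamma (1 - \<beta>)"
  have c: "0 < c" unfolding c_def by (rule Gamma_const_pos[OF beta])
  have i1: "integrable lborel (\<lambda>u. 2 * K * (c * (indicator {0<..} u * min u 1 / u powr (1 + \<beta>))))"
    by (intro integrable_mult_right integrable_min_frac beta)
  define D where "D = (LBINT u. 2 * K * (c * (indicator {0<..} u * min u 1 / u powr (1 + \<beta>))))
      + K * (c / \<beta>)"
  have D1: "0 \<le> (LBINT u. 2 * K * (c * (indicator {0<..} u * min u 1 / u powr (1 + \<beta>))))"
    using K_nonneg c by (intro integral_nonneg_AE AE_I2) (auto simp: indicator_def)
  have "\<bar>increment_integral w0 f t\<bar> \<le> D * (1 + t powr (- \<beta>))" if t: "0 < t" for t
  proof -
    let ?g = "\<lambda>u. 2 * K * (c * (indicator {0<..} u * min u 1 / u powr (1 + \<beta>)))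
        + K * (c * (indicator {t..} u / u powr (1 + \<beta>)))"
    have tail: "integrable lborel (\<lambda>u. indicator {t..} u / u powr (1 + \<beta>))"
      "(LBINT u. indicator {t..} u / u powr (1 + \<beta>)) = t powr (- \<beta>) / \<beta>"
      using powr_tail[OF beta(1) t] by (auto simp: has_bochner_integral_iff)
    have i2: "integrable lborel (\<lambda>u. K * (c * (indicator {t..} u / u powr (1 + \<beta>))))"
      "(LBINT u. K * (c * (indicator {t..} u / u powr (1 + \<beta>)))) = K * (c * (t powr (- \<beta>) / \<beta>))"
      using tail(1)
          by (intro integrable_mult_right) (simp_all only: integral_mult_right_zero tail(2))
    have le: "norm ((f t - f (t - u)) * w0 u) \<le> ?g u" for u
    proof (cases "0 < u")
      case u: True
      have w: "w0 u = c * (1 / u powr (1 + \<beta>))" using u by (simp add: frac_weight_0 c_def)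
      have p: "0 \<le> c * (1 / u powr (1 + \<beta>))" using c by simp
      have "\<bar>f t - f (t - u)\<bar> \<le> 2 * K * min u 1 + K * indicator {t..} u"
      proof (cases "t \<le> u")
        case True
        have "\<bar>f t - f (t - u)\<bar> \<le> K \<or> u = t"
          using True f_le_K[of t] by (auto simp: f_def)
        moreover have "\<bar>\<phi> t - \<phi> 0\<bar> \<le> 2 * K * min t 1 + K" if "u = t"
        proof (cases "t \<le> 1")
          case True
          have "\<bar>\<phi> t - \<phi> 0\<bar> \<le> K * t * exp (- \<epsilon> * (t - t))" using phi_diff_bound[of t t] t by simp
          also have "\<dots> = K * t" by simp
          also have "\<dots> \<le> 2 * K * t" using K_nonneg t by (intro mult_right_mono) auto
          finally show ?thesis using True K_nonneg by simp
        next
          case False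
          then show ?thesis using f_le_K[of t] f_le_K[of 0] K_nonneg t by (simp add: f_def)
        qed
        moreover have "0 \<le> 2 * K * min u 1" using K_nonneg u by simp
        ultimately have "\<bar>f t - f (t - u)\<bar> \<le> 2 * K * min u 1 + K"
          by (cases "u = t") (use t in \<open>simp add: f_def\<close>, linarith)
        then show ?thesis using True by simp
      next
        case False
        then have eq: "f t - f (t - u) = \<phi> t - \<phi> (t - u)" using t by (simp add: f_def)
        have "\<bar>\<phi> t - \<phi> (t - u)\<bar> \<le> K * u * exp (- \<epsilon> * (t - u))" using phi_diff_bound[of u t] u False
            by simp
        also have "\<dots> \<le> K * u * 1" using False u eps K_nonneg by (intro mult_left_mono) auto
        also have "\<dots> \<le> 2 * K * u" using K_nonneg u by simp
        finally have a: "\<bar>f t - f (t - u)\<bar> \<le> 2 * K * u" unfolding eq .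
        have b: "\<bar>f t - f (t - u)\<bar> \<le> 2 * K" using f_le_K[of t] f_le_K[of "t - u"] by linarith
        from a b show ?thesis using False by (auto simp: min_def)
      qed
      then have "\<bar>f t - f (t - u)\<bar> * (c * (1 / u powr (1 + \<beta>))) \<le> (2 * K * min u 1
          + K * indicator {t..} u) * (c * (1 / u powr (1 + \<beta>)))"
        using p by (rule mult_right_mono)
      also have "\<dots> = ?g u" using u by (simp add: algebra_simps)
      finally show ?thesis using c by (simp add: w abs_mult)
    next
      case False
      then show ?thesis using c K_nonneg t by (auto simp: frac_weight_0)
    qed
    have g: "integrable lborel ?g" by (rule Bochner_Integration.integrable_add[OF i1 i2(1)])
    have "integrable lborel (\<lambda>u. (f t - f (t - u)) * w0 u)"
      by (rule Bochner_Integration.integrable_bound[OF g]) (use le order_trans[OF _ abs_ge_self] in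
          auto)
    then have "norm (increment_integral w0 f t) \<le> (LBINT u. ?g u)"
      unfolding increment_integral_def using g le
      by (intro order_trans[OF integral_norm_bound integral_mono]) auto
    also have "\<dots> = (LBINT u. 2 * K * (c * (indicator {0<..} u * min u 1 / u powr (1 + \<beta>))))
        + K * (c / \<beta>) * t powr (- \<beta>)"
      using Bochner_Integration.integral_add[OF i1 i2(1)] i2(2) by simp
    also have "\<dots> \<le> D * (1 + t powr (- \<beta>))"
      using D1 K_nonneg c beta by (simp add: D_def distrib_left distrib_right)
    finally show ?thesis by simp
  qed
  moreover have "0 \<le> D" using D1 K_nonneg c beta by (simp add: D_def)
  ultimately show thesis using that by blast
qed

text \<open>Near \<open>0\<close> the square is at most a multiple of \<open>t\<^sup>-\<^sup>2\<^sup>\<beta>\<close>; for \<open>t \<ge> 1\<close> the function is bounded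
  and integrable.\<close>

lemma frac_deriv_L2:
  assumes "\<beta> < 1 / 2"
  shows "integrable lborel (\<lambda>t. (increment_integral w0 f t)\<^sup>2)"
proof -
  obtain D where D: "0 \<le> D" "\<And>t. 0 < t \<Longrightarrow> \<bar>increment_integral w0 f t\<bar> \<le> D * (1 + t powr (- \<beta>))"
    using frac_deriv_bound by blast
  let ?F = "increment_integral w0 f"
  have [measurable]: "?F \<in> borel_measurable borel"
    using frac_deriv_integrable by simp
  have i: "integrable lborel (\<lambda>t. 4 * D\<^sup>2 * (indicator {0<..<1} t * t powr (- (2 * \<beta>)))
      + 2 * D * \<bar>?F t\<bar>)"
    using integrable_powr_near_0[of "2 * \<beta>" 1] assms frac_deriv_integrable
    by (intro Bochner_Integration.integrable_add integrable_mult_right integrable_abs) auto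
  show ?thesis
  proof (rule Bochner_Integration.integrable_bound[OF i])
    show "AE t in lborel. norm ((?F t)\<^sup>2)
       \<le> norm (4 * D\<^sup>2 * (indicator {0<..<1} t * t powr (- (2 * \<beta>))) + 2 * D * \<bar>?F t\<bar>)"
      using AE_lborel_singleton[of 0]
    proof eventually_elim
      case (elim t)
      have nn: "0 \<le> 4 * D\<^sup>2 * (indicator {0<..<1} t * t powr (- (2 * \<beta>)))" "0 \<le> 2 * D * \<bar>?F t\<bar>"
        using D(1) by auto
      consider "t < 0" | "0 < t" "t < 1" | "1 \<le> t" using elim by linarith
      then have "(?F t)\<^sup>2 \<le> 4 * D\<^sup>2 * (indicator {0<..<1} t * t powr (- (2 * \<beta>))) + 2 * D * \<bar>?F t\<bar>"
      proof cases
        case 1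
        then have z: "(\<lambda>u. (f t - f (t - u)) * w0 u) = (\<lambda>u. 0)"
          by (auto simp: f_def frac_weight_0 indicator_def)
        have "?F t = 0" unfolding increment_integral_def z by simp
        then show ?thesis using nn by simp
      next
        case 2
        have "1 \<le> t powr (- \<beta>)" using 2 beta
            by (simp add: ge_one_powr_ge_zero powr_minus_divide powr_le1)
        then have "\<bar>?F t\<bar> \<le> D * (2 * t powr (- \<beta>))"
          using D(2)[OF 2(1)] mult_left_mono[OF _ D(1), of "1 + t powr (- \<beta>)" "2 * t powr (- \<beta>)"]
              by linarith
        then have "\<bar>?F t\<bar>\<^sup>2 \<le> (D * (2 * t powr (- \<beta>)))\<^sup>2" by (intro power_mono) auto
        also have "\<dots> = 4 * D\<^sup>2 * t powr (- (2 * \<beta>))"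
          using 2 by (simp add: power2_eq_square powr_add[symmetric])
        finally show ?thesis using 2 nn by simp
      next
        case 3
        have "t powr (- \<beta>) \<le> 1" using 3 beta by (simp add: powr_minus_divide ge_one_powr_ge_zero)
        then have "\<bar>?F t\<bar> \<le> 2 * D"
          using D(2)[of t] 3 mult_left_mono[OF _ D(1), of "1 + t powr (- \<beta>)" "2"] by linarith
        then have "\<bar>?F t\<bar> * \<bar>?F t\<bar> \<le> 2 * D * \<bar>?F t\<bar>" by (intro mult_right_mono) auto
        then have "(?F t)\<^sup>2 \<le> 2 * D * \<bar>?F t\<bar>" by (simp add: power2_eq_square)
        then show ?thesis using nn(1) by linarith
      qed
      then show ?case by simp
    qed
  qed measurable
qed

end

section \<open>The exponential kernel\<close>

lemma continuous_on_mat_exp: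
  fixes A :: "real ^ 'n ^ 'n"
  shows "continuous_on S (\<lambda>t. mat_exp (t *\<^sub>R A))"
proof -
  have "continuous_on S (\<lambda>t. \<chi> i j. mat_exp (t *\<^sub>R A) $ i $ j)"
    by (intro continuous_on_vec_lambda continuous_at_imp_continuous_on ballI)
      (rule DERIV_isCont[OF mat_exp_entry_deriv])
  then show ?thesis by (simp only: vec_nth_inverse)
qed

lemma exp_kernel_deriv:
  fixes A :: "real ^ 'n ^ 'n"
  shows "((\<lambda>t. b \<bullet> (mat_exp (t *\<^sub>R A) *v v)) has_real_derivative b \<bullet> (mat_exp (t *\<^sub>R A) *v (A *v
      v))) (at t)"
proof -
  have "((\<lambda>t. \<Sum>i\<in>UNIV. b $ i * (\<Sum>j\<in>UNIV. mat_exp (t *\<^sub>R A) $ i $ j * v $ j)) has_real_derivative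
      (\<Sum>i\<in>UNIV. b $ i * (\<Sum>j\<in>UNIV. (A ** mat_exp (t *\<^sub>R A)) $ i $ j * v $ j))) (at t)"
    by (intro DERIV_sum DERIV_cmult DERIV_cmult_right mat_exp_entry_deriv)
  also have "(\<Sum>i\<in>UNIV. b $ i * (\<Sum>j\<in>UNIV. (A ** mat_exp (t *\<^sub>R A)) $ i $ j * v $ j))
      = b \<bullet> ((mat_exp (t *\<^sub>R A) ** A) *v v)"
    by (simp add: inner_vec_def matrix_vector_mult_def mat_exp_commute)
  finally show ?thesis
    by (simp add: inner_vec_def matrix_vector_mult_def[of "mat_exp _"] matrix_vector_mul_assoc)
qed

lemma integrable_powr_mat_exp:
  fixes A :: "real ^ 'n ^ 'n"
  assumes "0 < \<beta>" "\<beta> < 1" "0 < t"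
  shows "set_integrable lborel {0..t} (\<lambda>u. (u powr (- \<beta>)) *\<^sub>R mat_exp (- (u *\<^sub>R A)))"
proof -
  have c: "continuous_on UNIV (\<lambda>u. mat_exp (- (u *\<^sub>R A)))"
    using continuous_on_compose2[OF continuous_on_mat_exp[of UNIV A] continuous_on_minus[OF
        continuous_on_id], of UNIV]
    by simp
  then have [measurable]: "(\<lambda>u. mat_exp (- (u *\<^sub>R A))) \<in> borel_measurable borel"
    by (rule borel_measurable_continuous_onI)
  have "bounded ((\<lambda>u. mat_exp (- (u *\<^sub>R A))) ` {0..t})"
    by (intro compact_imp_bounded compact_continuous_image continuous_on_subset[OF c]) auto
  then obtain B where "\<forall>u\<in>{0..t}. norm (mat_exp (- (u *\<^sub>R A))) \<le> B"
    by (auto simp: bounded_iff)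
  then have B: "\<And>u. u \<in> {0..t} \<Longrightarrow> norm (mat_exp (- (u *\<^sub>R A))) \<le> B" by blast
  have i: "integrable lborel (\<lambda>u. B * (indicator {0<..<t + 1} u * u powr (- \<beta>)))"
    using assms by (intro integrable_mult_right integrable_powr_near_0) auto
  show ?thesis
    unfolding set_integrable_def
  proof (rule Bochner_Integration.integrable_bound[OF i])
    show "AE u in lborel. norm (indicator {0..t} u *\<^sub>R ((u powr (- \<beta>)) *\<^sub>R mat_exp (- (u *\<^sub>R A))))
       \<le> norm (B * (indicator {0<..<t + 1} u * u powr (- \<beta>)))"
    proof (rule AE_I2)
      fix u
      show "norm (indicator {0..t} u *\<^sub>R ((u powr (- \<beta>)) *\<^sub>R mat_exp (- (u *\<^sub>R A))))
       \<le> norm (B * (indicator {0<..<t + 1} u * u powr (- \<beta>)))"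
      proof (cases "u \<in> {0<..t}")
        case True
        then show ?thesis
            using mult_right_mono[OF B[of u], of "u powr (- \<beta>)"] order_trans[OF norm_ge_zero B[of
                u]]
          by (simp add: abs_mult mult.commute)
      qed (auto simp: indicator_def)
    qed
  qed measurable
qed

lemma matrix_scaleR_right: "A ** (c *\<^sub>R B) = c *\<^sub>R (A ** (B :: real ^ 'n ^ 'm))"
  by (simp add: vec_eq_iff matrix_matrix_mult_def sum_distrib_left mult_ac)

text \<open>A linear functional is pulled into the matrix-valued integral, and
  \<open>A e\<^sup>t\<^sup>A e\<^sup>-\<^sup>u\<^sup>A = e\<^sup>(\<^sup>t\<^sup>-\<^sup>u\<^sup>)\<^sup>A A\<close>.\<close>

lemma exp_kernel_frac_deriv_eq:
  fixes A :: "real ^ 'n::{finite,linorder} ^ 'n::{finite,linorder}"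
  assumes "0 < \<beta>" "\<beta> < 1" "0 < t"
  shows "exp_kernel_frac_deriv \<beta> A b t = 1 / Gamma (1 - \<beta>) *
    (b \<bullet> (mat_exp (0 *\<^sub>R A) *v e1) * t powr (- \<beta>)
      + (LBINT u:{0..t}. b \<bullet> (mat_exp ((t - u) *\<^sub>R A) *v (A *v e1)) * u powr (- \<beta>)))"
proof -
  let ?E = "\<lambda>t. mat_exp (t *\<^sub>R A)"
  define l :: "real ^ 'n::{finite,linorder} ^ 'n::{finite,linorder} \<Rightarrow> real" where "l M
      = b \<bullet> ((A ** ?E t ** M) *v e1)" for M
  have "linear l"
    by (rule linearI)
      (simp_all add: l_def matrix_add_ldistrib matrix_vector_mult_add_rdistrib inner_add_right
        scaleR_matrix_vector_assoc[symmetric] matrix_scaleR_right)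
  then have bl: "bounded_linear l" by (simp add: linear_conv_bounded_linear)
  have l: "l (mat_exp (- (u *\<^sub>R A))) = b \<bullet> (?E (t - u) *v (A *v e1))" for u
  proof -
    have "A ** ?E t ** mat_exp (- (u *\<^sub>R A)) = ?E (t - u) ** A"
      using mat_exp_add[of t A "- u"] by (simp add: matrix_mul_assoc[symmetric] mat_exp_commute)
    then show ?thesis by (simp add: l_def matrix_vector_mul_assoc)
  qed
  have "l (LBINT u:{0..t}. (u powr (- \<beta>)) *\<^sub>R mat_exp (- (u *\<^sub>R A)))
      = (LBINT u:{0..t}. l ((u powr (- \<beta>)) *\<^sub>R mat_exp (- (u *\<^sub>R A))))"
    unfolding set_lebesgue_integral_def
    using integral_bounded_linear[OF bl integrable_powr_mat_exp[OF assms, of A, unfolded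
        set_integrable_def]]
    by (simp only: linear_cmul[OF \<open>linear l\<close>])
  also have "\<dots> = (LBINT u:{0..t}. b \<bullet> (?E (t - u) *v (A *v e1)) * u powr (- \<beta>))"
    by (simp add: linear_cmul[OF \<open>linear l\<close>] l mult.commute)
  finally show ?thesis
    using assms
    by (simp add: exp_kernel_frac_deriv_def l_def matrix_vector_mult_add_rdistrib inner_add_right
        scaleR_matrix_vector_assoc[symmetric] mat_exp_zero)
qed

lemma decaying_half_line_function_exp_kernel:
  fixes A :: "real ^ 'n::{finite,linorder} ^ 'n::{finite,linorder}"
  assumes "0 < \<beta>" "\<beta> < 1" "\<And>z. eigenvalue (cmat A) z \<Longrightarrow> Re z < 0"
  obtains K \<epsilon> where "decaying_half_line_function (\<lambda>t. b \<bullet> (mat_exp (t *\<^sub>R A) *v e1))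
     (\<lambda>t. b \<bullet> (mat_exp (t *\<^sub>R A) *v (A *v e1))) K \<epsilon> \<beta>"
proof -
  obtain K \<epsilon> where 1: "0 < \<epsilon>" "\<And>t. t \<ge> 0 \<Longrightarrow> \<bar>b \<bullet> (mat_exp (t *\<^sub>R A) *v e1)\<bar> \<le> K * exp (- \<epsilon> * t)"
    using exp_decay_mat_exp[where A = A and b = b and v = e1, OF assms(3)] unfolding exp_decay_def
        by auto
  obtain J \<delta> where 2: "0 < \<delta>" "\<And>t. t \<ge> 0 \<Longrightarrow> \<bar>b \<bullet> (mat_exp (t *\<^sub>R A) *v (A *v e1))\<bar>
      \<le> J * exp (- \<delta> * t)"
    using exp_decay_mat_exp[where A = A and b = b and v
        = "A *v e1", OF assms(3)] unfolding exp_decay_def by auto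
  have nn: "0 \<le> K" "0 \<le> J" using 1(2)[of 0] 2(2)[of 0] by auto
  have mono: "c * exp (- \<eta> * t) \<le> max K J * exp (- min \<epsilon> \<delta> * t)"
    if "0 \<le> c" "c \<le> max K J" "min \<epsilon> \<delta> \<le> \<eta>" "0 \<le> t" for c \<eta> t
    using that by (intro mult_mono) (auto intro: mult_right_mono)
  show thesis
  proof (rule that[of "max K J" "min \<epsilon> \<delta>"], unfold_locales)
    show "((\<lambda>t. b \<bullet> (mat_exp (t *\<^sub>R A) *v e1)) has_real_derivative b \<bullet> (mat_exp (t *\<^sub>R A) *v (A *v
        e1))) (at t)" for t
      by (rule exp_kernel_deriv)
    show "continuous_on UNIV (\<lambda>t. b \<bullet> (mat_exp (t *\<^sub>R A) *v (A *v e1)))"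
      by (intro continuous_at_imp_continuous_on ballI DERIV_isCont[OF exp_kernel_deriv])
    show "0 < min \<epsilon> \<delta>" using 1(1) 2(1) by simp
    show "\<bar>b \<bullet> (mat_exp (t *\<^sub>R A) *v e1)\<bar> \<le> max K J * exp (- min \<epsilon> \<delta> * t)" if "0 \<le> t" for t
      using 1(2)[OF that] mono[of K \<epsilon> t] nn that by simp
    show "\<bar>b \<bullet> (mat_exp (t *\<^sub>R A) *v (A *v e1))\<bar> \<le> max K J * exp (- min \<epsilon> \<delta> * t)" if "0 \<le> t" for t
      using 2(2)[OF that] mono[of J \<delta> t] nn that by simp
  qed (use assms in auto)
qed

lemma exp_kernel_frac_deriv_properties:
  fixes A :: "real ^ 'n::{finite,linorder} ^ 'n::{finite,linorder}"
  assumes "0 < \<beta>" "\<beta> < 1 / 2" "\<And>z. eigenvalue (cmat A) z \<Longrightarrow> Re z < 0"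
  shows "integrable lborel (exp_kernel A b)"
    and "integrable lborel (exp_kernel_frac_deriv \<beta> A b)"
    and "in_L2 lborel (exp_kernel_frac_deriv \<beta> A b)"
    and "(\<And>n. 0 < \<delta> n) \<Longrightarrow> \<delta> \<longlonglongrightarrow> 0 \<Longrightarrow>
      (\<lambda>n. \<integral>\<^sup>+t. ennreal \<bar>increment_integral (frac_weight \<beta> (\<delta> n)) (exp_kernel A b) t
         - exp_kernel_frac_deriv \<beta> A b t\<bar> \<partial>lborel) \<longlonglongrightarrow> 0"
proof -
  have beta1: "\<beta> < 1" using assms(2) by simp
  obtain K \<epsilon> where "decaying_half_line_function (\<lambda>t. b \<bullet> (mat_exp (t *\<^sub>R A) *v e1))
     (\<lambda>t. b \<bullet> (mat_exp (t *\<^sub>R A) *v (A *v e1))) K \<epsilon> \<beta>"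
    using decaying_half_line_function_exp_kernel[OF assms(1) beta1 assms(3)] by blast
  then interpret decaying_half_line_function "\<lambda>t. b \<bullet> (mat_exp (t *\<^sub>R A) *v e1)"
     "\<lambda>t. b \<bullet> (mat_exp (t *\<^sub>R A) *v (A *v e1))" K \<epsilon> \<beta> .
  have f: "f = exp_kernel A b" by (auto simp: f_def exp_kernel_def)
  show "integrable lborel (exp_kernel A b)" using f_integrable by (simp only: f)
  let ?F = "increment_integral w0 (exp_kernel A b)"
  let ?G = "exp_kernel_frac_deriv \<beta> A b"
  have pos: "?G t = ?F t" if "0 < t" for t
    using increment_integral_eq[OF that] exp_kernel_frac_deriv_eq[OF assms(1) beta1 that]
        by (simp only: f)
  have neg: "?G t = ?F t" if "t < 0" for t
  proof -
    have z: "(\<lambda>u. (exp_kernel A b t - exp_kernel A b (t - u)) * w0 u) = (\<lambda>u. 0)"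
      using that by (auto simp: exp_kernel_def frac_weight_0 indicator_def)
    show ?thesis unfolding increment_integral_def z using that
        by (simp add: exp_kernel_frac_deriv_def)
  qed
  have ae: "AE t in lborel. ?G t = ?F t"
    using AE_lborel_singleton[of 0]
        by eventually_elim (use pos neg in \<open>metis linorder_neqE_linordered_idom\<close>)
  have [measurable]: "?F \<in> borel_measurable borel" using frac_deriv_integrable by (simp add: f)
  have "?G = (\<lambda>t. if t = 0 then 0 else ?F t)"
    using pos neg by (metis exp_kernel_frac_deriv_def less_irrefl linorder_neqE_linordered_idom)
  then have [measurable]: "?G \<in> borel_measurable borel" by simp
  show "integrable lborel ?G"
    using frac_deriv_integrable integrable_cong_AE[OF _ _ ae] by (simp add: f)
  have "integrable lborel (\<lambda>t. (?G t)\<^sup>2)"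
  proof (subst integrable_cong_AE)
    show "AE t in lborel. (?G t)\<^sup>2 = (?F t)\<^sup>2" using ae by eventually_elim simp
    show "integrable lborel (\<lambda>t. (?F t)\<^sup>2)" using frac_deriv_L2[OF assms(2)] by (simp only: f)
  qed measurable
  then show "in_L2 lborel ?G" by (simp add: in_L2_def)
  show "(\<lambda>n. \<integral>\<^sup>+t. ennreal \<bar>increment_integral (frac_weight \<beta> (\<delta> n)) (exp_kernel A b) t - ?G t\<bar>
      \<partial>lborel) \<longlonglongrightarrow> 0"
    if "\<And>n. 0 < \<delta> n" "\<delta> \<longlonglongrightarrow> 0"
  proof -
    have "(\<integral>\<^sup>+t. ennreal \<bar>increment_integral (frac_weight \<beta> (\<delta> n)) (exp_kernel A b) t - ?G t\<bar>
        \<partial>lborel)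
      = (\<integral>\<^sup>+t. ennreal \<bar>increment_integral (frac_weight \<beta> (\<delta> n)) (exp_kernel A b) t - ?F t\<bar>
          \<partial>lborel)" for n
      by (rule nn_integral_cong_AE) (use ae in eventually_elim, simp)
    then show ?thesis using truncated_frac_deriv_tendsto_L1[OF that] by (simp only: f)
  qed
qed

section \<open>Square integrable functions\<close>

lemma in_L2_real: "in_L2 M f \<longleftrightarrow> f \<in> borel_measurable M \<and> integrable M (\<lambda>x. (f x)\<^sup>2)"
  for f :: "'a \<Rightarrow> real"
  by (simp add: in_L2_def)

lemma in_L2_mult_integrable:
  fixes f g :: "'a \<Rightarrow> real"
  assumes "in_L2 M f" "in_L2 M g"
  shows "integrable M (\<lambda>x. f x * g x)"
proof -
  have [measurable]: "f \<in> borel_measurable M" "g \<in> borel_measurable M" using assms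
      by (auto simp: in_L2_real)
  show ?thesis
  proof (rule Bochner_Integration.integrable_bound)
    show "integrable M (\<lambda>x. (f x)\<^sup>2 + (g x)\<^sup>2)" using assms by (auto simp: in_L2_real)
    show "AE x in M. norm (f x * g x) \<le> norm ((f x)\<^sup>2 + (g x)\<^sup>2)"
    proof (rule AE_I2)
      fix x
      have "2 * \<bar>f x\<bar> * \<bar>g x\<bar> \<le> (f x)\<^sup>2 + (g x)\<^sup>2"
        using sum_squares_bound[of "\<bar>f x\<bar>" "\<bar>g x\<bar>"] by simp
      moreover have "0 \<le> \<bar>f x\<bar> * \<bar>g x\<bar>" by simp
      ultimately have "\<bar>f x\<bar> * \<bar>g x\<bar> \<le> (f x)\<^sup>2 + (g x)\<^sup>2" by linarith
      then show "norm (f x * g x) \<le> norm ((f x)\<^sup>2 + (g x)\<^sup>2)"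
        by (simp add: abs_mult)
    qed
  qed measurable
qed

lemma in_L2_add:
  fixes f g :: "'a \<Rightarrow> real"
  assumes "in_L2 M f" "in_L2 M g"
  shows "in_L2 M (\<lambda>x. f x + g x)"
  using assms in_L2_mult_integrable[OF assms]
  by (auto simp: in_L2_real power2_sum mult.assoc)

lemma in_L2_cmult:
  fixes f :: "'a \<Rightarrow> real"
  assumes "in_L2 M f" shows "in_L2 M (\<lambda>x. c * f x)"
  using assms by (auto simp: in_L2_real power_mult_distrib)

lemma in_L2_diff:
  fixes f g :: "'a \<Rightarrow> real"
  assumes "in_L2 M f" "in_L2 M g"
  shows "in_L2 M (\<lambda>x. f x - g x)"
  using in_L2_add[OF assms(1) in_L2_cmult[OF assms(2), of "-1"]] by simp

lemma in_L2_zero [simp]: "in_L2 M (\<lambda>x. 0 :: real)"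
  by (simp add: in_L2_real)

lemma in_L2_cong_AE:
  fixes f g :: "'a \<Rightarrow> real"
  assumes "in_L2 M f" "g \<in> borel_measurable M" "AE x in M. f x = g x"
  shows "in_L2 M g"
proof -
  have [measurable]: "f \<in> borel_measurable M" "g \<in> borel_measurable M" using assms
      by (auto simp: in_L2_real)
  have "integrable M (\<lambda>x. (f x)\<^sup>2) = integrable M (\<lambda>x. (g x)\<^sup>2)"
    by (rule integrable_cong_AE) (use assms(3) in auto)
  then show ?thesis using assms by (simp add: in_L2_real)
qed

lemma (in finite_measure) in_L2_integrable:
  fixes f :: "'a \<Rightarrow> real"
  assumes "in_L2 M f" shows "integrable M f"
  using in_L2_mult_integrable[OF assms, of "\<lambda>x. 1"] by (simp add: in_L2_real)

lemma (in prob_space) expectation_abs_le_sqrt: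
  fixes X :: "'a \<Rightarrow> real"
  assumes "in_L2 M X"
  shows "expectation (\<lambda>x. \<bar>X x\<bar>) \<le> sqrt (expectation (\<lambda>x. (X x)\<^sup>2))"
proof -
  have i: "integrable M (\<lambda>x. \<bar>X x\<bar>)" "integrable M (\<lambda>x. \<bar>X x\<bar>\<^sup>2)"
    using in_L2_integrable[OF assms] assms by (auto simp: in_L2_real)
  have "0 \<le> expectation (\<lambda>x. \<bar>X x\<bar>\<^sup>2) - (expectation (\<lambda>x. \<bar>X x\<bar>))\<^sup>2"
    using variance_positive[of "\<lambda>x. \<bar>X x\<bar>"] variance_eq[OF i] by simp
  then show ?thesis by (intro real_le_rsqrt) simp
qed

lemma nonneg_quadratic_discriminant:
  fixes a b c :: real
  assumes quad: "\<And>t. 0 \<le> a + 2 * t * b + t\<^sup>2 * c" and "0 \<le> c"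
  shows "b\<^sup>2 \<le> a * c"
proof (cases "c = 0")
  case True
  have "b = 0"
  proof (rule ccontr)
    assume "b \<noteq> 0"
    then have "a + 2 * (- (a + 1) / (2 * b)) * b = - 1" by (simp add: field_simps)
    moreover have "0 \<le> a + 2 * (- (a + 1) / (2 * b)) * b"
      using quad[of "- (a + 1) / (2 * b)"] by (simp only: True mult_zero_right add_0_right)
    ultimately show False by linarith
  qed
  then show ?thesis by (simp add: True)
next
  case False
  with assms(2) have "0 < c" by simp
  have "0 \<le> (a + 2 * (- b / c) * b + (- b / c)\<^sup>2 * c) * c"
    using quad[of "- b / c"] \<open>0 < c\<close> by (intro mult_nonneg_nonneg) auto
  also have "\<dots> = a * c - b\<^sup>2"
    using \<open>0 < c\<close> by (simp add: power2_eq_square field_simps)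
  finally show ?thesis by simp
qed

lemma cauchy_schwarz_integral:
  fixes f g :: "'a \<Rightarrow> real"
  assumes "in_L2 M f" "in_L2 M g"
  shows "(\<integral>x. f x * g x \<partial>M)\<^sup>2 \<le> (\<integral>x. (f x)\<^sup>2 \<partial>M) * (\<integral>x. (g x)\<^sup>2 \<partial>M)"
proof -
  let ?a = "\<integral>x. (f x)\<^sup>2 \<partial>M" and ?b = "\<integral>x. f x * g x \<partial>M" and ?c = "\<integral>x. (g x)\<^sup>2 \<partial>M"
  have quad: "0 \<le> ?a + 2 * t * ?b + t\<^sup>2 * ?c" for t
  proof -
    have "0 \<le> (\<integral>x. (f x + t * g x)\<^sup>2 \<partial>M)" by simp
    also have "\<dots> = (\<integral>x. (f x)\<^sup>2 + 2 * t * (f x * g x) + t\<^sup>2 * (g x)\<^sup>2 \<partial>M)"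
      by (intro Bochner_Integration.integral_cong) (auto simp: power2_eq_square algebra_simps)
    also have "\<dots> = ?a + 2 * t * ?b + t\<^sup>2 * ?c"
      using assms in_L2_mult_integrable[OF assms] by (simp add: in_L2_real)
    finally show ?thesis .
  qed
  show ?thesis by (rule nonneg_quadratic_discriminant[OF quad]) simp
qed

lemma L2_tendsto_iff:
  fixes F :: "'i \<Rightarrow> 'a \<Rightarrow> real"
  assumes "\<And>k. in_L2 M (F k)" "in_L2 M f"
  shows "L2_tendsto M F f FF \<longleftrightarrow> ((\<lambda>k. \<integral>x. (F k x - f x)\<^sup>2 \<partial>M) \<longlongrightarrow> 0) FF"
proof -
  have "(\<integral>\<^sup>+x. ennreal ((norm (F k x - f x))\<^sup>2) \<partial>M) = ennreal (\<integral>x. (F k x - f x)\<^sup>2 \<partial>M)" for k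
    using in_L2_diff[OF assms] by (subst nn_integral_eq_integral[symmetric]) (auto simp: in_L2_real)
  then show ?thesis
    unfolding L2_tendsto_def
    using tendsto_ennreal_iff[where f = "\<lambda>k. \<integral>x. (F k x - f x)\<^sup>2 \<partial>M" and x = 0 and F = FF]
    by simp
qed

text \<open>Apply the Cauchy-Schwarz inequality to each of the first three terms of
  \<open>F G = (F - f) (G - g) + (F - f) g + f (G - g) + f g\<close>.\<close>

lemma L2_tendsto_inner:
  fixes F G :: "nat \<Rightarrow> 'a \<Rightarrow> real"
  assumes F: "\<And>k. in_L2 M (F k)" "in_L2 M f" "L2_tendsto M F f sequentially"
    and G: "\<And>k. in_L2 M (G k)" "in_L2 M g" "L2_tendsto M G g sequentially"
  shows "(\<lambda>k. \<integral>x. F k x * G k x \<partial>M) \<longlonglongrightarrow> (\<integral>x. f x * g x \<partial>M)"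
proof -
  let ?a = "\<lambda>k. \<integral>x. (F k x - f x)\<^sup>2 \<partial>M" and ?b = "\<lambda>k. \<integral>x. (G k x - g x)\<^sup>2 \<partial>M"
  have lim: "?a \<longlonglongrightarrow> 0" "?b \<longlonglongrightarrow> 0"
    using F(3) G(3) L2_tendsto_iff[of M F f sequentially] L2_tendsto_iff[of M G g sequentially]
        F(1,2) G(1,2)
    by simp_all
  have z: "(\<lambda>k. \<integral>x. h k x * h' k x \<partial>M) \<longlonglongrightarrow> 0"
    if "\<And>k. in_L2 M (h k)" "\<And>k. in_L2 M (h' k)"
      "(\<lambda>k. (\<integral>x. (h k x)\<^sup>2 \<partial>M) * (\<integral>x. (h' k x)\<^sup>2 \<partial>M)) \<longlonglongrightarrow> 0" for h h' :: "nat \<Rightarrow> 'a \<Rightarrow> real"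
  proof (rule Lim_null_comparison)
    show "eventually (\<lambda>k. norm (\<integral>x. h k x * h' k x \<partial>M)
        \<le> sqrt ((\<integral>x. (h k x)\<^sup>2 \<partial>M) * (\<integral>x. (h' k x)\<^sup>2 \<partial>M))) sequentially"
      using cauchy_schwarz_integral[OF that(1,2)] by (auto intro!: always_eventually real_le_rsqrt)
    show "(\<lambda>k. sqrt ((\<integral>x. (h k x)\<^sup>2 \<partial>M) * (\<integral>x. (h' k x)\<^sup>2 \<partial>M))) \<longlonglongrightarrow> 0"
      using tendsto_real_sqrt[OF that(3)] by simp
  qed
  have D: "in_L2 M (\<lambda>x. F k x - f x)" "in_L2 M (\<lambda>x. G k x - g x)" for k
    using F G by (auto intro: in_L2_diff)
  have 1: "(\<lambda>k. \<integral>x. (F k x - f x) * (G k x - g x) \<partial>M) \<longlonglongrightarrow> 0"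
    using tendsto_mult[OF lim] by (intro z D) simp
  have 2: "(\<lambda>k. \<integral>x. (F k x - f x) * g x \<partial>M) \<longlonglongrightarrow> 0"
    using tendsto_mult_right[OF lim(1), of "\<integral>x. (g x)\<^sup>2 \<partial>M"]
        by (intro z D G(2)) (simp add: mult.commute)
  have 3: "(\<lambda>k. \<integral>x. f x * (G k x - g x) \<partial>M) \<longlonglongrightarrow> 0"
    using tendsto_mult_left[OF lim(2), of "\<integral>x. (f x)\<^sup>2 \<partial>M"] by (intro z D F(2)) simp
  have "(\<integral>x. F k x * G k x \<partial>M) = (\<integral>x. (F k x - f x) * (G k x - g x) \<partial>M)
      + (\<integral>x. (F k x - f x) * g x \<partial>M) + (\<integral>x. f x * (G k x - g x) \<partial>M) + (\<integral>x. f x * g x \<partial>M)" for k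
  proof -
    have i: "integrable M (\<lambda>x. (F k x - f x) * (G k x - g x))"
        "integrable M (\<lambda>x. (F k x - f x) * g x)"
      "integrable M (\<lambda>x. f x * (G k x - g x))" "integrable M (\<lambda>x. f x * g x)"
      using D F G by (auto intro: in_L2_mult_integrable)
    have "(\<integral>x. F k x * G k x \<partial>M)
       = (\<integral>x. (F k x - f x) * (G k x - g x) + (F k x - f x) * g x + f x * (G k x - g x)
           + f x * g x \<partial>M)"
      by (intro Bochner_Integration.integral_cong) (auto simp: algebra_simps)
    then show ?thesis
      by (simp only: Bochner_Integration.integral_add Bochner_Integration.integrable_add i)
  qed
  then show ?thesis
    using tendsto_add[OF tendsto_add[OF tendsto_add[OF 1 2] 3] tendsto_const[of "\<integral>x. f x * g x \<partial>M"]]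
        by simp
qed

lemma square_triangle:
  fixes Y Z W :: "'a \<Rightarrow> real"
  assumes "in_L2 M Y" "in_L2 M Z" "in_L2 M W"
  shows "(\<integral>\<omega>. (Y \<omega> - W \<omega>)\<^sup>2 \<partial>M)
    \<le> 2 * (\<integral>\<omega>. (Y \<omega> - Z \<omega>)\<^sup>2 \<partial>M) + 2 * (\<integral>\<omega>. (Z \<omega> - W \<omega>)\<^sup>2 \<partial>M)"
proof -
  have i: "integrable M (\<lambda>\<omega>. (Y \<omega> - W \<omega>)\<^sup>2)" "integrable M (\<lambda>\<omega>. (Y \<omega> - Z \<omega>)\<^sup>2)"
      "integrable M (\<lambda>\<omega>. (Z \<omega> - W \<omega>)\<^sup>2)"
    using assms in_L2_diff by (auto simp: in_L2_real)
  have "(\<integral>\<omega>. (Y \<omega> - W \<omega>)\<^sup>2 \<partial>M) \<le> (\<integral>\<omega>. 2 * (Y \<omega> - Z \<omega>)\<^sup>2 + 2 * (Z \<omega> - W \<omega>)\<^sup>2 \<partial>M)"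
  proof (rule integral_mono)
    show "(Y \<omega> - W \<omega>)\<^sup>2 \<le> 2 * (Y \<omega> - Z \<omega>)\<^sup>2 + 2 * (Z \<omega> - W \<omega>)\<^sup>2" for \<omega>
      using zero_le_power2[of "(Y \<omega> - Z \<omega>) - (Z \<omega> - W \<omega>)"]
          by (simp add: power2_eq_square algebra_simps)
  qed (use i in auto)
  then show ?thesis using i by simp
qed


section \<open>Second moments of a Levy process\<close>

text \<open>By Tonelli's theorem the variable \<open>X + y\<close> is square integrable for some constant
  \<open>y\<close>, and then so is \<open>X\<close>.\<close>

lemma (in prob_space) in_L2_indep_summand:
  fixes X Y :: "'a \<Rightarrow> real"
  assumes indep: "indep_var borel X borel Y" and sq: "in_L2 M (\<lambda>x. X x + Y x)"
  shows "in_L2 M X"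
proof -
  have [measurable]: "X \<in> borel_measurable M" "Y \<in> borel_measurable M"
    using indep by (auto dest: indep_var_rv1 indep_var_rv2)
  define PX where "PX = distr M borel X"
  define PY where "PY = distr M borel Y"
  interpret PX: prob_space PX unfolding PX_def by (rule prob_space_distr) simp
  interpret PY: prob_space PY unfolding PY_def by (rule prob_space_distr) simp
  have [measurable_cong]: "sets PX = sets borel" "sets PY = sets borel"
      by (auto simp: PX_def PY_def)
  interpret P: pair_sigma_finite PX PY ..
  have pair: "PX \<Otimes>\<^sub>M PY = distr M (borel \<Otimes>\<^sub>M borel) (\<lambda>x. (X x, Y x))"
    using indep unfolding indep_var_distribution_eq PX_def PY_def by simp
  have "(\<integral>\<^sup>+y. \<integral>\<^sup>+x. ennreal ((x + y)\<^sup>2) \<partial>PX \<partial>PY) = (\<integral>\<^sup>+z. ennreal ((fst z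
      + snd z)\<^sup>2) \<partial>(PX \<Otimes>\<^sub>M PY))"
    by (subst P.nn_integral_snd[symmetric]) auto
  also have "\<dots> = (\<integral>\<^sup>+x. ennreal ((X x + Y x)\<^sup>2) \<partial>M)"
    unfolding pair by (subst nn_integral_distr) auto
  also have "\<dots> < \<infinity>"
    using sq integrableD(2)[of M "\<lambda>x. (X x + Y x)\<^sup>2"] by (simp add: in_L2_real less_top)
  finally have fin: "(\<integral>\<^sup>+y. \<integral>\<^sup>+x. ennreal ((x + y)\<^sup>2) \<partial>PX \<partial>PY) < \<infinity>" .
  obtain y where y: "(\<integral>\<^sup>+x. ennreal ((x + y)\<^sup>2) \<partial>PX) < \<infinity>"
  proof (rule ccontr)
    assume "\<not> thesis"
    then have "(\<integral>\<^sup>+x. ennreal ((x + y)\<^sup>2) \<partial>PX) = \<infinity>" for y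
      using that by (auto simp: less_top[symmetric])
    then show False using fin by (simp add: PY.emeasure_space_1)
  qed
  have "(\<integral>\<^sup>+x. ennreal ((X x)\<^sup>2) \<partial>M) = (\<integral>\<^sup>+x. ennreal (x\<^sup>2) \<partial>PX)"
    unfolding PX_def by (subst nn_integral_distr) auto
  also have "\<dots> \<le> (\<integral>\<^sup>+x. ennreal 2 * ennreal ((x + y)\<^sup>2) + ennreal (2 * y\<^sup>2) \<partial>PX)"
  proof (rule nn_integral_mono)
    fix x
    have "x\<^sup>2 \<le> 2 * (x + y)\<^sup>2 + 2 * y\<^sup>2"
      using sum_squares_bound[of "x + y" "- y"] zero_le_power2[of "x + 2 * y"]
      by (simp add: power2_eq_square algebra_simps)
    then have "ennreal (x\<^sup>2) \<le> ennreal (2 * (x + y)\<^sup>2 + 2 * y\<^sup>2)" by (rule ennreal_leI)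
    also have "\<dots> = ennreal 2 * ennreal ((x + y)\<^sup>2) + ennreal (2 * y\<^sup>2)"
      by (subst ennreal_plus) (auto simp: ennreal_mult)
    finally show "ennreal (x\<^sup>2) \<le> ennreal 2 * ennreal ((x + y)\<^sup>2) + ennreal (2 * y\<^sup>2)" .
  qed
  also have "\<dots> = ennreal 2 * (\<integral>\<^sup>+x. ennreal ((x + y)\<^sup>2) \<partial>PX) + ennreal (2 * y\<^sup>2)"
    by (simp add: nn_integral_add nn_integral_cmult PX.emeasure_space_1)
  also have "\<dots> < \<infinity>" using y by (simp add: ennreal_mult_less_top)
  finally show ?thesis
    unfolding in_L2_real by (intro conjI integrableI_bounded) auto
qed

text \<open>Cauchy's functional equation: \<open>a t - t a 1\<close> vanishes at all rational points, which determines
  it because it is small near \<open>0\<close>.\<close>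

lemma additive_linear:
  fixes a :: "real \<Rightarrow> real"
  assumes add: "\<And>s t. 0 \<le> s \<Longrightarrow> 0 \<le> t \<Longrightarrow> a (s + t) = a s + a t"
    and lim: "(a \<longlongrightarrow> 0) (at_right 0)" and "0 \<le> t"
  shows "a t = t * a 1"
proof -
  define b where "b s = a s - s * a 1" for s
  have b_add: "b (s + t) = b s + b t" if "0 \<le> s" "0 \<le> t" for s t
    using add[OF that] by (simp add: b_def algebra_simps)
  have b0: "b 0 = 0" and b1: "b 1 = 0" using add[of 0 0] by (auto simp: b_def)
  have b_nat: "b (real k * x) = real k * b x" if "0 \<le> x" for k x
  proof (induction k)
    case (Suc k)
    then show ?case using b_add[of "real k * x" x] that by (simp add: algebra_simps)
  qed (simp add: b0)
  have "((\<lambda>s. a s - s * a 1) \<longlongrightarrow> 0 - 0 * a 1) (at_right 0)"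
    by (intro tendsto_intros lim)
  then have b_lim: "(b \<longlongrightarrow> 0) (at_right 0)" by (simp add: b_def[abs_def])
  have "\<bar>b t\<bar> < e" if "0 < e" for e
  proof -
    have "eventually (\<lambda>s. \<bar>b s\<bar> < e) (at_right 0)"
      using tendstoD[OF b_lim that] by (simp add: dist_real_def)
    then obtain d where d: "0 < d" "\<And>s. 0 < s \<Longrightarrow> s < d \<Longrightarrow> \<bar>b s\<bar> < e"
      unfolding eventually_at_right[OF zero_less_one] by blast
    obtain n where n: "inverse (real (Suc n)) < d" using reals_Archimedean[OF d(1)] by blast
    let ?N = "real (Suc n)"
    define k where "k = nat \<lfloor>?N * t\<rfloor>"
    have k: "real k \<le> ?N * t" "?N * t < real k + 1"
      using \<open>0 \<le> t\<close> unfolding k_def by (auto simp: of_nat_nat)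
    define s where "s = t - real k / ?N"
    have "?N * s = ?N * t - real k" by (simp add: s_def right_diff_distrib del: of_nat_Suc)
    then have "0 \<le> ?N * s" "?N * s < 1" using k by linarith+
    then have s: "0 \<le> s" "s < inverse ?N"
      by (simp_all add: inverse_eq_divide pos_less_divide_eq mult.commute zero_le_mult_iff del:
          of_nat_Suc)
    have "?N * b (real k / ?N) = b (?N * (real k / ?N))" by (rule b_nat[symmetric]) simp
    also have "\<dots> = b (real k * 1)" by simp
    also have "\<dots> = 0" using b_nat[of 1 k] b1 by simp
    finally have "b (real k / ?N) = 0" by simp
    then have "b t = b s" using b_add[of "real k / ?N" s] s by (simp add: s_def)
    then show ?thesis using d(2)[of s] s n b0 that by (cases "s = 0") auto
  qed
  then have "b t = 0" by (metis abs_ge_zero less_irrefl zero_less_abs_iff)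
  then show ?thesis by (simp add: b_def)
qed

locale standardized_levy = prob_space M for M :: "'w measure" +
  fixes L :: "real \<Rightarrow> 'w \<Rightarrow> real"
  assumes levy: "levy_process M L"
    and sq1: "integrable M (\<lambda>\<omega>. (L 1 \<omega>)\<^sup>2)"
    and mean1: "expectation (L 1) = 0"
    and var1: "expectation (\<lambda>\<omega>. (L 1 \<omega>)\<^sup>2) = 1"
begin

lemma L_measurable [measurable]: "0 \<le> t \<Longrightarrow> L t \<in> borel_measurable M"
  using levy by (auto simp: levy_process_def)

lemma L_0: "AE \<omega> in M. L 0 \<omega> = 0"
  using levy by (auto simp: levy_process_def)

lemma cadlag_paths: "AE \<omega> in M. cadlag (\<lambda>t. L t \<omega>)"
  using levy by (auto simp: levy_process_def)

lemma stationary: "0 \<le> s \<Longrightarrow> 0 \<le> h \<Longrightarrow> distr M borel (\<lambda>\<omega>. L (s + h) \<omega> - L s \<omega>) = distr M borel (L h)"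
  using levy by (auto simp: levy_process_def)

lemma indep_increments:
  assumes "0 \<le> r" "r \<le> s" "s \<le> t"
  shows "indep_var borel (\<lambda>\<omega>. L s \<omega> - L r \<omega>) borel (\<lambda>\<omega>. L t \<omega> - L s \<omega>)"
proof -
  \<comment> \<open>The definition of a Levy process speaks of infinite sequences of times; the sequence
      \<open>r, s, t, t, \<dots>\<close> has the two required increments as its first ones.\<close>
  define T where "T i = (if i = 0 then r else if i = Suc 0 then s else t)" for i :: nat
  have "mono T" using assms by (auto simp: mono_def T_def)
  moreover have "0 \<le> T 0" using assms by (simp add: T_def)
  ultimately have "indep_vars (\<lambda>_. borel) (\<lambda>i \<omega>. L (T (Suc i)) \<omega> - L (T i) \<omega>) {..<2::nat}"
    using levy unfolding levy_process_def by blast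
  moreover have "{..<2::nat} = insert 0 {1}" by auto
  ultimately have "indep_vars (\<lambda>_. borel) (\<lambda>i \<omega>. L (T (Suc i)) \<omega> - L (T i) \<omega>) (insert 0 {1::nat})"
      by simp
  from indep_vars_sum[OF _ _ this] show ?thesis by (simp add: T_def)
qed

lemma expectation_increment:
  fixes g :: "real \<Rightarrow> real"
  assumes "0 \<le> s" "0 \<le> h" and [measurable]: "g \<in> borel_measurable borel"
  shows "expectation (\<lambda>\<omega>. g (L (s + h) \<omega> - L s \<omega>)) = expectation (\<lambda>\<omega>. g (L h \<omega>))"
proof -
  have "expectation (\<lambda>\<omega>. g (L (s + h) \<omega> - L s \<omega>)) = integral\<^sup>L (distr M borel (\<lambda>\<omega>. L (s
      + h) \<omega> - L s \<omega>)) g"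
    using assms by (subst integral_distr) auto
  also have "\<dots> = expectation (\<lambda>\<omega>. g (L h \<omega>))"
    unfolding stationary[OF assms(1,2)] using assms by (subst integral_distr) auto
  finally show ?thesis .
qed

lemma in_L2_increment:
  assumes "0 \<le> s" "0 \<le> h"
  shows "in_L2 M (\<lambda>\<omega>. L (s + h) \<omega> - L s \<omega>) \<longleftrightarrow> in_L2 M (L h)"
proof -
  have "integrable M (\<lambda>\<omega>. (L (s + h) \<omega> - L s \<omega>)\<^sup>2) \<longleftrightarrow> integrable (distr M borel (\<lambda>\<omega>. L (s
      + h) \<omega> - L s \<omega>)) (\<lambda>x. x\<^sup>2)"
    using assms by (subst integrable_distr_eq) auto
  also have "\<dots> \<longleftrightarrow> integrable M (\<lambda>\<omega>. (L h \<omega>)\<^sup>2)"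
    unfolding stationary[OF assms] using assms by (subst integrable_distr_eq) auto
  finally show ?thesis using assms by (auto simp: in_L2_real)
qed

text \<open>At integer times \<open>L\<close> is a sum of increments with the law of \<open>L 1\<close>, and \<open>L t\<close> is an independent
  summand of \<open>L n\<close> for \<open>n \<ge> t\<close>.\<close>

lemma L_in_L2:
  assumes "0 \<le> t"
  shows "in_L2 M (L t)"
proof -
  have nat: "in_L2 M (L (real (Suc n)))" for n
  proof (induction n)
    case 0
    show ?case using sq1 by (simp add: in_L2_real)
  next
    case (Suc n)
    have "in_L2 M (L 1)" using sq1 by (simp add: in_L2_real)
    then have "in_L2 M (\<lambda>\<omega>. L (real (Suc n) + 1) \<omega> - L (real (Suc n)) \<omega>)"
      by (subst in_L2_increment) auto
    from in_L2_add[OF this Suc] show ?case by (simp add: add.commute)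
  qed
  define n where "n = nat \<lceil>t\<rceil>"
  have n: "t \<le> real (Suc n)" by (simp add: n_def) linarith
  have "in_L2 M (\<lambda>\<omega>. (L t \<omega> - L 0 \<omega>) + (L (real (Suc n)) \<omega> - L t \<omega>))"
  proof (rule in_L2_cong_AE[OF nat[of n]])
    show "AE \<omega> in M. L (real (Suc n)) \<omega> = L t \<omega> - L 0 \<omega> + (L (real (Suc n)) \<omega> - L t \<omega>)"
      using L_0 by eventually_elim simp
  qed (use assms in measurable)
  then have "in_L2 M (\<lambda>\<omega>. L t \<omega> - L 0 \<omega>)"
    by (rule in_L2_indep_summand[rotated]) (rule indep_increments, use assms n in auto)
  then show ?thesis
    by (rule in_L2_cong_AE) (use assms L_0 in auto)
qed

lemma L_integrable: "0 \<le> t \<Longrightarrow> integrable M (L t)"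
  by (rule in_L2_integrable[OF L_in_L2])

abbreviation "mean t \<equiv> expectation (L t)"
definition "var t = expectation (\<lambda>\<omega>. (L t \<omega>)\<^sup>2) - (mean t)\<^sup>2"

lemma mean_add:
  assumes "0 \<le> s" "0 \<le> t"
  shows "mean (s + t) = mean s + mean t"
proof -
  have "mean (s + t) - mean s = expectation (\<lambda>\<omega>. L (s + t) \<omega> - L s \<omega>)"
    using assms by (subst Bochner_Integration.integral_diff) (auto intro: L_integrable)
  also have "\<dots> = mean t" using expectation_increment[of s t "\<lambda>x. x"] assms by simp
  finally show ?thesis by simp
qed

lemma var_add:
  assumes st: "0 \<le> s" "0 \<le> t"
  shows "var (s + t) = var s + var t"
proof -
  let ?D = "\<lambda>\<omega>. L (s + t) \<omega> - L s \<omega>"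
  have D: "in_L2 M ?D" "expectation (\<lambda>\<omega>. (?D \<omega>)\<^sup>2) = expectation (\<lambda>\<omega>. (L t \<omega>)\<^sup>2)"
      "expectation ?D = mean t"
    using in_L2_increment[OF st] L_in_L2 st expectation_increment[OF st, of "\<lambda>x. x\<^sup>2"]
      expectation_increment[OF st, of "\<lambda>x. x"] by auto
  have Ls: "in_L2 M (L s)" using L_in_L2 st by simp
  have 1: "indep_var borel (\<lambda>\<omega>. L s \<omega> - L 0 \<omega>) borel ?D" using indep_increments[of 0 s "s + t"] st
      by simp
  have L0: "in_L2 M (\<lambda>\<omega>. L s \<omega> - L 0 \<omega>)" using L_in_L2 st by (intro in_L2_diff) auto
  have "expectation (\<lambda>\<omega>. L s \<omega> * ?D \<omega>) = expectation (\<lambda>\<omega>. (L s \<omega> - L 0 \<omega>) * ?D \<omega>)"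
    using L_0 st by (intro integral_cong_AE) auto
  also have "\<dots> = expectation (\<lambda>\<omega>. L s \<omega> - L 0 \<omega>) * expectation ?D"
    by (rule indep_var_lebesgue_integral[OF 1 in_L2_integrable[OF L0] in_L2_integrable[OF D(1)]])
  also have "expectation (\<lambda>\<omega>. L s \<omega> - L 0 \<omega>) = mean s"
    using L_0 st by (intro integral_cong_AE) auto
  finally have prod: "expectation (\<lambda>\<omega>. L s \<omega> * ?D \<omega>) = mean s * mean t" using D(3) by simp
  have "expectation (\<lambda>\<omega>. (L (s + t) \<omega>)\<^sup>2)
      = expectation (\<lambda>\<omega>. (L s \<omega>)\<^sup>2 + (?D \<omega>)\<^sup>2 + 2 * (L s \<omega> * ?D \<omega>))"
    by (intro Bochner_Integration.integral_cong) (auto simp: power2_eq_square algebra_simps)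
  also have "\<dots> = expectation (\<lambda>\<omega>. (L s \<omega>)\<^sup>2) + expectation (\<lambda>\<omega>. (?D \<omega>)\<^sup>2)
      + 2 * expectation (\<lambda>\<omega>. L s \<omega> * ?D \<omega>)"
    using Ls D(1) in_L2_mult_integrable[OF Ls D(1)]
    by (simp add: in_L2_real)
  also have "\<dots> = expectation (\<lambda>\<omega>. (L s \<omega>)\<^sup>2) + expectation (\<lambda>\<omega>. (L t \<omega>)\<^sup>2) + 2 * (mean s * mean t)"
    by (simp only: D(2) prod)
  finally show ?thesis by (simp add: var_def mean_add[OF st] power2_sum)
qed

lemma var_nonneg: "0 \<le> t \<Longrightarrow> 0 \<le> var t"
  unfolding var_def using L_integrable[of t] L_in_L2[of t]
  by (subst variance_eq[symmetric]) (auto simp: in_L2_real variance_positive)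

lemma var_1: "var 1 = 1"
  using mean1 var1 by (simp add: var_def)

text \<open>The variance is additive and nonnegative, hence monotone; so it is at most \<open>1 / n\<close> on
  \<open>[0, 1 / n]\<close> and Cauchy's functional equation applies.\<close>

lemma var_eq:
  assumes "0 \<le> t"
  shows "var t = t"
proof -
  have mono: "var s \<le> var t" if "0 \<le> s" "s \<le> t" for s t
    using var_add[of s "t - s"] var_nonneg[of "t - s"] that by simp
  have inv: "var (inverse (real (Suc n))) = inverse (real (Suc n))" for n
  proof -
    have "var (real k * x) = real k * var x" if "0 \<le> x" for k x
    proof (induction k)
      case 0
      show ?case using var_add[of 0 0] by simp
    next
      case (Suc k)
      then show ?case using var_add[of "real k * x" x] that by (simp add: algebra_simps)
    qed
    from this[of "inverse (real (Suc n))" "Suc n"] show ?thesis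
      using var_1 by (simp add: field_simps)
  qed
  have "(var \<longlongrightarrow> 0) (at_right 0)"
  proof (rule tendstoI)
    fix e :: real assume "0 < e"
    then obtain n where n: "inverse (real (Suc n)) < e" using reals_Archimedean by blast
    have "eventually (\<lambda>s. s \<in> {0<..<inverse (real (Suc n))}) (at_right 0)"
      by (rule eventually_at_right_real) simp
    then show "eventually (\<lambda>s. dist (var s) 0 < e) (at_right 0)"
    proof eventually_elim
      case (elim s)
      then show ?case using mono[of s "inverse (real (Suc n))"] inv[of n] var_nonneg[of s] n by simp
    qed
  qed
  from additive_linear[OF var_add this assms] show ?thesis by (simp add: var_1)
qed

text \<open>Right continuity of the paths at \<open>0\<close> gives \<open>L s \<rightarrow> 0\<close> almost surely, while
  \<open>L s - mean s \<rightarrow> 0\<close> in quadratic mean; hence the means tend to \<open>0\<close>.\<close>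

lemma mean_eq_0:
  assumes "0 \<le> t"
  shows "mean t = 0"
proof -
  have "(mean \<longlongrightarrow> 0) (at_right 0)"
    unfolding tendsto_at_iff_sequentially
  proof (intro allI impI)
    fix X :: "nat \<Rightarrow> real" assume X: "\<forall>i. X i \<in> {0<..} - {0}" "X \<longlonglongrightarrow> 0"
    have pos: "0 < X n" for n using X by auto
    have X_lim: "filterlim X (at_right 0) sequentially"
    proof -
      have "X n \<noteq> 0" for n using pos[of n] by simp
      then show ?thesis using X(2) pos by (simp add: filterlim_at)
    qed
    have [measurable]: "L (X n) \<in> borel_measurable M" for n using pos[of n] by simp
    have "(\<lambda>n. expectation (\<lambda>\<omega>. min 1 \<bar>L (X n) \<omega>\<bar>)) \<longlonglongrightarrow> expectation (\<lambda>\<omega>. 0)"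
    proof (rule integral_dominated_convergence[where w = "\<lambda>\<omega>. 1"])
      show "AE \<omega> in M. (\<lambda>n. min 1 \<bar>L (X n) \<omega>\<bar>) \<longlonglongrightarrow> 0"
        using cadlag_paths L_0
      proof eventually_elim
        case (elim \<omega>)
        have "((\<lambda>t. L t \<omega>) \<longlongrightarrow> L 0 \<omega>) (at_right 0)"
          using elim(1) unfolding cadlag_def by (auto simp: continuous_within)
        then have "(\<lambda>n. L (X n) \<omega>) \<longlonglongrightarrow> L 0 \<omega>"
          by (rule filterlim_compose[OF _ X_lim])
        then have "(\<lambda>n. min 1 \<bar>L (X n) \<omega>\<bar>) \<longlonglongrightarrow> min 1 \<bar>L 0 \<omega>\<bar>" by (intro tendsto_intros)
        then show ?case using elim(2) by simp
      qed
    qed auto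
    then have lim1: "(\<lambda>n. expectation (\<lambda>\<omega>. min 1 \<bar>L (X n) \<omega>\<bar>)) \<longlonglongrightarrow> 0" by simp
    have le: "min 1 \<bar>mean (X n)\<bar> \<le> expectation (\<lambda>\<omega>. min 1 \<bar>L (X n) \<omega>\<bar>) + sqrt (X n)" for n
    proof -
      have L2: "in_L2 M (L (X n))" using L_in_L2 pos[of n] by simp
      have D: "in_L2 M (\<lambda>\<omega>. L (X n) \<omega> - mean (X n))"
        using L2 by (rule in_L2_diff) (simp add: in_L2_real)
      have i1: "integrable M (\<lambda>\<omega>. min 1 \<bar>L (X n) \<omega>\<bar>)"
        by (rule integrable_const_bound[of _ 1]) auto
      have i2: "integrable M (\<lambda>\<omega>. \<bar>L (X n) \<omega> - mean (X n)\<bar>)"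
        using in_L2_integrable[OF D] by simp
      have "min 1 \<bar>mean (X n)\<bar> = expectation (\<lambda>\<omega>. min 1 \<bar>mean (X n)\<bar>)" by (simp add: prob_space)
      also have "\<dots> \<le> expectation (\<lambda>\<omega>. min 1 \<bar>L (X n) \<omega>\<bar> + \<bar>L (X n) \<omega> - mean (X n)\<bar>)"
        using i1 i2 by (intro integral_mono) auto
      also have "\<dots> = expectation (\<lambda>\<omega>. min 1 \<bar>L (X n) \<omega>\<bar>)
          + expectation (\<lambda>\<omega>. \<bar>L (X n) \<omega> - mean (X n)\<bar>)"
        using i1 i2 by simp
      finally have "min 1 \<bar>mean (X n)\<bar>
          \<le> expectation (\<lambda>\<omega>. min 1 \<bar>L (X n) \<omega>\<bar>) + expectation (\<lambda>\<omega>. \<bar>L (X n) \<omega> - mean (X n)\<bar>)" .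
      moreover have "expectation (\<lambda>\<omega>. (L (X n) \<omega> - mean (X n))\<^sup>2) = X n"
        using variance_eq[of "L (X n)"] L_integrable[of "X n"] L2 pos[of n] var_eq[of "X n"]
        by (simp add: in_L2_real var_def)
      then have "expectation (\<lambda>\<omega>. \<bar>L (X n) \<omega> - mean (X n)\<bar>) \<le> sqrt (X n)"
        using expectation_abs_le_sqrt[OF D] by simp
      ultimately show ?thesis by linarith
    qed
    have lim2: "(\<lambda>n. expectation (\<lambda>\<omega>. min 1 \<bar>L (X n) \<omega>\<bar>) + sqrt (X n)) \<longlonglongrightarrow> 0"
      using tendsto_add[OF lim1 tendsto_real_sqrt[OF X(2)]] by simp
    have "(\<lambda>n. min 1 \<bar>mean (X n)\<bar>) \<longlonglongrightarrow> 0"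
      by (rule tendsto_sandwich[OF _ _ tendsto_const lim2]) (auto intro!: always_eventually le)
    then have ev: "eventually (\<lambda>n. min 1 \<bar>mean (X n)\<bar> < min 1 e) sequentially" if "0 < e" for e
      by (rule order_tendstoD(2)) (use that in simp)
    show "(mean \<circ> X) \<longlonglongrightarrow> 0"
    proof (rule tendstoI)
      fix e :: real assume "0 < e"
      from ev[OF this] show "eventually (\<lambda>n. dist ((mean \<circ> X) n) 0 < e) sequentially"
        by eventually_elim (auto simp: min_def split: if_splits)
    qed
  qed
  from additive_linear[OF mean_add this assms] show ?thesis by (simp add: mean1)
qed

lemma second_moment_increment:
  assumes "0 \<le> s" "s \<le> t"
  shows "in_L2 M (\<lambda>\<omega>. L t \<omega> - L s \<omega>)" "expectation (\<lambda>\<omega>. (L t \<omega> - L s \<omega>)\<^sup>2) = t - s"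
proof -
  show "in_L2 M (\<lambda>\<omega>. L t \<omega> - L s \<omega>)" using assms by (intro in_L2_diff L_in_L2) auto
  have "expectation (\<lambda>\<omega>. (L (s + (t - s)) \<omega> - L s \<omega>)\<^sup>2) = expectation (\<lambda>\<omega>. (L (t - s) \<omega>)\<^sup>2)"
    using assms by (intro expectation_increment) auto
  also have "\<dots> = t - s"
    using var_eq[of "t - s"] mean_eq_0[of "t - s"] assms by (simp add: var_def)
  finally show "expectation (\<lambda>\<omega>. (L t \<omega> - L s \<omega>)\<^sup>2) = t - s" by simp
qed


text \<open>No fixed jumps: by Fatou's lemma the left limit at \<open>t\<close> has quadratic distance \<open>0\<close> from \<open>L t\<close>.\<close>

lemma left_limit:
  assumes "0 < t"
  shows "AE \<omega> in M. Lim (at_left t) (\<lambda>s. L s \<omega>) = L t \<omega>"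
proof -
  define X where "X n = t - t * inverse (real (Suc (Suc n)))" for n
  have X: "0 < X n" "X n < t" for n
  proof -
    have "t * inverse (real (Suc (Suc n))) < t * 1"
      using assms by (intro mult_strict_left_mono) (auto simp: inverse_less_1_iff)
    then show "0 < X n" "X n < t" using assms by (auto simp: X_def simp del: of_nat_Suc)
  qed
  have [measurable]: "L (X n) \<in> borel_measurable M" "L t \<in> borel_measurable M" for n
    using X(1)[of n] assms by auto
  have X_lim: "X \<longlonglongrightarrow> t"
  proof -
    have "(\<lambda>n. inverse (real (Suc (Suc n)))) \<longlonglongrightarrow> 0"
      by (rule LIMSEQ_Suc[OF LIMSEQ_inverse_real_of_nat])
    from tendsto_diff[OF tendsto_const[of t] tendsto_mult[OF tendsto_const[of t] this]]
    show ?thesis by (simp add: X_def[abs_def] del: of_nat_Suc)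
  qed
  have "(\<integral>\<^sup>+\<omega>. ennreal ((L t \<omega> - L (X n) \<omega>)\<^sup>2) \<partial>M) = ennreal (t - X n)" for n
    using second_moment_increment[of "X n" t] X[of n]
    by (subst nn_integral_eq_integral) (auto simp: in_L2_real)
  moreover have "(\<lambda>n. ennreal (t - X n)) \<longlonglongrightarrow> ennreal (t - t)"
    by (intro tendsto_ennrealI tendsto_diff tendsto_const X_lim)
  ultimately have lim0: "(\<lambda>n. \<integral>\<^sup>+\<omega>. ennreal ((L t \<omega> - L (X n) \<omega>)\<^sup>2) \<partial>M) \<longlonglongrightarrow> 0" by simp
  have "(\<integral>\<^sup>+\<omega>. liminf (\<lambda>n. ennreal ((L t \<omega> - L (X n) \<omega>)\<^sup>2)) \<partial>M) \<le> 0"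
    using nn_integral_liminf[of "\<lambda>n \<omega>. ennreal ((L t \<omega> - L (X n) \<omega>)\<^sup>2)" M]
      lim_imp_Liminf[OF _ lim0] by simp
  then have "AE \<omega> in M. liminf (\<lambda>n. ennreal ((L t \<omega> - L (X n) \<omega>)\<^sup>2)) = 0"
    by (subst nn_integral_0_iff_AE[symmetric]) auto
  then show ?thesis
    using cadlag_paths
  proof eventually_elim
    case (elim \<omega>)
    obtain l where l: "((\<lambda>s. L s \<omega>) \<longlongrightarrow> l) (at_left t)"
      using elim(2)[unfolded cadlag_def, rule_format, of t] assms by auto
    moreover have "filterlim X (at_left t) sequentially"
    proof -
      have "X n \<noteq> t" for n using X(2)[of n] by simp
      then show ?thesis using X_lim X(2) by (simp add: filterlim_at)
    qed
    ultimately have "(\<lambda>n. L (X n) \<omega>) \<longlonglongrightarrow> l"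
      by (rule filterlim_compose)
    then have "(\<lambda>n. ennreal ((L t \<omega> - L (X n) \<omega>)\<^sup>2)) \<longlonglongrightarrow> ennreal ((L t \<omega> - l)\<^sup>2)"
      by (intro tendsto_ennrealI tendsto_power tendsto_diff tendsto_const)
    then have "liminf (\<lambda>n. ennreal ((L t \<omega> - L (X n) \<omega>)\<^sup>2)) = ennreal ((L t \<omega> - l)\<^sup>2)"
      by (intro lim_imp_Liminf) auto
    then have "ennreal ((L t \<omega> - l)\<^sup>2) = 0" using elim(1) by simp
    then have "L t \<omega> = l" by simp
    then show ?case using l by (simp add: tendsto_Lim)
  qed
qed

end

lemma process_path_measurable:
  assumes "\<And>t. 0 \<le> t \<Longrightarrow> L t \<in> borel_measurable M"
  shows "process_path L \<in> measurable M path_space"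
  unfolding process_path_def[abs_def] path_space_def
  using assms by (intro measurable_restrict) auto

lemma path_space_component: "0 \<le> t \<Longrightarrow> (\<lambda>p. p t) \<in> borel_measurable path_space"
  unfolding path_space_def by (rule measurable_component_singleton) simp

lemma distr_process_path:
  assumes "levy_process M L" "0 \<le> t"
  shows "distr M borel (L t) = distr (distr M path_space (process_path L)) borel (\<lambda>p. p t)"
proof -
  have [measurable]: "process_path L \<in> measurable M path_space"
    using assms by (intro process_path_measurable) (auto simp: levy_process_def)
  note [measurable] = path_space_component[OF assms(2)]
  show ?thesis
    using assms by (subst distr_distr) (auto simp: o_def process_path_def)
qed

locale two_sided_standardized_levy = prob_space M for M :: "'w measure" +
  fixes L :: "real \<Rightarrow> 'w \<Rightarrow> real"
  assumes levy: "two_sided_levy_process M L"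
    and sq1: "integrable M (\<lambda>\<omega>. (L 1 \<omega>)\<^sup>2)"
    and mean1: "expectation (L 1) = 0"
    and var1: "expectation (\<lambda>\<omega>. (L 1 \<omega>)\<^sup>2) = 1"
begin

lemma L_measurable [measurable]: "L t \<in> borel_measurable M"
  using levy by (auto simp: two_sided_levy_process_def)

text \<open>The process on the negative half-line has the law of the one on the positive half-line, so it
  inherits the moments at time \<open>1\<close>; the left limits in its definition are almost surely values.\<close>

lemma one_sided_parts:
  "\<exists>L1 L2. standardized_levy M L1 \<and> standardized_levy M L2
    \<and> (\<forall>s\<ge>0. \<forall>t\<ge>0. indep_var borel (L1 s) borel (L2 t))
    \<and> (\<forall>t\<ge>0. AE \<omega> in M. L t \<omega> = L1 t \<omega>) \<and> (\<forall>t>0. AE \<omega> in M. L (- t) \<omega> = - L2 t \<omega>)"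
proof -
  obtain L1 L2 where L1: "levy_process M L1" and L2: "levy_process M L2"
    and eq: "distr M path_space (process_path L2) = distr M path_space (process_path L1)"
    and indep: "indep_var path_space (process_path L1) path_space (process_path L2)"
    and L: "AE \<omega> in M. \<forall>t. L t \<omega> =
           (if t \<ge> 0 then L1 t \<omega> else - Lim (at_left (- t)) (\<lambda>s. L2 s \<omega>))"
    using levy unfolding two_sided_levy_process_def by blast
  have m: "0 \<le> t \<Longrightarrow> L1 t \<in> borel_measurable M" "0 \<le> t \<Longrightarrow> L2 t \<in> borel_measurable M" for t
    using L1 L2 by (auto simp: levy_process_def)
  have [measurable]: "L1 1 \<in> borel_measurable M" "L2 1 \<in> borel_measurable M"
    by (rule m, simp)+
  have pos: "AE \<omega> in M. L t \<omega> = L1 t \<omega>" if "0 \<le> t" for t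
    using L by eventually_elim (use that in simp)
  have d: "distr M borel (L2 1) = distr M borel (L1 1)"
    using distr_process_path[OF L1, of 1] distr_process_path[OF L2, of 1] eq by simp
  have d1: "distr M borel (L1 1) = distr M borel (L 1)"
    by (rule distr_cong_AE) (use pos[of 1] in auto)
  have "standardized_levy M L'" if L': "levy_process M L'"
      "distr M borel (L' 1) = distr M borel (L 1)" for L'
  proof
    have [measurable]: "L' 1 \<in> borel_measurable M" using L'(1) by (auto simp: levy_process_def)
    show "levy_process M L'" by fact
    have eq: "expectation (\<lambda>\<omega>. g (L' 1 \<omega>)) = expectation (\<lambda>\<omega>. g (L 1 \<omega>))"
      if g [measurable]: "g \<in> borel_measurable borel" for g :: "real \<Rightarrow> real"
    proof -
      have "expectation (\<lambda>\<omega>. g (L' 1 \<omega>)) = integral\<^sup>L (distr M borel (L' 1)) g"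
        by (rule integral_distr[symmetric]) measurable
      also have "\<dots> = expectation (\<lambda>\<omega>. g (L 1 \<omega>))"
        unfolding L'(2) by (rule integral_distr) measurable
      finally show ?thesis .
    qed
    have "integrable (distr M borel (L' 1)) (\<lambda>x. x\<^sup>2)"
      unfolding L'(2) using sq1 by (subst integrable_distr_eq) auto
    then show "integrable M (\<lambda>\<omega>. (L' 1 \<omega>)\<^sup>2)"
      by (subst (asm) integrable_distr_eq) auto
    show "expectation (L' 1) = 0" using eq[of "\<lambda>x. x"] mean1 by simp
    show "expectation (\<lambda>\<omega>. (L' 1 \<omega>)\<^sup>2) = 1" using eq[of "\<lambda>x. x\<^sup>2"] var1 by simp
  qed
  then have std: "standardized_levy M L1" "standardized_levy M L2" using L1 L2 d d1 by auto
  interpret L2: standardized_levy M L2 by (rule std)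
  show ?thesis
  proof (intro exI conjI allI impI)
    show "standardized_levy M L1" "standardized_levy M L2" by (rule std)+
    show "indep_var borel (L1 s) borel (L2 t)" if "0 \<le> s" "0 \<le> t" for s t
    proof -
      have "indep_var borel ((\<lambda>p. p s) \<circ> process_path L1) borel ((\<lambda>p. p t) \<circ> process_path L2)"
        using that by (intro indep_var_compose[OF indep] path_space_component)
      moreover have "(\<lambda>p. p s) \<circ> process_path L1 = L1 s" "(\<lambda>p. p t) \<circ> process_path L2 = L2 t"
        using that by (auto simp: o_def process_path_def)
      ultimately show ?thesis by simp
    qed
    show "AE \<omega> in M. L t \<omega> = L1 t \<omega>" if "0 \<le> t" for t using pos[OF that] .
    show "AE \<omega> in M. L (- t) \<omega> = - L2 t \<omega>" if "0 < t" for t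
      using L L2.left_limit[OF that] by eventually_elim (use that in simp)
  qed
qed

text \<open>For times of opposite sign the increment is a sum of two independent centred variables.\<close>

lemma second_moment_increment:
  shows "in_L2 M (L t)" "expectation (\<lambda>\<omega>. (L s \<omega> - L t \<omega>)\<^sup>2) = \<bar>s - t\<bar>"
proof -
  obtain L1 L2 where std: "standardized_levy M L1" "standardized_levy M L2"
    and indep: "\<forall>s\<ge>0. \<forall>t\<ge>0. indep_var borel (L1 s) borel (L2 t)"
    and pos: "\<forall>t\<ge>0. AE \<omega> in M. L t \<omega> = L1 t \<omega>"
    and neg: "\<forall>t>0. AE \<omega> in M. L (- t) \<omega> = - L2 t \<omega>"
    using one_sided_parts by (elim exE conjE)
  note indep = indep[rule_format] and pos = pos[rule_format] and neg = neg[rule_format]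
  interpret L1: standardized_levy M L1 by (rule std)
  interpret L2: standardized_levy M L2 by (rule std)
  show "in_L2 M (L t)"
  proof (cases "0 \<le> t")
    case True
    then show ?thesis
      using pos[OF True] by (intro in_L2_cong_AE[OF L1.L_in_L2[OF True]]) auto
  next
    case False
    then have "0 < - t" by simp
    from neg[OF this] have "AE \<omega> in M. - 1 * L2 (- t) \<omega> = L t \<omega>" by eventually_elim simp
    then show ?thesis
      using False by (intro in_L2_cong_AE[OF in_L2_cmult[OF L2.L_in_L2[of "- t"], of "- 1"]]) auto
  qed
  have ordered: "expectation (\<lambda>\<omega>. (L s \<omega> - L t \<omega>)\<^sup>2) = t - s" if "s \<le> t" for s t
  proof -
    consider "0 \<le> s" | "t < 0" | "s < 0" "0 \<le> t" using that by linarith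
    then show ?thesis
    proof cases
      case 1
      have "expectation (\<lambda>\<omega>. (L s \<omega> - L t \<omega>)\<^sup>2) = expectation (\<lambda>\<omega>. (L1 t \<omega> - L1 s \<omega>)\<^sup>2)"
      proof (rule integral_cong_AE)
        show "AE \<omega> in M. (L s \<omega> - L t \<omega>)\<^sup>2 = (L1 t \<omega> - L1 s \<omega>)\<^sup>2"
          using pos[of s] pos[of t] 1 that by (auto simp: power2_commute)
      qed (use 1 that in auto)
      then show ?thesis using L1.second_moment_increment(2)[of s t] 1 that by simp
    next
      case 2
      then have st: "0 \<le> - t" "- t \<le> - s" "0 < - s" "0 < - t" using that by auto
      have "expectation (\<lambda>\<omega>. (L s \<omega> - L t \<omega>)\<^sup>2) = expectation (\<lambda>\<omega>. (L2 (- s) \<omega> - L2 (- t) \<omega>)\<^sup>2)"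
      proof (rule integral_cong_AE)
        show "AE \<omega> in M. (L s \<omega> - L t \<omega>)\<^sup>2 = (L2 (- s) \<omega> - L2 (- t) \<omega>)\<^sup>2"
          using neg[OF st(3)] neg[OF st(4)] by eventually_elim (simp add: power2_commute)
      qed (use st in auto)
      then show ?thesis using L2.second_moment_increment(2)[of "- t" "- s"] st by simp
    next
      case 3
      let ?s = "- s"
      have s: "0 < ?s" using 3 by simp
      have i: "in_L2 M (L1 t)" "in_L2 M (L2 ?s)" using L1.L_in_L2 L2.L_in_L2 3 by auto
      have "expectation (\<lambda>\<omega>. (L s \<omega> - L t \<omega>)\<^sup>2) = expectation (\<lambda>\<omega>. (L1 t \<omega>)\<^sup>2 + (L2 ?s \<omega>)\<^sup>2
          + 2 * (L1 t \<omega> * L2 ?s \<omega>))"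
      proof (rule integral_cong_AE)
        show "AE \<omega> in M. (L s \<omega> - L t \<omega>)\<^sup>2 = (L1 t \<omega>)\<^sup>2 + (L2 ?s \<omega>)\<^sup>2 + 2 * (L1 t \<omega> * L2 ?s \<omega>)"
          using pos[OF 3(2)] neg[OF s] by eventually_elim (simp add: power2_eq_square algebra_simps)
      qed (use 3 in auto)
      also have "\<dots> = expectation (\<lambda>\<omega>. (L1 t \<omega>)\<^sup>2) + expectation (\<lambda>\<omega>. (L2 ?s \<omega>)\<^sup>2)
          + 2 * expectation (\<lambda>\<omega>. L1 t \<omega> * L2 ?s \<omega>)"
        using i in_L2_mult_integrable[OF i] by (simp add: in_L2_real)
      also have "expectation (\<lambda>\<omega>. L1 t \<omega> * L2 ?s \<omega>) = 0"
        using indep_var_lebesgue_integral[OF indep[of t ?s] in_L2_integrable[OF i(1)]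
            in_L2_integrable[OF i(2)]]
          L1.mean_eq_0[of t] 3 by simp
      finally show ?thesis
        using L1.var_eq[of t] L1.mean_eq_0[of t] L2.var_eq[of ?s] L2.mean_eq_0[of ?s] 3
        by (simp add: L1.var_def L2.var_def)
    qed
  qed
  show "expectation (\<lambda>\<omega>. (L s \<omega> - L t \<omega>)\<^sup>2) = \<bar>s - t\<bar>"
    using ordered[of s t] ordered[of t s] by (cases "s \<le> t") (auto simp: power2_commute)
qed

section \<open>The isometry of stochastic integration\<close>

text \<open>Polarisation turns the variances of increments into covariances: both sides are
  \<open>(\<bar>s - r'\<bar> + \<bar>r - s'\<bar> - \<bar>s - s'\<bar> - \<bar>r - r'\<bar>) / 2\<close>.\<close>

lemma increment_covariance:
  assumes "r \<le> s" "r' \<le> s'"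
  shows "expectation (\<lambda>\<omega>. (L s \<omega> - L r \<omega>) * (L s' \<omega> - L r' \<omega>))
    = (LBINT u. indicator {r<..s} u * indicator {r'<..s'} u)"
proof -
  let ?D = "\<lambda>s t \<omega>. (L s \<omega> - L t \<omega>)\<^sup>2"
  have i: "integrable M (?D s t)" for s t
    using in_L2_diff[OF second_moment_increment(1) second_moment_increment(1)]
        by (auto simp: in_L2_real)
  have "expectation (\<lambda>\<omega>. (L s \<omega> - L r \<omega>) * (L s' \<omega> - L r' \<omega>))
    = expectation (\<lambda>\<omega>. (?D s r' \<omega> + ?D r s' \<omega> - ?D s s' \<omega> - ?D r r' \<omega>) / 2)"
    by (intro Bochner_Integration.integral_cong) (auto simp: power2_eq_square field_simps)
  also have "\<dots> = (\<bar>s - r'\<bar> + \<bar>r - s'\<bar> - \<bar>s - s'\<bar> - \<bar>r - r'\<bar>) / 2"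
    using i by (simp add: second_moment_increment(2))
  also have "\<dots> = max 0 (min s s' - max r r')"
    using assms unfolding max_def min_def abs_if by (simp split: if_splits; linarith)
  also have "\<dots> = measure lborel {max r r'<..min s s'}"
  proof (cases "max r r' \<le> min s s'")
    case True
    then show ?thesis by (subst measure_lborel_Ioc[OF True]) linarith
  next
    case False
    then have "{max r r'<..min s s'} = {}" by (intro greaterThanAtMost_empty) linarith
    with False show ?thesis by (simp only: measure_empty)
  qed
  also have "\<dots> = (LBINT u. indicator {r<..s} u * indicator {r'<..s'} u)"
  proof -
    have "(\<lambda>u. indicator {r<..s} u * indicator {r'<..s'} u :: real)
        = indicator {max r r'<..min s s'}"
      by (auto simp: fun_eq_iff indicator_def)
    then show ?thesis by simp
  qed
  finally show ?thesis .
qed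

lemma step_fun_Cons: "step_fun ((c, r, s) # S) u = c * indicator {r<..s} u + step_fun S u"
  by (simp add: step_fun_def)

lemma step_integral_Cons: "step_integral L' ((c, r, s) # S) \<omega> = c * (L' s \<omega> - L' r \<omega>)
    + step_integral L' S \<omega>"
  by (simp add: step_integral_def)

lemma step_Nil [simp]: "step_fun [] u = 0" "step_integral L' [] \<omega> = 0"
  by (simp_all add: step_fun_def step_integral_def)

lemma step_integral_L2: "in_L2 M (step_integral L S)"
proof (induction S)
  case Nil
  then show ?case by (simp add: step_integral_def[abs_def])
next
  case (Cons a S)
  obtain c r s where a: "a = (c, r, s)" by (cases a)
  show ?case
    unfolding a using Cons
    by (simp add: step_integral_Cons[abs_def] in_L2_add in_L2_cmult in_L2_diff
        second_moment_increment(1))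
qed

lemma indicator_in_L2: "in_L2 lborel (indicator {r<..s} :: real \<Rightarrow> real)"
proof -
  have "(\<lambda>x. (indicator {r<..s} x)\<^sup>2 :: real) = indicator {r<..s}" by (auto simp: indicator_def)
  moreover have "emeasure lborel {r<..s} < \<infinity>" by (cases "r \<le> s") auto
  ultimately show ?thesis by (auto simp: in_L2_real)
qed

lemma step_fun_L2: "in_L2 lborel (step_fun S)"
proof (induction S)
  case Nil
  then show ?case by (simp add: step_fun_def[abs_def])
next
  case (Cons a S)
  obtain c r s where a: "a = (c, r, s)" by (cases a)
  show ?case
    unfolding a using Cons
    by (simp add: step_fun_Cons[abs_def] in_L2_add in_L2_cmult indicator_in_L2)
qed

text \<open>Both sides are bilinear in the step functions, which reduces the claim to two single
  increments.\<close>

lemma step_isometry_bilinear: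
  assumes "step_valid S" "step_valid T"
  shows "expectation (\<lambda>\<omega>. step_integral L S \<omega> * step_integral L T \<omega>)
      = (LBINT u. step_fun S u * step_fun T u)"
proof -
  have D: "in_L2 M (\<lambda>\<omega>. L s \<omega> - L r \<omega>)" for s r
    by (intro in_L2_diff second_moment_increment(1))
  have one: "expectation (\<lambda>\<omega>. (L s \<omega> - L r \<omega>) * step_integral L T \<omega>)
      = (LBINT u. indicator {r<..s} u * step_fun T u)" if "r \<le> s" "step_valid T" for r s T
    using that(2)
  proof (induction T)
    case (Cons a T)
    obtain c r' s' where a: "a = (c, r', s')" by (cases a)
    have v: "step_valid T" "r' \<le> s'" using Cons.prems by (auto simp: a step_valid_def)
    have i: "integrable M (\<lambda>\<omega>. c * ((L s \<omega> - L r \<omega>) * (L s' \<omega> - L r' \<omega>)))"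
      "integrable M (\<lambda>\<omega>. (L s \<omega> - L r \<omega>) * step_integral L T \<omega>)"
      "integrable lborel (\<lambda>u. c * (indicator {r<..s} u * indicator {r'<..s'} u))"
      "integrable lborel (\<lambda>u. indicator {r<..s} u * step_fun T u)"
      by (intro integrable_mult_right in_L2_mult_integrable D step_integral_L2 indicator_in_L2
          step_fun_L2)+
    have "expectation (\<lambda>\<omega>. (L s \<omega> - L r \<omega>) * step_integral L (a # T) \<omega>)
      = expectation (\<lambda>\<omega>. c * ((L s \<omega> - L r \<omega>) * (L s' \<omega> - L r' \<omega>))
          + (L s \<omega> - L r \<omega>) * step_integral L T \<omega>)"
      by (simp add: a step_integral_Cons algebra_simps)
    also have "\<dots> = c * expectation (\<lambda>\<omega>. (L s \<omega> - L r \<omega>) * (L s' \<omega> - L r' \<omega>))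
        + expectation (\<lambda>\<omega>. (L s \<omega> - L r \<omega>) * step_integral L T \<omega>)"
      by (simp only: Bochner_Integration.integral_add[OF i(1,2)] integral_mult_right_zero)
    also have "\<dots> = c * (LBINT u. indicator {r<..s} u * indicator {r'<..s'} u)
        + (LBINT u. indicator {r<..s} u * step_fun T u)"
      using increment_covariance[OF that(1) v(2)] Cons.IH[OF v(1)] by simp
    also have "\<dots> = (LBINT u. c * (indicator {r<..s} u * indicator {r'<..s'} u)
        + indicator {r<..s} u * step_fun T u)"
      by (simp only: Bochner_Integration.integral_add[OF i(3,4)] integral_mult_right_zero)
    also have "\<dots> = (LBINT u. indicator {r<..s} u * step_fun (a # T) u)"
      by (simp add: a step_fun_Cons algebra_simps)
    finally show ?case .
  qed simp
  show ?thesis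
    using assms(1)
  proof (induction S)
    case (Cons a S)
    obtain c r s where a: "a = (c, r, s)" by (cases a)
    have v: "step_valid S" "r \<le> s" using Cons.prems by (auto simp: a step_valid_def)
    have i: "integrable M (\<lambda>\<omega>. c * ((L s \<omega> - L r \<omega>) * step_integral L T \<omega>))"
      "integrable M (\<lambda>\<omega>. step_integral L S \<omega> * step_integral L T \<omega>)"
      "integrable lborel (\<lambda>u. c * (indicator {r<..s} u * step_fun T u))"
      "integrable lborel (\<lambda>u. step_fun S u * step_fun T u)"
      by (intro integrable_mult_right in_L2_mult_integrable D step_integral_L2 indicator_in_L2
          step_fun_L2)+
    have "expectation (\<lambda>\<omega>. step_integral L (a # S) \<omega> * step_integral L T \<omega>)
      = expectation (\<lambda>\<omega>. c * ((L s \<omega> - L r \<omega>) * step_integral L T \<omega>)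
          + step_integral L S \<omega> * step_integral L T \<omega>)"
      by (simp add: a step_integral_Cons algebra_simps)
    also have "\<dots> = c * expectation (\<lambda>\<omega>. (L s \<omega> - L r \<omega>) * step_integral L T \<omega>)
        + expectation (\<lambda>\<omega>. step_integral L S \<omega> * step_integral L T \<omega>)"
      by (simp only: Bochner_Integration.integral_add[OF i(1,2)] integral_mult_right_zero)
    also have "\<dots> = c * (LBINT u. indicator {r<..s} u * step_fun T u)
        + (LBINT u. step_fun S u * step_fun T u)"
      using one[OF v(2) assms(2)] Cons.IH[OF v(1)] by simp
    also have "\<dots> = (LBINT u. c * (indicator {r<..s} u * step_fun T u)
        + step_fun S u * step_fun T u)"
      by (simp only: Bochner_Integration.integral_add[OF i(3,4)] integral_mult_right_zero)
    also have "\<dots> = (LBINT u. step_fun (a # S) u * step_fun T u)"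
      by (simp add: a step_fun_Cons algebra_simps)
    finally show ?case .
  qed simp
qed

end

lemma (in two_sided_standardized_levy) levy_integral_covariance:
  assumes Y: "has_levy_integral M L \<phi> Y" and Z: "has_levy_integral M L \<psi> Z"
  shows "expectation (\<lambda>\<omega>. Y \<omega> * Z \<omega>) = (LBINT u. \<phi> u * \<psi> u)"
proof -
  obtain S where S: "\<And>k. step_valid (S k)" "L2_tendsto lborel (\<lambda>k. step_fun (S k)) \<phi> sequentially"
    "L2_tendsto M (\<lambda>k. step_integral L (S k)) Y sequentially" and Y2: "in_L2 lborel \<phi>" "in_L2 M Y"
    using Y unfolding has_levy_integral_def by blast
  obtain T where T: "\<And>k. step_valid (T k)" "L2_tendsto lborel (\<lambda>k. step_fun (T k)) \<psi> sequentially"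
    "L2_tendsto M (\<lambda>k. step_integral L (T k)) Z sequentially" and Z2: "in_L2 lborel \<psi>" "in_L2 M Z"
    using Z unfolding has_levy_integral_def by blast
  have "(\<lambda>k. expectation (\<lambda>\<omega>. step_integral L (S k) \<omega> * step_integral L (T k) \<omega>))
      \<longlonglongrightarrow> expectation (\<lambda>\<omega>. Y \<omega> * Z \<omega>)"
    by (intro L2_tendsto_inner step_integral_L2 S T Y2 Z2)
  moreover have "(\<lambda>k. LBINT u. step_fun (S k) u * step_fun (T k) u) \<longlonglongrightarrow> (LBINT u. \<phi> u * \<psi> u)"
    by (intro L2_tendsto_inner step_fun_L2 S T Y2 Z2)
  ultimately show ?thesis
    using step_isometry_bilinear[OF S(1) T(1)] LIMSEQ_unique by simp
qed

text \<open>Substituting \<open>s - u\<close> for \<open>u\<close> shows that the covariance depends only on the lag \<open>t - s\<close>.\<close>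

lemma (in two_sided_standardized_levy) moving_average_covariance:
  assumes X: "\<And>t. has_levy_integral M L (\<lambda>u. indicator {..t} u * g (t - u)) (X t)"
  shows "expectation (\<lambda>\<omega>. X s \<omega> * X t \<omega>)
    = (LBINT u. (indicator {0..} u * g u) * (indicator {0..} (u + (t - s)) * g (u + (t - s))))"
proof -
  have "expectation (\<lambda>\<omega>. X s \<omega> * X t \<omega>) = (LBINT u. (indicator {..s} u * g (s - u)) * (indicator
      {..t} u * g (t - u)))"
    by (rule levy_integral_covariance[OF X X])
  also have "\<dots> = (LBINT u. (indicator {..s} (s + - 1 * u) * g (s - (s
      + - 1 * u))) * (indicator {..t} (s + - 1 * u) * g (t - (s + - 1 * u))))"
    by (subst lborel_integral_real_affine[where c = "- 1" and t = s]) simp_all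
  also have "\<dots> = (LBINT u. (indicator {0..} u * g u) * (indicator {0..} (u + (t - s)) * g (u
      + (t - s))))"
    by (intro Bochner_Integration.integral_cong) (auto simp: indicator_def algebra_simps)
  finally show ?thesis .
qed

section \<open>Second order stationary processes\<close>

lemma measurable_process_compose:
  assumes "measurable_process M X" "f \<in> borel_measurable N" "h \<in> measurable N M"
  shows "(\<lambda>z. X (f z) (h z)) \<in> borel_measurable N"
  using measurable_compose[OF measurable_Pair[OF assms(2,3)] assms(1)[unfolded
      measurable_process_def]]
  by simp

lemma measurable_processI:
  "(\<lambda>z. X (fst z) (snd z)) \<in> borel_measurable (borel \<Otimes>\<^sub>M M) \<Longrightarrow> measurable_process M X"
  unfolding measurable_process_def by (simp add: case_prod_beta')

context prob_space
begin

text \<open>These three lemmas integrate a process with bounded first moments against a fixed integrable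
  function; the exchange of the order of integration is what requires joint measurability.\<close>

lemma nn_integral_convolution_le:
  assumes Z: "measurable_process M Z" and c: "0 \<le> c" "\<And>s. (\<integral>\<^sup>+\<omega>. ennreal \<bar>Z s \<omega>\<bar> \<partial>M) \<le> ennreal c"
    and h: "integrable lborel h"
  shows "(\<integral>\<^sup>+\<omega>. \<integral>\<^sup>+u. ennreal \<bar>Z (t - u) \<omega> * h u\<bar> \<partial>lborel \<partial>M) \<le> ennreal (c * (LBINT u. \<bar>h u\<bar>))"
proof -
  interpret LM: pair_sigma_finite lborel M ..
  have [measurable]: "h \<in> borel_measurable borel" using h by simp
  have [measurable]: "(\<lambda>z. Z (t - fst z) (snd z)) \<in> borel_measurable (lborel \<Otimes>\<^sub>M M)"
    by (rule measurable_process_compose[OF Z]) measurable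
  have [measurable]: "Z s \<in> borel_measurable M" for s
    by (rule measurable_process_compose[OF Z]) measurable
  have "(\<integral>\<^sup>+\<omega>. \<integral>\<^sup>+u. ennreal \<bar>Z (t - u) \<omega> * h u\<bar> \<partial>lborel \<partial>M)
      = (\<integral>\<^sup>+u. \<integral>\<^sup>+\<omega>. ennreal \<bar>Z (t - u) \<omega> * h u\<bar> \<partial>M \<partial>lborel)"
    by (rule LM.Fubini') (simp add: case_prod_beta')
  also have "\<dots> = (\<integral>\<^sup>+u. (\<integral>\<^sup>+\<omega>. ennreal \<bar>Z (t - u) \<omega>\<bar> \<partial>M) * ennreal \<bar>h u\<bar> \<partial>lborel)"
    by (simp add: abs_mult ennreal_mult nn_integral_multc)
  also have "\<dots> \<le> (\<integral>\<^sup>+u. ennreal c * ennreal \<bar>h u\<bar> \<partial>lborel)"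
    by (intro nn_integral_mono mult_right_mono c) simp
  also have "\<dots> = ennreal c * (\<integral>\<^sup>+u. ennreal \<bar>h u\<bar> \<partial>lborel)"
    by (rule nn_integral_cmult) measurable
  also have "(\<integral>\<^sup>+u. ennreal \<bar>h u\<bar> \<partial>lborel) = ennreal (LBINT u. \<bar>h u\<bar>)"
    using h by (intro nn_integral_eq_integral) auto
  finally show ?thesis using c(1) by (simp add: ennreal_mult)
qed

lemma convolution_integrable:
  assumes Z: "measurable_process M Z" and c: "0 \<le> c" "\<And>s. (\<integral>\<^sup>+\<omega>. ennreal \<bar>Z s \<omega>\<bar> \<partial>M) \<le> ennreal c"
    and h: "integrable lborel h"
  shows "AE \<omega> in M. integrable lborel (\<lambda>u. Z (t - u) \<omega> * h u)"
proof -
  interpret LM: pair_sigma_finite lborel M ..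
  have [measurable]: "h \<in> borel_measurable borel" using h by simp
  have [measurable]: "(\<lambda>z. Z (t - snd z) (fst z)) \<in> borel_measurable (M \<Otimes>\<^sub>M lborel)"
    by (rule measurable_process_compose[OF Z]) measurable
  have zu: "(\<lambda>u. Z (t - u) \<omega>) \<in> borel_measurable borel" if "\<omega> \<in> space M" for \<omega>
    by (rule measurable_process_compose[OF Z]) (use that in measurable)
  have m: "(\<lambda>\<omega>. \<integral>\<^sup>+u. ennreal \<bar>Z (t - u) \<omega> * h u\<bar> \<partial>lborel) \<in> borel_measurable M"
    by (rule lborel.borel_measurable_nn_integral) (simp add: case_prod_beta')
  have "AE \<omega> in M. (\<integral>\<^sup>+u. ennreal \<bar>Z (t - u) \<omega> * h u\<bar> \<partial>lborel) \<noteq> \<infinity>"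
    by (rule nn_integral_PInf_AE[OF m])
      (use nn_integral_convolution_le[OF assms, of t] in \<open>auto simp: top_unique\<close>)
  then show ?thesis
    using AE_space
  proof eventually_elim
    case (elim \<omega>)
    have [measurable]: "(\<lambda>u. Z (t - u) \<omega>) \<in> borel_measurable borel" using elim zu by simp
    show ?case using elim(1) by (intro integrableI_bounded) (auto simp: less_top)
  qed
qed

lemma convolution_L1_bound:
  assumes Z: "measurable_process M Z" and c: "0 \<le> c" "\<And>s. (\<integral>\<^sup>+\<omega>. ennreal \<bar>Z s \<omega>\<bar> \<partial>M) \<le> ennreal c"
    and h: "integrable lborel h"
  shows "(\<integral>\<^sup>+\<omega>. ennreal \<bar>LBINT u. Z (t - u) \<omega> * h u\<bar> \<partial>M) \<le> ennreal (c * (LBINT u. \<bar>h u\<bar>))"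
proof -
  have "AE \<omega> in M. ennreal \<bar>LBINT u. Z (t - u) \<omega> * h u\<bar>
      \<le> (\<integral>\<^sup>+u. ennreal \<bar>Z (t - u) \<omega> * h u\<bar> \<partial>lborel)"
    using convolution_integrable[OF assms, of t]
  proof eventually_elim
    case (elim \<omega>)
    from integral_norm_bound_ennreal[OF elim] show ?case by simp
  qed
  then show ?thesis
    using nn_integral_convolution_le[OF assms, of t] by (rule order_trans[OF nn_integral_mono_AE])
qed

lemma nn_integral_abs_le_sqrt:
  fixes Y :: "'a \<Rightarrow> real"
  assumes "in_L2 M Y"
  shows "(\<integral>\<^sup>+\<omega>. ennreal \<bar>Y \<omega>\<bar> \<partial>M) \<le> ennreal (sqrt (expectation (\<lambda>\<omega>. (Y \<omega>)\<^sup>2)))"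
  using expectation_abs_le_sqrt[OF assms] in_L2_integrable[OF assms]
  by (subst nn_integral_eq_integral) (auto intro: ennreal_leI)

end

locale second_order_stationary = prob_space M for M :: "'w measure" +
  fixes X :: "real \<Rightarrow> 'w \<Rightarrow> real" and \<gamma> :: "real \<Rightarrow> real"
  assumes X_process: "measurable_process M X"
    and X_L2: "in_L2 M (X t)"
    and covariance: "expectation (\<lambda>\<omega>. X s \<omega> * X t \<omega>) = \<gamma> (t - s)"
begin

abbreviation "weighted w s \<omega> \<equiv> increment_integral w (\<lambda>t. X t \<omega>) s"

lemma X_compose [measurable (raw)]:
  "f \<in> borel_measurable N \<Longrightarrow> h \<in> measurable N M \<Longrightarrow> (\<lambda>z. X (f z) (h z)) \<in> borel_measurable N"
  by (rule measurable_process_compose[OF X_process])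

lemma X_abs_bound: "(\<integral>\<^sup>+\<omega>. ennreal \<bar>X t \<omega>\<bar> \<partial>M) \<le> ennreal (sqrt (\<gamma> 0))"
  using nn_integral_abs_le_sqrt[OF X_L2[of t]] covariance[of t t] by (simp add: power2_eq_square)

lemma gamma_0_nonneg: "0 \<le> \<gamma> 0"
proof -
  have "0 \<le> expectation (\<lambda>\<omega>. (X 0 \<omega>)\<^sup>2)" by simp
  then show ?thesis using covariance[of 0 0] by (simp only: power2_eq_square diff_self)
qed

lemma weighted_process:
  assumes [measurable]: "w \<in> borel_measurable borel"
  shows "measurable_process M (weighted w)"
proof (rule measurable_processI)
  show "(\<lambda>z. weighted w (fst z) (snd z)) \<in> borel_measurable (borel \<Otimes>\<^sub>M M)"
    unfolding increment_integral_def
    by (rule lborel.borel_measurable_lebesgue_integral) (simp add: case_prod_beta')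
qed

lemma weighted_integrable:
  assumes w: "integrable lborel w"
  shows "AE \<omega> in M. integrable lborel (\<lambda>u. (X s \<omega> - X (s - u) \<omega>) * w u)"
  using convolution_integrable[OF X_process real_sqrt_ge_zero[OF gamma_0_nonneg] X_abs_bound w, of
      s]
proof eventually_elim
  case (elim \<omega>)
  have "integrable lborel (\<lambda>u. X s \<omega> * w u - X (s - u) \<omega> * w u)"
    using elim w by (intro Bochner_Integration.integrable_diff) auto
  then show ?case by (simp add: left_diff_distrib)
qed

lemma weighted_diff:
  assumes "integrable lborel w" "integrable lborel w'"
  shows "AE \<omega> in M. weighted (\<lambda>u. w u - w' u) s \<omega> = weighted w s \<omega> - weighted w' s \<omega>"
  using weighted_integrable[OF assms(1), of s] weighted_integrable[OF assms(2), of s]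
proof eventually_elim
  case (elim \<omega>)
  then show ?case
    unfolding increment_integral_def right_diff_distrib
    by (rule Bochner_Integration.integral_diff)
qed

lemma increment_L2: "in_L2 M (\<lambda>\<omega>. X s \<omega> - X (s - u) \<omega>)"
  by (intro in_L2_diff X_L2)

lemma increment_covariance:
  "expectation (\<lambda>\<omega>. (X s \<omega> - X (s - u) \<omega>) * (X s \<omega> - X (s - v) \<omega>)) = \<gamma> 0 - \<gamma> (- v) - \<gamma> u
      + \<gamma> (u - v)"
proof -
  have i: "integrable M (\<lambda>\<omega>. X a \<omega> * X b \<omega>)" for a b
    by (intro in_L2_mult_integrable X_L2)
  have "expectation (\<lambda>\<omega>. (X s \<omega> - X (s - u) \<omega>) * (X s \<omega> - X (s - v) \<omega>))
     = expectation (\<lambda>\<omega>. X s \<omega> * X s \<omega> - X s \<omega> * X (s - v) \<omega> - X (s - u) \<omega> * X s \<omega>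
         + X (s - u) \<omega> * X (s - v) \<omega>)"
    by (intro Bochner_Integration.integral_cong) (auto simp: algebra_simps)
  also have "\<dots> = \<gamma> (s - s) - \<gamma> (s - v - s) - \<gamma> (s - (s - u)) + \<gamma> (s - v - (s - u))"
    by (simp only: Bochner_Integration.integral_add Bochner_Integration.integral_diff
        Bochner_Integration.integrable_add Bochner_Integration.integrable_diff i covariance)
  finally show ?thesis by (simp add: algebra_simps)
qed

lemma increment_second_moment: "expectation (\<lambda>\<omega>. (X s \<omega> - X (s - u) \<omega>)\<^sup>2) \<le> 4 * \<gamma> 0"
proof -
  have sq: "integrable M (\<lambda>\<omega>. (X a \<omega>)\<^sup>2)" "expectation (\<lambda>\<omega>. (X a \<omega>)\<^sup>2) = \<gamma> 0" for a
    using X_L2[of a] covariance[of a a] by (auto simp: in_L2_real power2_eq_square)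
  have "expectation (\<lambda>\<omega>. (X s \<omega> - X (s - u) \<omega>)\<^sup>2) \<le> expectation (\<lambda>\<omega>. 2 * (X s \<omega>)\<^sup>2
      + 2 * (X (s - u) \<omega>)\<^sup>2)"
  proof (rule integral_mono)
    show "integrable M (\<lambda>\<omega>. (X s \<omega> - X (s - u) \<omega>)\<^sup>2)" using increment_L2 by (simp add: in_L2_real)
    show "integrable M (\<lambda>\<omega>. 2 * (X s \<omega>)\<^sup>2 + 2 * (X (s - u) \<omega>)\<^sup>2)" using sq by simp
    show "(X s \<omega> - X (s - u) \<omega>)\<^sup>2 \<le> 2 * (X s \<omega>)\<^sup>2 + 2 * (X (s - u) \<omega>)\<^sup>2" for \<omega>
      using zero_le_power2[of "X s \<omega> + X (s - u) \<omega>"] by (simp add: power2_eq_square algebra_simps)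
  qed
  also have "\<dots> = 4 * \<gamma> 0" using sq by simp
  finally show ?thesis .
qed

text \<open>Fubini's theorem expresses the second moment through the covariances of the increments, which
  do not depend on \<open>s\<close>.\<close>

lemma weighted_second_moment:
  assumes w: "integrable lborel w"
  shows "in_L2 M (weighted w s)"
    and "expectation (\<lambda>\<omega>. (weighted w s \<omega>)\<^sup>2)
      = (\<integral>p. (\<gamma> 0 - \<gamma> (- snd p) - \<gamma> (fst p)
          + \<gamma> (fst p - snd p)) * (w (fst p) * w (snd p)) \<partial>(lborel \<Otimes>\<^sub>M lborel))"
proof -
  let ?P = "lborel \<Otimes>\<^sub>M lborel :: (real \<times> real) measure"
  interpret PM: pair_sigma_finite ?P M
    by (intro pair_sigma_finite.intro lborel_pair.P.sigma_finite_measure_axioms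
        sigma_finite_measure_axioms)
  have [measurable]: "w \<in> borel_measurable borel" using w by simp
  define D where "D u \<omega> = X s \<omega> - X (s - u) \<omega>" for u \<omega>
  have [measurable (raw)]: "(\<lambda>z. D (f z) (h z)) \<in> borel_measurable N"
    if [measurable]: "f \<in> borel_measurable N" "h \<in> measurable N M" for f h and N :: "'z measure"
    unfolding D_def by measurable
  have D_L2: "in_L2 M (D u)" for u unfolding D_def by (rule increment_L2)
  define H where "H p \<omega> = (D (fst p) \<omega> * D (snd p) \<omega>) * (w (fst p) * w (snd p))" for p \<omega>
  have H_meas [measurable]: "(\<lambda>(p, \<omega>). H p \<omega>) \<in> borel_measurable (?P \<Otimes>\<^sub>M M)"
    unfolding H_def case_prod_beta' by measurable
  have DD: "(\<integral>\<^sup>+\<omega>. ennreal \<bar>D u \<omega> * D v \<omega>\<bar> \<partial>M) \<le> ennreal (4 * \<gamma> 0)" for u v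
  proof -
    have sq: "integrable M (\<lambda>\<omega>. (D u \<omega>)\<^sup>2)" for u using D_L2 by (simp add: in_L2_real)
    have "(\<integral>\<^sup>+\<omega>. ennreal \<bar>D u \<omega> * D v \<omega>\<bar> \<partial>M) = ennreal (expectation (\<lambda>\<omega>. \<bar>D u \<omega> * D v \<omega>\<bar>))"
      using in_L2_mult_integrable[OF D_L2 D_L2] by (intro nn_integral_eq_integral) auto
    also have "expectation (\<lambda>\<omega>. \<bar>D u \<omega> * D v \<omega>\<bar>) \<le> expectation (\<lambda>\<omega>. ((D u \<omega>)\<^sup>2 + (D v \<omega>)\<^sup>2) / 2)"
    proof (rule integral_mono)
      show "\<bar>D u \<omega> * D v \<omega>\<bar> \<le> ((D u \<omega>)\<^sup>2 + (D v \<omega>)\<^sup>2) / 2" for \<omega>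
        using sum_squares_bound[of "\<bar>D u \<omega>\<bar>" "\<bar>D v \<omega>\<bar>"] by (simp add: abs_mult)
    qed (use sq in_L2_mult_integrable[OF D_L2 D_L2] in auto)
    also have "\<dots> = (expectation (\<lambda>\<omega>. (D u \<omega>)\<^sup>2) + expectation (\<lambda>\<omega>. (D v \<omega>)\<^sup>2)) / 2" using sq by simp
    also have "\<dots> \<le> 4 * \<gamma> 0"
      using increment_second_moment[of s u] increment_second_moment[of s v] by (simp add: D_def)
    finally show ?thesis by (simp add: ennreal_leI)
  qed
  have H_int: "integrable (?P \<Otimes>\<^sub>M M) (\<lambda>(p, \<omega>). H p \<omega>)"
  proof (rule integrableI_bounded)
    have "(\<integral>\<^sup>+z. ennreal (norm ((\<lambda>(p, \<omega>). H p \<omega>) z)) \<partial>(?P \<Otimes>\<^sub>M M))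
        = (\<integral>\<^sup>+p. \<integral>\<^sup>+\<omega>. ennreal \<bar>H p \<omega>\<bar> \<partial>M \<partial>?P)"
      by (subst nn_integral_fst[symmetric]) (auto simp: case_prod_beta')
    also have "\<dots> = (\<integral>\<^sup>+p. (\<integral>\<^sup>+\<omega>. ennreal \<bar>D (fst p) \<omega> * D (snd p) \<omega>\<bar> \<partial>M) * ennreal \<bar>w (fst p) * w
        (snd p)\<bar> \<partial>?P)"
      unfolding H_def abs_mult[of "_ * _" "w _ * w _"]
      by (simp add: ennreal_mult nn_integral_multc)
    also have "\<dots> \<le> (\<integral>\<^sup>+p. ennreal (4 * \<gamma> 0) * ennreal \<bar>w (fst p) * w (snd p)\<bar> \<partial>?P)"
      by (intro nn_integral_mono mult_right_mono DD) simp
    also have "\<dots> = (\<integral>\<^sup>+u. \<integral>\<^sup>+v. ennreal (4 * \<gamma> 0) * ennreal \<bar>w u * w v\<bar> \<partial>lborel \<partial>lborel)"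
      by (subst lborel.nn_integral_fst[symmetric]) auto
    also have "\<dots> = ennreal (4 * \<gamma> 0) * ((\<integral>\<^sup>+u. ennreal \<bar>w u\<bar> \<partial>lborel) * (\<integral>\<^sup>+v. ennreal \<bar>w v\<bar>
        \<partial>lborel))"
      by (simp add: abs_mult ennreal_mult nn_integral_cmult nn_integral_multc)
    also have "(\<integral>\<^sup>+u. ennreal \<bar>w u\<bar> \<partial>lborel) = ennreal (LBINT u. \<bar>w u\<bar>)"
      using w by (intro nn_integral_eq_integral) auto
    also have "ennreal (4 * \<gamma> 0) * (ennreal (LBINT u. \<bar>w u\<bar>) * ennreal (LBINT u. \<bar>w u\<bar>)) < \<infinity>"
      by (simp add: ennreal_mult_less_top)
    finally show "(\<integral>\<^sup>+z. ennreal (norm ((\<lambda>(p, \<omega>). H p \<omega>) z)) \<partial>(?P \<Otimes>\<^sub>M M)) < \<infinity>" .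
  qed measurable
  have sq_eq: "AE \<omega> in M. (\<integral>p. H p \<omega> \<partial>?P) = (weighted w s \<omega>)\<^sup>2"
    using PM.AE_integrable_snd[OF H_int]
  proof eventually_elim
    case (elim \<omega>)
    let ?I = "LBINT u. D u \<omega> * w u"
    have "(\<integral>p. H p \<omega> \<partial>?P) = (LBINT u. LBINT v. H (u, v) \<omega>)"
      by (rule lborel_pair.integral_fst'[symmetric, OF elim])
    also have "\<dots> = (LBINT u. LBINT v. (D u \<omega> * w u) * (D v \<omega> * w v))"
      by (simp add: H_def mult_ac)
    also have "\<dots> = (LBINT u. (D u \<omega> * w u) * ?I)" by (simp only: integral_mult_right_zero)
    also have "\<dots> = ?I * ?I" by (rule integral_mult_left_zero)
    finally show ?case by (simp add: increment_integral_def D_def power2_eq_square)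
  qed
  have [measurable]: "weighted w s \<in> borel_measurable M"
    by (rule measurable_process_compose[OF weighted_process]) measurable
  have "integrable M (\<lambda>\<omega>. (weighted w s \<omega>)\<^sup>2)"
    using integrable_cong_AE[OF _ _ sq_eq] PM.integrable_snd[OF H_int] by simp
  then show "in_L2 M (weighted w s)" by (simp add: in_L2_real)
  have "expectation (\<lambda>\<omega>. (weighted w s \<omega>)\<^sup>2) = expectation (\<lambda>\<omega>. \<integral>p. H p \<omega> \<partial>?P)"
    using PM.integrable_snd[OF H_int] sq_eq by (intro integral_cong_AE) auto
  also have "\<dots> = (\<integral>p. expectation (\<lambda>\<omega>. H p \<omega>) \<partial>?P)"
    by (rule PM.Fubini_integral[OF H_int])
  also have "\<dots> = (\<integral>p. (\<gamma> 0 - \<gamma> (- snd p) - \<gamma> (fst p)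
      + \<gamma> (fst p - snd p)) * (w (fst p) * w (snd p)) \<partial>?P)"
    unfolding H_def D_def by (simp only: integral_mult_left_zero increment_covariance)
  finally show "expectation (\<lambda>\<omega>. (weighted w s \<omega>)\<^sup>2)
      = (\<integral>p. (\<gamma> 0 - \<gamma> (- snd p) - \<gamma> (fst p) + \<gamma> (fst p - snd p)) * (w (fst p) * w (snd p)) \<partial>?P)" .
qed

lemma weighted_diff_second_moment:
  assumes w: "integrable lborel w" "integrable lborel w'"
  shows "expectation (\<lambda>\<omega>. (weighted w s \<omega> - weighted w' s \<omega>)\<^sup>2)
      = expectation (\<lambda>\<omega>. (weighted w 0 \<omega> - weighted w' 0 \<omega>)\<^sup>2)"
proof -
  have *: "expectation (\<lambda>\<omega>. (weighted w s \<omega> - weighted w' s \<omega>)\<^sup>2)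
      = expectation (\<lambda>\<omega>. (weighted (\<lambda>u. w u - w' u) s \<omega>)\<^sup>2)" for s
  proof (rule integral_cong_AE)
    show "AE \<omega> in M. (weighted w s \<omega> - weighted w' s \<omega>)\<^sup>2 = (weighted (\<lambda>u. w u - w' u) s \<omega>)\<^sup>2"
      using weighted_diff[OF w, of s] by eventually_elim simp
    have "in_L2 M (weighted w s)" "in_L2 M (weighted w' s)" "in_L2 M (weighted (\<lambda>u. w u - w' u) s)"
      using w by (auto intro!: weighted_second_moment(1))
    then show "(\<lambda>\<omega>. (weighted w s \<omega> - weighted w' s \<omega>)\<^sup>2) \<in> borel_measurable M"
      "(\<lambda>\<omega>. (weighted (\<lambda>u. w u - w' u) s \<omega>)\<^sup>2) \<in> borel_measurable M" by (auto simp: in_L2_real)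
  qed
  show ?thesis
    unfolding * weighted_second_moment(2)[OF Bochner_Integration.integrable_diff[OF w]] ..
qed

text \<open>Pointwise \<open>L\<^sup>2\<close> convergence is automatically uniform in \<open>t\<close>, since the mutual distances of
  the approximations do not depend on \<open>t\<close>.\<close>

lemma weighted_limit_uniform:
  assumes w: "\<And>n. integrable lborel (w n)" and DX: "\<And>t. in_L2 M (DX t)"
    and lim: "\<And>t. L2_tendsto M (\<lambda>n. weighted (w n) t) (DX t) sequentially" and "0 < e"
  obtains N where "\<And>n t. N \<le> n \<Longrightarrow> expectation (\<lambda>\<omega>. (DX t \<omega> - weighted (w n) t \<omega>)\<^sup>2) \<le> e"
proof -
  note L2 = weighted_second_moment(1)[OF w]
  define d where "d n t = expectation (\<lambda>\<omega>. (weighted (w n) t \<omega> - DX t \<omega>)\<^sup>2)" for n t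
  have d: "(\<lambda>n. d n t) \<longlonglongrightarrow> 0" for t
  proof -
    have "(\<integral>\<^sup>+\<omega>. ennreal ((norm (weighted (w n) t \<omega> - DX t \<omega>))\<^sup>2) \<partial>M) = ennreal (d n t)" for n
      unfolding d_def using in_L2_diff[OF L2 DX]
      by (subst nn_integral_eq_integral[symmetric]) (auto simp: in_L2_real)
    then have "(\<lambda>n. ennreal (d n t)) \<longlonglongrightarrow> 0"
      using lim[of t] unfolding L2_tendsto_def by simp
    then show ?thesis
      by (rule ennreal_tendsto_0_iff[THEN iffD1, rotated]) (simp add: d_def)
  qed
  have "eventually (\<lambda>n. d n 0 < e / 8) sequentially"
    using \<open>0 < e\<close> by (intro order_tendstoD(2)[OF d]) simp
  then obtain N where N: "\<And>n. N \<le> n \<Longrightarrow> d n 0 < e / 8"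
    unfolding eventually_sequentially by blast
  have "d n t \<le> e" if "N \<le> n" for n t
  proof (rule LIMSEQ_le_const)
    show "(\<lambda>m. e + 2 * d m t) \<longlonglongrightarrow> e"
      using tendsto_add[OF tendsto_const[of e] tendsto_mult_left[OF d[of t], of 2]] by simp
    show "\<exists>k. \<forall>m\<ge>k. d n t \<le> e + 2 * d m t"
    proof (intro exI allI impI)
      fix m assume "N \<le> m"
      have "expectation (\<lambda>\<omega>. (weighted (w n) t \<omega> - weighted (w m) t \<omega>)\<^sup>2)
          = expectation (\<lambda>\<omega>. (weighted (w n) 0 \<omega> - weighted (w m) 0 \<omega>)\<^sup>2)"
        by (rule weighted_diff_second_moment[OF w w])
      also have "\<dots> \<le> 2 * d n 0 + 2 * d m 0"
        using square_triangle[OF L2[of n 0] DX[of 0] L2[of m 0]] by (simp add: d_def power2_commute)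
      also have "\<dots> \<le> e / 2" using N[OF that] N[OF \<open>N \<le> m\<close>] by simp
      finally have "expectation (\<lambda>\<omega>. (weighted (w n) t \<omega> - weighted (w m) t \<omega>)\<^sup>2) \<le> e / 2" .
      then show "d n t \<le> e + 2 * d m t"
        using square_triangle[OF L2[of n t] L2[of m t] DX[of t]] by (simp add: d_def)
    qed
  qed
  then show thesis by (intro that[of N]) (simp add: d_def power2_commute)
qed

end

section \<open>Moving the fractional derivative from the process to the kernel\<close>

lemma translated_product_integrable:
  fixes f w :: "real \<Rightarrow> real"
  assumes f: "integrable lborel f" and w: "integrable lborel w"
  shows "integrable (lborel \<Otimes>\<^sub>M lborel) (\<lambda>(v, u). f (v - c * u) * w u)"
proof (rule integrableI_bounded)
  have [measurable]: "f \<in> borel_measurable borel" "w \<in> borel_measurable borel" using f w by auto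
  show "(\<lambda>(v, u). f (v - c * u) * w u) \<in> borel_measurable (lborel \<Otimes>\<^sub>M lborel)" by measurable
  have "(\<integral>\<^sup>+z. ennreal (norm ((\<lambda>(v, u). f (v - c * u) * w u) z)) \<partial>(lborel \<Otimes>\<^sub>M lborel))
      = (\<integral>\<^sup>+u. \<integral>\<^sup>+v. ennreal \<bar>f (v - c * u) * w u\<bar> \<partial>lborel \<partial>lborel)"
    by (subst lborel_pair.nn_integral_snd[symmetric]) auto
  also have "\<dots> = (\<integral>\<^sup>+u. (\<integral>\<^sup>+v. ennreal \<bar>f v\<bar> \<partial>lborel) * ennreal \<bar>w u\<bar> \<partial>lborel)"
  proof (rule nn_integral_cong)
    fix u
    have "(\<integral>\<^sup>+v. ennreal \<bar>f (v - c * u) * w u\<bar> \<partial>lborel)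
        = (\<integral>\<^sup>+v. ennreal \<bar>f (v - c * u)\<bar> \<partial>lborel) * ennreal \<bar>w u\<bar>"
      by (simp add: abs_mult ennreal_mult nn_integral_multc)
    also have "(\<integral>\<^sup>+v. ennreal \<bar>f (v - c * u)\<bar> \<partial>lborel) = (\<integral>\<^sup>+v. ennreal \<bar>f v\<bar> \<partial>lborel)"
      using nn_integral_real_affine[of "\<lambda>v. ennreal \<bar>f v\<bar>" 1 "- (c * u)"]
          by (simp add: algebra_simps)
    finally show "(\<integral>\<^sup>+v. ennreal \<bar>f (v - c * u) * w u\<bar> \<partial>lborel)
        = (\<integral>\<^sup>+v. ennreal \<bar>f v\<bar> \<partial>lborel) * ennreal \<bar>w u\<bar>" .
  qed
  also have "\<dots> = (\<integral>\<^sup>+v. ennreal \<bar>f v\<bar> \<partial>lborel) * (\<integral>\<^sup>+u. ennreal \<bar>w u\<bar> \<partial>lborel)"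
    by (rule nn_integral_cmult) measurable
  also have "\<dots> = ennreal (LBINT v. \<bar>f v\<bar>) * ennreal (LBINT u. \<bar>w u\<bar>)"
    using f w by (simp add: nn_integral_eq_integral)
  also have "\<dots> < \<infinity>" by (simp add: ennreal_mult_less_top)
  finally show "(\<integral>\<^sup>+z. ennreal (norm ((\<lambda>(v, u). f (v - c * u) * w u) z)) \<partial>(lborel \<Otimes>\<^sub>M lborel)) < \<infinity>"
      .
qed

lemma increment_integral_integrable:
  assumes "integrable lborel f" "integrable lborel w"
  shows "integrable lborel (increment_integral w f)"
proof -
  have "integrable (lborel \<Otimes>\<^sub>M lborel) (\<lambda>z. (\<lambda>(v, u). f (v - 0 * u) * w u) z - (\<lambda>(v, u). f (v - 1 *
      u) * w u) z)"
    by (intro Bochner_Integration.integrable_diff translated_product_integrable assms)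
  then have "integrable (lborel \<Otimes>\<^sub>M lborel) (\<lambda>(v, u). (f v - f (v - u)) * w u)"
    by (simp add: case_prod_beta' left_diff_distrib)
  from lborel_pair.integrable_fst[OF this] show ?thesis
      by (simp add: increment_integral_def[abs_def])
qed

text \<open>Both sides equal \<open>\<integral>\<integral> x(v) f(v) w(u) - \<integral>\<integral> x(v + u) f(v) w(u)\<close>; in the second double integral
  substitute \<open>v - u\<close> for \<open>v\<close>.\<close>

lemma increment_integral_transpose:
  fixes x f w :: "real \<Rightarrow> real"
  assumes [measurable]: "x \<in> borel_measurable borel" "f \<in> borel_measurable borel"
      "w \<in> borel_measurable borel"
    and A: "integrable (lborel \<Otimes>\<^sub>M lborel) (\<lambda>(v, u). x v * f v * w u)"
    and B: "integrable (lborel \<Otimes>\<^sub>M lborel) (\<lambda>(v, u). x (v + u) * f v * w u)"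
  shows "(LBINT v. (LBINT u. (x v - x (v + u)) * w u) * f v)
      = (LBINT v. x v * increment_integral w f v)"
proof -
  have shift: "(LBINT v. x (v + u) * f v * w u) = (LBINT v. x v * f (v - u) * w u)" for u
    using lborel_integral_real_affine[of 1 "\<lambda>v. x v * f (v - u) * w u" u]
        by (auto simp: add.commute)
  have B': "integrable (lborel \<Otimes>\<^sub>M lborel) (\<lambda>(v, u). x v * f (v - u) * w u)"
  proof (rule integrableI_bounded)
    have "(\<integral>\<^sup>+z. ennreal (norm ((\<lambda>(v, u). x v * f (v - u) * w u) z)) \<partial>(lborel \<Otimes>\<^sub>M lborel))
        = (\<integral>\<^sup>+u. \<integral>\<^sup>+v. ennreal \<bar>x v * f (v - u) * w u\<bar> \<partial>lborel \<partial>lborel)"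
      by (subst lborel_pair.nn_integral_snd[symmetric]) auto
    also have "\<dots> = (\<integral>\<^sup>+u. \<integral>\<^sup>+v. ennreal \<bar>x (v + u) * f v * w u\<bar> \<partial>lborel \<partial>lborel)"
    proof (rule nn_integral_cong)
      show "(\<integral>\<^sup>+v. ennreal \<bar>x v * f (v - u) * w u\<bar> \<partial>lborel) = (\<integral>\<^sup>+v. ennreal \<bar>x (v
          + u) * f v * w u\<bar> \<partial>lborel)" for u
        using nn_integral_real_affine[of "\<lambda>v. ennreal \<bar>x v * f (v - u) * w u\<bar>" 1 u]
            by (simp add: add.commute)
    qed
    also have "\<dots> = (\<integral>\<^sup>+z. ennreal (norm ((\<lambda>(v, u). x (v + u) * f v * w u) z)) \<partial>(lborel \<Otimes>\<^sub>M lborel))"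
      by (subst lborel_pair.nn_integral_snd[symmetric]) auto
    also have "\<dots> < \<infinity>" using B unfolding integrable_iff_bounded by blast
    finally show "(\<integral>\<^sup>+z. ennreal (norm ((\<lambda>(v, u). x v * f (v - u) * w u) z)) \<partial>(lborel \<Otimes>\<^sub>M lborel)) <
        \<infinity>" .
  qed measurable
  have BB': "(LBINT v. LBINT u. x (v + u) * f v * w u) = (LBINT v. LBINT u. x v * f (v - u) * w u)"
    unfolding lborel_pair.Fubini_integral[OF B, symmetric] lborel_pair.Fubini_integral[OF B',
        symmetric] shift ..
  have "(LBINT v. (LBINT u. (x v - x (v + u)) * w u) * f v)
      = (LBINT v. (LBINT u. x v * f v * w u) - (LBINT u. x (v + u) * f v * w u))"
  proof (rule integral_cong_AE)
    show "AE v in lborel. (LBINT u. (x v - x (v + u)) * w u) * f v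
        = (LBINT u. x v * f v * w u) - (LBINT u. x (v + u) * f v * w u)"
      using lborel_pair.AE_integrable_fst[OF A] lborel_pair.AE_integrable_fst[OF B]
    proof eventually_elim
      case (elim v)
      have "(LBINT u. (x v - x (v + u)) * w u) * f v = (LBINT u. (x v - x (v + u)) * w u * f v)"
        by (rule integral_mult_left_zero[symmetric])
      also have "\<dots> = (LBINT u. x v * f v * w u - x (v + u) * f v * w u)"
        by (simp add: algebra_simps)
      finally show ?case unfolding Bochner_Integration.integral_diff[OF elim] .
    qed
  qed measurable
  also have "\<dots> = (LBINT v. LBINT u. x v * f v * w u) - (LBINT v. LBINT u. x (v + u) * f v * w u)"
    by (rule Bochner_Integration.integral_diff[OF lborel_pair.integrable_fst[OF A]
        lborel_pair.integrable_fst[OF B]])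
  also have "\<dots> = (LBINT v. (LBINT u. x v * f v * w u) - (LBINT u. x v * f (v - u) * w u))"
    unfolding BB'
    by (rule Bochner_Integration.integral_diff[OF lborel_pair.integrable_fst[OF A]
        lborel_pair.integrable_fst[OF B'], symmetric])
  also have "\<dots> = (LBINT v. x v * increment_integral w f v)"
  proof (rule integral_cong_AE)
    show "AE v in lborel. (LBINT u. x v * f v * w u) - (LBINT u. x v * f (v - u) * w u)
        = x v * increment_integral w f v"
      using lborel_pair.AE_integrable_fst[OF A] lborel_pair.AE_integrable_fst[OF B']
    proof eventually_elim
      case (elim v)
      have "x v * increment_integral w f v = (LBINT u. x v * ((f v - f (v - u)) * w u))"
        unfolding increment_integral_def by (rule integral_mult_right_zero[symmetric])
      also have "\<dots> = (LBINT u. x v * f v * w u - x v * f (v - u) * w u)"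
        by (simp add: algebra_simps)
      finally show ?case unfolding Bochner_Integration.integral_diff[OF elim] ..
    qed
  qed (unfold increment_integral_def, measurable)
  finally show ?thesis .
qed

context second_order_stationary
begin

text \<open>Almost every path satisfies the integrability conditions of the deterministic identity above,
  because \<open>X\<close> has bounded first moments and \<open>f(v) w(u)\<close> is integrable.\<close>

lemma weighted_transpose:
  assumes f: "integrable lborel f" and w: "integrable lborel w"
  shows "AE \<omega> in M. (LBINT v. weighted w (t - v) \<omega> * f v)
      = (LBINT v. X (t - v) \<omega> * increment_integral w f v)"
proof -
  let ?P = "lborel \<Otimes>\<^sub>M lborel :: (real \<times> real) measure"
  interpret PM: pair_sigma_finite ?P M
    by (intro pair_sigma_finite.intro lborel_pair.P.sigma_finite_measure_axioms
        sigma_finite_measure_axioms)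
  have [measurable]: "f \<in> borel_measurable borel" "w \<in> borel_measurable borel" using f w by auto
  have fw: "integrable ?P (\<lambda>p. f (fst p) * w (snd p))"
    using translated_product_integrable[OF f w, of 0] by (simp add: case_prod_beta')
  have int: "AE \<omega> in M. integrable ?P (\<lambda>p. X (h p) \<omega> * (f (fst p) * w (snd p)))"
    if [measurable]: "h \<in> borel_measurable borel" for h :: "real \<times> real \<Rightarrow> real"
  proof -
    have [measurable]: "h \<in> borel_measurable ?P"
      using that by (simp add: borel_prod[symmetric] cong: measurable_cong_sets)
    have "integrable (?P \<Otimes>\<^sub>M M) (\<lambda>(p, \<omega>). X (h p) \<omega> * (f (fst p) * w (snd p)))"
    proof (rule integrableI_bounded)
      show "(\<lambda>(p, \<omega>). X (h p) \<omega> * (f (fst p) * w (snd p))) \<in> borel_measurable (?P \<Otimes>\<^sub>M M)"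
        unfolding case_prod_beta' by measurable
      have "(\<integral>\<^sup>+z. ennreal (norm ((\<lambda>(p, \<omega>). X (h p) \<omega> * (f (fst p) * w (snd p))) z)) \<partial>(?P \<Otimes>\<^sub>M M))
          = (\<integral>\<^sup>+p. \<integral>\<^sup>+\<omega>. ennreal \<bar>X (h p) \<omega> * (f (fst p) * w (snd p))\<bar> \<partial>M \<partial>?P)"
        by (subst nn_integral_fst[symmetric]) (auto simp: case_prod_beta')
      also have "\<dots> = (\<integral>\<^sup>+p. (\<integral>\<^sup>+\<omega>. ennreal \<bar>X (h p) \<omega>\<bar> \<partial>M) * ennreal \<bar>f (fst p) * w (snd p)\<bar> \<partial>?P)"
        by (simp add: abs_mult[of "X _ _"] ennreal_mult nn_integral_multc)
      also have "\<dots> \<le> (\<integral>\<^sup>+p. ennreal (sqrt (\<gamma> 0)) * ennreal \<bar>f (fst p) * w (snd p)\<bar> \<partial>?P)"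
        by (intro nn_integral_mono mult_right_mono X_abs_bound) simp
      also have "\<dots> = ennreal (sqrt (\<gamma> 0)) * (\<integral>\<^sup>+p. ennreal \<bar>f (fst p) * w (snd p)\<bar> \<partial>?P)"
        by (rule nn_integral_cmult) measurable
      also have "(\<integral>\<^sup>+p. ennreal \<bar>f (fst p) * w (snd p)\<bar> \<partial>?P)
          = ennreal (\<integral>p. \<bar>f (fst p) * w (snd p)\<bar> \<partial>?P)"
        using fw by (intro nn_integral_eq_integral) auto
      also have "ennreal (sqrt (\<gamma> 0)) * ennreal (\<integral>p. \<bar>f (fst p) * w (snd p)\<bar> \<partial>?P) < \<infinity>"
        by (simp add: ennreal_mult_less_top)
      finally show "(\<integral>\<^sup>+z. ennreal (norm ((\<lambda>(p, \<omega>). X (h p) \<omega> * (f (fst p) * w (snd p))) z)) \<partial>(?P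
          \<Otimes>\<^sub>M M)) < \<infinity>" .
    qed
    from PM.AE_integrable_snd[OF this] show ?thesis .
  qed
  have m1: "(\<lambda>p. t - fst p) \<in> borel_measurable (borel :: (real \<times> real) measure)"
    and m2: "(\<lambda>p. t - (fst p + snd p)) \<in> borel_measurable (borel :: (real \<times> real) measure)"
    by (intro borel_measurable_continuous_onI continuous_intros)+
  show ?thesis
    using int[OF m1] int[OF m2] AE_space
  proof eventually_elim
    case (elim \<omega>)
    have [measurable]: "(\<lambda>v. X (t - v) \<omega>) \<in> borel_measurable borel"
      by (rule X_compose) (use elim(3) in auto)
    have "(LBINT v. (LBINT u. (X (t - v) \<omega> - X (t - (v + u)) \<omega>) * w u) * f v)
        = (LBINT v. X (t - v) \<omega> * increment_integral w f v)"
      by (rule increment_integral_transpose[of "\<lambda>v. X (t - v) \<omega>"])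
        (use elim(1,2) in \<open>simp_all add: case_prod_beta' mult.assoc\<close>)
    then show ?case by (simp add: increment_integral_def diff_diff_eq)
  qed
qed

text \<open>The difference of the two integrals is, for every \<open>n\<close>, the sum of a convolution of \<open>f\<close> with
  the error \<open>DX - weighted (w n)\<close> and a convolution of \<open>X\<close> with \<open>increment_integral (w n) f - F\<close>.  The
  first is small in \<open>L\<^sup>1(M)\<close> because the error is small uniformly in time, the second because its
  kernel is small in \<open>L\<^sup>1\<close>.\<close>

lemma frac_deriv_transpose:
  assumes w: "\<And>n. integrable lborel (w n)"
    and DX_process: "measurable_process M DX" and DX_L2: "\<And>t. in_L2 M (DX t)"
    and lim: "\<And>t. L2_tendsto M (\<lambda>n. weighted (w n) t) (DX t) sequentially"
    and f: "integrable lborel f" and F: "integrable lborel F"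
    and F_lim: "(\<lambda>n. \<integral>\<^sup>+v. ennreal \<bar>increment_integral (w n) f v - F v\<bar> \<partial>lborel) \<longlonglongrightarrow> 0"
  shows "AE \<omega> in M. integrable lborel (\<lambda>u. DX (t - u) \<omega> * f u) \<and> integrable lborel (\<lambda>u. X (t - u) \<omega>
      * F u)
     \<and> (LBINT u. DX (t - u) \<omega> * f u) = (LBINT u. X (t - u) \<omega> * F u)"
proof -
  define Z where "Z n s \<omega> = DX s \<omega> - weighted (w n) s \<omega>" for n s \<omega>
  have Z_L2: "in_L2 M (Z n s)" for n s
    unfolding Z_def by (intro in_L2_diff DX_L2 weighted_second_moment(1) w)
  have [measurable (raw)]: "(\<lambda>z. DX (f z) (h z)) \<in> borel_measurable N"
    if "f \<in> borel_measurable N" "h \<in> measurable N M" for f h and N :: "'z measure"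
    by (rule measurable_process_compose[OF DX_process that])
  have w_process: "measurable_process M (weighted (w n))" for n
    using w[of n] by (intro weighted_process) simp
  have Z_process: "measurable_process M (Z n)" for n
    unfolding Z_def
  proof (rule measurable_processI)
    have "(\<lambda>z. weighted (w n) (fst z) (snd z)) \<in> borel_measurable (borel \<Otimes>\<^sub>M M)"
      by (rule measurable_process_compose[OF w_process]) auto
    then show "(\<lambda>z. DX (fst z) (snd z) - weighted (w n) (fst z) (snd z)) \<in> borel_measurable (borel
        \<Otimes>\<^sub>M M)"
      by measurable
  qed
  have Z_small: "\<exists>N. \<forall>n\<ge>N. \<forall>s. (\<integral>\<^sup>+\<omega>. ennreal \<bar>Z n s \<omega>\<bar> \<partial>M) \<le> ennreal e" if e: "0 < e" for e
  proof -
    obtain N where N: "\<And>n t. N \<le> n \<Longrightarrow> expectation (\<lambda>\<omega>. (DX t \<omega> - weighted (w n) t \<omega>)\<^sup>2) \<le> e\<^sup>2"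
      using weighted_limit_uniform[OF w DX_L2 lim, of "e\<^sup>2"] e by auto
    have "(\<integral>\<^sup>+\<omega>. ennreal \<bar>Z n s \<omega>\<bar> \<partial>M) \<le> ennreal e" if "N \<le> n" for n s
    proof -
      have "sqrt (expectation (\<lambda>\<omega>. (Z n s \<omega>)\<^sup>2)) \<le> sqrt (e\<^sup>2)"
        unfolding Z_def by (intro real_sqrt_le_mono N that)
      then have "sqrt (expectation (\<lambda>\<omega>. (Z n s \<omega>)\<^sup>2)) \<le> e" using e by simp
      then show ?thesis using nn_integral_abs_le_sqrt[OF Z_L2] ennreal_leI order_trans by blast
    qed
    then show ?thesis by blast
  qed
  have X_conv: "AE \<omega> in M. integrable lborel (\<lambda>u. X (t - u) \<omega> * h u)" if "integrable lborel h" for h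
    by (rule convolution_integrable[OF X_process real_sqrt_ge_zero[OF gamma_0_nonneg] X_abs_bound
        that])
  have weighted_conv: "AE \<omega> in M. integrable lborel (\<lambda>u. weighted (w n) (t - u) \<omega> * f u)" for n
  proof (rule convolution_integrable[OF w_process _ _ f])
    let ?c = "sqrt (expectation (\<lambda>\<omega>. (weighted (w n) 0 \<omega>)\<^sup>2))"
    show "0 \<le> ?c" by simp
    show "(\<integral>\<^sup>+\<omega>. ennreal \<bar>weighted (w n) s \<omega>\<bar> \<partial>M) \<le> ennreal ?c" for s
      using nn_integral_abs_le_sqrt[OF weighted_second_moment(1)[OF w], of n s]
      by (simp only: weighted_second_moment(2)[OF w])
  qed
  obtain N1 where N1: "\<And>n s. N1 \<le> n \<Longrightarrow> (\<integral>\<^sup>+\<omega>. ennreal \<bar>Z n s \<omega>\<bar> \<partial>M) \<le> ennreal 1"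
    using Z_small[of 1] by auto
  have Z_conv: "AE \<omega> in M. integrable lborel (\<lambda>u. Z n (t - u) \<omega> * f u)" if "N1 \<le> n" for n
    by (rule convolution_integrable[OF Z_process _ N1[OF that] f]) simp
  have DX_conv: "AE \<omega> in M. integrable lborel (\<lambda>u. DX (t - u) \<omega> * f u)"
    using Z_conv[OF order_refl] weighted_conv[of N1]
  proof eventually_elim
    case (elim \<omega>)
    from Bochner_Integration.integrable_add[OF elim] show ?case
        by (simp add: Z_def left_diff_distrib)
  qed
  define d where "d n = (LBINT v. \<bar>increment_integral (w n) f v - F v\<bar>)" for n
  have diff_int: "integrable lborel (\<lambda>v. increment_integral (w n) f v - F v)" for n
    by (intro Bochner_Integration.integrable_diff increment_integral_integrable f w F)
  have "(\<integral>\<^sup>+v. ennreal \<bar>increment_integral (w n) f v - F v\<bar> \<partial>lborel) = ennreal (d n)" for n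
    unfolding d_def using diff_int[of n] by (intro nn_integral_eq_integral) auto
  then have d_lim: "d \<longlonglongrightarrow> 0"
    using F_lim by (intro ennreal_tendsto_0_iff[THEN iffD1]) (auto simp: d_def)
  define E where "E \<omega> = (LBINT u. DX (t - u) \<omega> * f u) - (LBINT u. X (t - u) \<omega> * F u)" for \<omega>
  have [measurable]: "E \<in> borel_measurable M"
  proof -
    have [measurable]: "f \<in> borel_measurable borel" "F \<in> borel_measurable borel" using f F by auto
    show ?thesis unfolding E_def[abs_def] by measurable
  qed
  have bound: "(\<integral>\<^sup>+\<omega>. ennreal \<bar>E \<omega>\<bar> \<partial>M) \<le> ennreal (e * (LBINT v. \<bar>f v\<bar>) + sqrt (\<gamma> 0) * d n)"
    if e: "0 < e" and n: "N1 \<le> n" "\<And>s. (\<integral>\<^sup>+\<omega>. ennreal \<bar>Z n s \<omega>\<bar> \<partial>M) \<le> ennreal e" for e n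
  proof -
    let ?a = "\<lambda>\<omega>. LBINT u. Z n (t - u) \<omega> * f u"
    let ?b = "\<lambda>\<omega>. LBINT u. X (t - u) \<omega> * (increment_integral (w n) f u - F u)"
    have [measurable]: "?a \<in> borel_measurable M" "?b \<in> borel_measurable M"
    proof -
      have [measurable]: "f \<in> borel_measurable borel"
          "(\<lambda>u. increment_integral (w n) f u - F u) \<in> borel_measurable borel"
        using f diff_int[of n] by (auto dest: borel_measurable_integrable)
      have [measurable]: "(\<lambda>z. Z n (t - snd z) (fst z)) \<in> borel_measurable (M \<Otimes>\<^sub>M lborel)"
        by (rule measurable_process_compose[OF Z_process]) measurable
      show "?a \<in> borel_measurable M"
        by (rule lborel.borel_measurable_lebesgue_integral) (simp add: case_prod_beta')
      show "?b \<in> borel_measurable M" by measurable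
    qed
    have "AE \<omega> in M. ennreal \<bar>E \<omega>\<bar> \<le> ennreal \<bar>?a \<omega>\<bar> + ennreal \<bar>?b \<omega>\<bar>"
      using weighted_transpose[OF f w[of n], of t] DX_conv weighted_conv[of n]
        X_conv[OF increment_integral_integrable[OF f w[of n]]] X_conv[OF F]
    proof eventually_elim
      case (elim \<omega>)
      have "?a \<omega> = (LBINT u. DX (t - u) \<omega> * f u) - (LBINT u. weighted (w n) (t - u) \<omega> * f u)"
        unfolding Z_def left_diff_distrib by (rule Bochner_Integration.integral_diff[OF elim(2,3)])
      moreover have "?b \<omega> = (LBINT u. X (t - u) \<omega> * increment_integral (w n) f u) - (LBINT u. X (t -
          u) \<omega> * F u)"
        unfolding right_diff_distrib by (rule Bochner_Integration.integral_diff[OF elim(4,5)])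
      ultimately have "E \<omega> = ?a \<omega> + ?b \<omega>" using elim(1) by (simp add: E_def)
      then have "\<bar>E \<omega>\<bar> \<le> \<bar>?a \<omega>\<bar> + \<bar>?b \<omega>\<bar>" by simp
      then have "ennreal \<bar>E \<omega>\<bar> \<le> ennreal (\<bar>?a \<omega>\<bar> + \<bar>?b \<omega>\<bar>)" by (rule ennreal_leI)
      then show ?case by simp
    qed
    then have "(\<integral>\<^sup>+\<omega>. ennreal \<bar>E \<omega>\<bar> \<partial>M) \<le> (\<integral>\<^sup>+\<omega>. ennreal \<bar>?a \<omega>\<bar> + ennreal \<bar>?b \<omega>\<bar> \<partial>M)"
      by (rule nn_integral_mono_AE)
    also have "\<dots> = (\<integral>\<^sup>+\<omega>. ennreal \<bar>?a \<omega>\<bar> \<partial>M) + (\<integral>\<^sup>+\<omega>. ennreal \<bar>?b \<omega>\<bar> \<partial>M)"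
      by (rule nn_integral_add) measurable
    also have "\<dots> \<le> ennreal (e * (LBINT v. \<bar>f v\<bar>)) + ennreal (sqrt (\<gamma> 0) * d n)"
      unfolding d_def
      by (intro add_mono convolution_L1_bound[OF Z_process _ n(2) f]
          convolution_L1_bound[OF X_process real_sqrt_ge_zero[OF gamma_0_nonneg] X_abs_bound
              diff_int])
        (use e in simp)
    also have "\<dots> = ennreal (e * (LBINT v. \<bar>f v\<bar>) + sqrt (\<gamma> 0) * d n)"
      using e gamma_0_nonneg by (intro ennreal_plus[symmetric]) (auto simp: d_def)
    finally show ?thesis .
  qed
  have "(\<integral>\<^sup>+\<omega>. ennreal \<bar>E \<omega>\<bar> \<partial>M) \<le> 0"
  proof (rule ennreal_le_epsilon)
    fix e :: real assume e: "0 < e"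
    define c where "c = (LBINT v. \<bar>f v\<bar>)"
    have c: "0 \<le> c" by (simp add: c_def)
    \<comment> \<open>Half of \<open>e\<close> for each convolution; \<open>c + 1\<close> avoids division by \<open>0\<close> when \<open>f\<close> vanishes.\<close>
    define e1 where "e1 = e / (2 * (c + 1))"
    have e1: "0 < e1" "e1 * c \<le> e / 2" using e c by (auto simp: e1_def field_simps)
    obtain N2 where N2: "\<And>n s. N2 \<le> n \<Longrightarrow> (\<integral>\<^sup>+\<omega>. ennreal \<bar>Z n s \<omega>\<bar> \<partial>M) \<le> ennreal e1"
      using Z_small[OF e1(1)] by auto
    have "(\<lambda>n. sqrt (\<gamma> 0) * d n) \<longlonglongrightarrow> 0" using tendsto_mult_left[OF d_lim, of "sqrt (\<gamma> 0)"] by simp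
    then have "eventually (\<lambda>n. sqrt (\<gamma> 0) * d n < e / 2) sequentially"
      by (rule order_tendstoD(2)) (use e in simp)
    then obtain N3 where N3: "\<And>n. N3 \<le> n \<Longrightarrow> sqrt (\<gamma> 0) * d n < e / 2"
      unfolding eventually_sequentially by blast
    let ?n = "max N1 (max N2 N3)"
    have "(\<integral>\<^sup>+\<omega>. ennreal \<bar>E \<omega>\<bar> \<partial>M) \<le> ennreal (e1 * c + sqrt (\<gamma> 0) * d ?n)"
      unfolding c_def by (intro bound e1 N2) auto
    also have "\<dots> \<le> ennreal e"
    proof (rule ennreal_leI)
      have "N3 \<le> ?n" by simp
      from N3[OF this] e1(2) show "e1 * c + sqrt (\<gamma> 0) * d ?n \<le> e" by linarith
    qed
    finally show "(\<integral>\<^sup>+\<omega>. ennreal \<bar>E \<omega>\<bar> \<partial>M) \<le> 0 + ennreal e" by simp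
  qed
  then have "(\<integral>\<^sup>+\<omega>. ennreal \<bar>E \<omega>\<bar> \<partial>M) = 0" by simp
  then have "AE \<omega> in M. ennreal \<bar>E \<omega>\<bar> = 0"
    by (subst (asm) nn_integral_0_iff_AE) auto
  then show ?thesis
    using DX_conv X_conv[OF F] by eventually_elim (simp add: E_def)
qed

end

theorem proposition4p2:
  fixes \<beta> :: real
    and A :: "real ^ 'n::{finite,linorder} ^ 'n::{finite,linorder}"
    and b :: "real ^ 'n::{finite,linorder}"
  assumes "0 < \<beta>" and "\<beta> < 1/2"
    and "\<And>z. eigenvalue (cmat A) z \<Longrightarrow> Re z < 0"
  shows "(integrable lborel (exp_kernel_frac_deriv \<beta> A b) \<and> in_L2 lborel (exp_kernel_frac_deriv \<beta> A b)) \<and>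
    (\<forall>(\<kappa>::real) (Q::real poly) (R::real poly) (g::real \<Rightarrow> real) (M::'w measure)
       (L::real \<Rightarrow> 'w \<Rightarrow> real) (X::real \<Rightarrow> 'w \<Rightarrow> real) (DX::real \<Rightarrow> 'w \<Rightarrow> real).
       \<kappa> + b \<bullet> (matrix_inv A *v e1) \<noteq> 0 \<longrightarrow>
       \<not> (\<exists>z::complex. poly (map_poly of_real Q) z = 0 \<and> poly (map_poly of_real R) z = 0) \<longrightarrow>
       lead_coeff Q = 1 \<longrightarrow>
       (R = 0 \<or> degree R < degree Q) \<longrightarrow>
       (\<forall>y::real.
          fourier (exp_kernel A b) y =
            - scalar_product (cvec b) (matrix_inv (cmat A + mat (\<i> * of_real y)) *v e1) \<and>
          - scalar_product (cvec b) (matrix_inv (cmat A + mat (\<i> * of_real y)) *v e1) =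
            - poly (map_poly of_real R) (- \<i> * of_real y) / poly (map_poly of_real Q) (- \<i> * of_real y)) \<longrightarrow>
       (\<forall>z::complex. z \<noteq> 0 \<longrightarrow> Re z \<ge> 0 \<longrightarrow>
          poly (map_poly of_real Q) z * (z + of_real \<kappa> * z powr of_real \<beta>)
            + poly (map_poly of_real R) z * z powr of_real \<beta> \<noteq> 0) \<longrightarrow>
       prob_space M \<longrightarrow>
       two_sided_levy_process M L \<longrightarrow>
       integrable M (L 1) \<longrightarrow> (\<integral>\<omega>. L 1 \<omega> \<partial>M) = 0 \<longrightarrow>
       integrable M (\<lambda>\<omega>. (L 1 \<omega>)\<^sup>2) \<longrightarrow> (\<integral>\<omega>. (L 1 \<omega>)\<^sup>2 \<partial>M) = 1 \<longrightarrow>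
       in_L2 lborel g \<longrightarrow>
       (\<forall>t<0. g t = 0) \<longrightarrow>
       has_fourier_L2 g (\<lambda>y. let w = - \<i> * of_real y in
          poly (map_poly of_real Q) w /
            (poly (map_poly of_real Q) w * (w + of_real \<kappa> * w powr of_real \<beta>)
              + poly (map_poly of_real R) w * w powr of_real \<beta>)) \<longrightarrow>
       measurable_process M X \<longrightarrow>
       (\<forall>t. has_levy_integral M L (\<lambda>u. indicator {..t} u * g (t - u)) (X t)) \<longrightarrow>
       measurable_process M DX \<longrightarrow>
       (\<forall>t. has_frac_deriv M \<beta> X t (DX t)) \<longrightarrow>
       (\<forall>t. AE \<omega> in M.
          set_integrable lborel {0..} (\<lambda>u. DX (t - u) \<omega> * exp_kernel A b u) \<and>
          set_integrable lborel {0..} (\<lambda>u. X (t - u) \<omega> * exp_kernel_frac_deriv \<beta> A b u) \<and>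
          (LBINT u:{0..}. DX (t - u) \<omega> * exp_kernel A b u) =
          (LBINT u:{0..}. X (t - u) \<omega> * exp_kernel_frac_deriv \<beta> A b u)))"
proof (intro conjI allI impI)
  note kernel = exp_kernel_frac_deriv_properties[where A = A and b = b, OF assms]
  show "integrable lborel (exp_kernel_frac_deriv \<beta> A b)" by (rule kernel(2))
  show "in_L2 lborel (exp_kernel_frac_deriv \<beta> A b)" by (rule kernel(3))
  fix g :: "real \<Rightarrow> real" and M :: "'w measure" and L X DX :: "real \<Rightarrow> 'w \<Rightarrow> real" and t :: real
  assume M: "prob_space M" and L: "two_sided_levy_process M L"
    and moments: "(\<integral>\<omega>. L 1 \<omega> \<partial>M) = 0" "integrable M (\<lambda>\<omega>. (L 1 \<omega>)\<^sup>2)" "(\<integral>\<omega>. (L 1 \<omega>)\<^sup>2 \<partial>M) = 1"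
    and X: "measurable_process M X"
        "\<forall>t. has_levy_integral M L (\<lambda>u. indicator {..t} u * g (t - u)) (X t)"
    and DX: "measurable_process M DX" "\<forall>t. has_frac_deriv M \<beta> X t (DX t)"
  interpret two_sided_standardized_levy M L
    using M L moments
        by (simp add: two_sided_standardized_levy_def two_sided_standardized_levy_axioms_def)
  define \<gamma> where "\<gamma> h = (LBINT u. (indicator {0..} u * g u) * (indicator {0..} (u + h) * g (u
      + h)))" for h
  interpret S: second_order_stationary M X \<gamma>
  proof
    show "measurable_process M X" by (rule X)
    show "in_L2 M (X s)" for s using X(2) by (simp add: has_levy_integral_def)
    show "expectation (\<lambda>\<omega>. X r \<omega> * X s \<omega>) = \<gamma> (s - r)" for r s
      unfolding \<gamma>_def by (rule moving_average_covariance) (use X(2) in blast)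
  qed
  define \<delta> where "\<delta> n = inverse (real (Suc n))" for n
  have \<delta>: "0 < \<delta> n" "\<delta> \<longlonglongrightarrow> 0" for n
    unfolding \<delta>_def[abs_def] using LIMSEQ_inverse_real_of_nat by auto
  have "\<delta> n \<noteq> 0" for n using \<delta>(1)[of n] by simp
  then have \<delta>_right: "filterlim \<delta> (at_right 0) sequentially" using \<delta> by (simp add: filterlim_at)
  have DX_L2: "in_L2 M (DX s)" for s using DX(2) by (simp add: has_frac_deriv_def)
  have lim: "L2_tendsto M (\<lambda>n. S.weighted (frac_weight \<beta> (\<delta> n)) s) (DX s) sequentially" for s
  proof -
    have eq: "\<beta> / Gamma (1 - \<beta>) * (LBINT u:{d..}. (X s \<omega> - X (s - u) \<omega>) / u powr (1 + \<beta>))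
        = S.weighted (frac_weight \<beta> d) s \<omega>" for d \<omega>
      unfolding increment_integral_def set_lebesgue_integral_def frac_weight_def
          integral_mult_right_zero[symmetric]
      by (intro Bochner_Integration.integral_cong) (auto simp: mult_ac)
    have "has_frac_deriv M \<beta> X s (DX s)" using DX(2) by blast
    then have "L2_tendsto M (\<lambda>d. S.weighted (frac_weight \<beta> d) s) (DX s) (at_right 0)"
      unfolding has_frac_deriv_def eq by blast
    then show ?thesis
      unfolding L2_tendsto_def by (rule filterlim_compose[OF _ \<delta>_right])
  qed
  have kernel_integrable: "integrable lborel (exp_kernel A b)"
      "integrable lborel (exp_kernel_frac_deriv \<beta> A b)"
    by ((rule kernel(1) | rule kernel(2)), assumption)+
  have truncation_limit: "(\<lambda>n. \<integral>\<^sup>+v. ennreal \<bar>increment_integral (frac_weight \<beta> (\<delta> n)) (exp_kernel A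
      b) v
      - exp_kernel_frac_deriv \<beta> A b v\<bar> \<partial>lborel) \<longlonglongrightarrow> 0"
    by (rule kernel(4)[OF _ \<delta>])
  have "AE \<omega> in M. integrable lborel (\<lambda>u. DX (t - u) \<omega> * exp_kernel A b u)
     \<and> integrable lborel (\<lambda>u. X (t - u) \<omega> * exp_kernel_frac_deriv \<beta> A b u)
     \<and> (LBINT u. DX (t - u) \<omega> * exp_kernel A b u)
         = (LBINT u. X (t - u) \<omega> * exp_kernel_frac_deriv \<beta> A b u)"
    by (rule S.frac_deriv_transpose[OF frac_weight_integrable[OF assms(1) \<delta>(1)] DX(1) DX_L2 lim
          kernel_integrable truncation_limit])
  \<comment> \<open>Both kernels vanish on the negative half-line, so integrals over \<open>{0..}\<close> and over the whole
      line agree.\<close>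
  moreover have "indicator {0..} u *\<^sub>R (c * exp_kernel A b u) = c * exp_kernel A b u"
    "indicator {0..} u *\<^sub>R (c * exp_kernel_frac_deriv \<beta> A b u) = c * exp_kernel_frac_deriv \<beta> A b u"
        for c u
    by (auto simp: exp_kernel_def exp_kernel_frac_deriv_def indicator_def)
  ultimately show "AE \<omega> in M.
          set_integrable lborel {0..} (\<lambda>u. DX (t - u) \<omega> * exp_kernel A b u) \<and>
          set_integrable lborel {0..} (\<lambda>u. X (t - u) \<omega> * exp_kernel_frac_deriv \<beta> A b u) \<and>
          (LBINT u:{0..}. DX (t - u) \<omega> * exp_kernel A b u) =
          (LBINT u:{0..}. X (t - u) \<omega> * exp_kernel_frac_deriv \<beta> A b u)"
    by (simp only: set_integrable_def set_lebesgue_integral_def)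
qed

end
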